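(* Let $\Phi$ be a root system of type $E_7$, and let $\omega\in W_{A_\circ}=\{1,\omega_7\}$. Then for every $q\in\mathbb{Z}_{>0}$: - if $\omega=1$ and $\gcd\{12,q\}=1$: $\chi_{\Phi,q}(\omega) = (q-1)(q-5)(q-7)(q-9)(q-11)(q-13)(q-17)$; - if $\omega=1$ and $\gcd\{12,q\}=2$: $\chi_{\Phi,q}(\omega) = (q-2)(q-10)(q-13)(q-14)(q^3-24q^2+155q-342)$; - if $\omega=1$ and $\gcd\{12,q\}=3$: $\chi_{\Phi,q}(\omega) = (q-3)(q-9)(q-15)(q^4-36q^3+438q^2-2052q+2289)$; - if $\omega=1$ and $\gcd\{12,q\}=4$: $\chi_{\Phi,q}(\omega) = (q-4)(q-5)(q-8)(q-16)(q^3-30q^2+263q-504)$; - if $\omega=1$ and $\gcd\{12,q\}=6$: $\chi_{\Phi,q}(\omega) = (q-6)(q^6-57q^5+1275q^4-14085q^3+79374q^2-213228q+234360)$; - if $\omega=1$ and $\gcd\{12,q\}=12$: $\chi_{\Phi,q}(\omega) = (q-12)(q^6-51q^5+1005q^4-9675q^3+47784q^2-116064q+120960)$; - if $\omega=\omega_7$ and $\gcd\{12,q\}\in\{1,3\}$: $\chi_{\Phi,q}(\omega)=0$; - if $\omega=\omega_7$ and $\gcd\{12,q\}=2$: $\chi_{\Phi,q}(\omega) = (q-2)(q-10)^2(q-14)$; - if $\omega=\omega_7$ and $\gcd\{12,q\}=4$: $\chi_{\Phi,q}(\omega) = (q-4)(q-8)^2(q-16)$; - if $\omega=\omega_7$ and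 $\gcd\{12,q\}=6$: $\chi_{\Phi,q}(\omega) = (q-6)(q^3-30q^2+268q-552)$; - if $\omega=\omega_7$ and $\gcd\{12,q\}=12$: $\chi_{\Phi,q}(\omega) = (q-12)(q^3-24q^2+160q-384)$.
   Context: Let $\Phi$ be the root system of type $E_7$ in a Euclidean space $E$ of dimension $7$ with inner product $(\cdot,\cdot)$, Weyl group $W$, and simple roots in Bourbaki numbering, e.g. $\alpha_1=\frac12(e_1-e_2-e_3-e_4-e_5-e_6-e_7+e_8)$, $\alpha_2=e_1+e_2$, $\alpha_3=e_2-e_1$, $\alpha_4=e_3-e_2$, $\alpha_5=e_4-e_3$, $\alpha_6=e_5-e_4$, $\alpha_7=e_6-e_5$ in $E=\{x\in\mathbb{R}^8: x_7=-x_8\}$. The coweight lattice is $Z := \{x\in E : (\alpha,x)\in\mathbb{Z}\ \forall\alpha\in\Phi\}$. For $q\in\mathbb{Z}_{>0}$, $M(\Phi;q) := \{x+qZ\in Z/qZ : (\beta,x)\not\equiv0\pmod q\ \forall\beta\in\Phi\}$; $W$ acts on it via $w(x+qZ)=w(x)+qZ$, and $\chi_{\Phi,q}(w) := \#\{t\in M(\Phi;q) : w(t)=t\}$. Let $\tilde\alpha=\sum_{i=1}^7 n_i\alpha_i$ be the highest root, $n_0:=1$, $J:=\{i\in\{0,\dots,7\}: n_i=1\}$ (here $J=\{0,7\}$). Let $w_0$ be the longest element of $W$; for $j\in J\setminus\{0\}$ let $w_j$ be the longest element of the subgroup generated by the simple reflections $s_{\alpha_i}$, $i\ne j$; put $\omega_j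 := w_jw_0$ and $\omega_0:=1$. Let $A_\circ=\{x\in E : (\alpha_i,x)>0\ \forall i,\ (\tilde\alpha,x)<1\}$; $W_{A_\circ}$ is the subgroup of $w\in W$ mapping the image of $A_\circ$ in $E/Z$ to itself, and $W_{A_\circ}=\{\omega_j : j\in J\}$. *)

theory Defs
  imports "HOL-Analysis.Analysis" "HOL-Library.Real_Mod"
begin

text \<open>The ambient Euclidean space is the whole type. Simple roots form a family \<open>\<alpha>\<close> restricted
  to a finite index set \<open>I\<close>, so that their numbering is available.\<close>

definition reflection :: "'a::euclidean_space \<Rightarrow> 'a \<Rightarrow> 'a" where
  "reflection a x = x - (2 * (a \<bullet> x) / (a \<bullet> a)) *\<^sub>R a"

definition root_system :: "'a::euclidean_space set \<Rightarrow> bool" where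
  "root_system \<Phi> \<longleftrightarrow>
     finite \<Phi> \<and> span \<Phi> = UNIV \<and> 0 \<notin> \<Phi> \<and>
     (\<forall>a\<in>\<Phi>. reflection a ` \<Phi> = \<Phi>) \<and>
     (\<forall>a\<in>\<Phi>. \<forall>b\<in>\<Phi>. 2 * (a \<bullet> b) / (a \<bullet> a) \<in> \<int>) \<and>
     (\<forall>a\<in>\<Phi>. \<forall>c::real. c *\<^sub>R a \<in> \<Phi> \<longrightarrow> c = 1 \<or> c = -1)"

definition nonneg_comb :: "(nat \<Rightarrow> 'a::euclidean_space) \<Rightarrow> nat set \<Rightarrow> 'a set" where
  "nonneg_comb \<alpha> I = {\<Sum>i\<in>I. real (c i) *\<^sub>R \<alpha> i | c :: nat \<Rightarrow> nat. True}"

definition simple_system :: "'a::euclidean_space set \<Rightarrow> (nat \<Rightarrow> 'a) \<Rightarrow> nat set \<Rightarrow> bool" where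
  "simple_system \<Phi> \<alpha> I \<longleftrightarrow>
     finite I \<and> inj_on \<alpha> I \<and> \<alpha> ` I \<subseteq> \<Phi> \<and> independent (\<alpha> ` I) \<and>
     (\<forall>\<beta>\<in>\<Phi>. \<beta> \<in> nonneg_comb \<alpha> I \<or> - \<beta> \<in> nonneg_comb \<alpha> I)"

text \<open>Bourbaki numbering: the Dynkin diagram is the chain 1-3-4-5-6-7 with 2 attached to 4.\<close>

definition E7_edges :: "nat set set" where
  "E7_edges = {{1,3}, {3,4}, {2,4}, {4,5}, {5,6}, {6,7}}"

definition E7_cartan :: "nat \<Rightarrow> nat \<Rightarrow> real" where
  "E7_cartan i j = (if i = j then 2 else if {i, j} \<in> E7_edges then -1 else 0)"

definition E7_root_system :: "'a::euclidean_space set \<Rightarrow> (nat \<Rightarrow> 'a) \<Rightarrow> bool" where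
  "E7_root_system \<Phi> \<alpha> \<longleftrightarrow>
     root_system \<Phi> \<and> simple_system \<Phi> \<alpha> {1..7} \<and>
     (\<forall>i\<in>{1..7}. \<forall>j\<in>{1..7}. 2 * (\<alpha> i \<bullet> \<alpha> j) / (\<alpha> j \<bullet> \<alpha> j) = E7_cartan i j)"

text \<open>The group generated by the reflections in the vectors of \<open>R\<close>; closure under inverses is
  automatic because reflections are involutions.\<close>

inductive_set reflection_group :: "'a::euclidean_space set \<Rightarrow> ('a \<Rightarrow> 'a) set"
  for R :: "'a set" where
    one: "id \<in> reflection_group R"
  | mult: "w \<in> reflection_group R \<Longrightarrow> a \<in> R \<Longrightarrow> reflection a \<circ> w \<in> reflection_group R"

definition word_product :: "(nat \<Rightarrow> 'a::euclidean_space) \<Rightarrow> nat list \<Rightarrow> 'a \<Rightarrow> 'a" where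
  "word_product \<alpha> is = foldr (\<lambda>i w. reflection (\<alpha> i) \<circ> w) is id"

definition coxeter_length ::
    "(nat \<Rightarrow> 'a::euclidean_space) \<Rightarrow> nat set \<Rightarrow> ('a \<Rightarrow> 'a) \<Rightarrow> nat" where
  "coxeter_length \<alpha> I w =
     (LEAST n. \<exists>is. set is \<subseteq> I \<and> length is = n \<and> w = word_product \<alpha> is)"

text \<open>The longest element of the subgroup generated by the simple reflections indexed by \<open>I\<close>.\<close>

definition longest_element :: "(nat \<Rightarrow> 'a::euclidean_space) \<Rightarrow> nat set \<Rightarrow> 'a \<Rightarrow> 'a" where
  "longest_element \<alpha> I =
     (THE w. w \<in> reflection_group (\<alpha> ` I) \<and>
        (\<forall>v\<in>reflection_group (\<alpha> ` I). coxeter_length \<alpha> I v \<le> coxeter_length \<alpha> I w))"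

definition omega :: "(nat \<Rightarrow> 'a::euclidean_space) \<Rightarrow> nat set \<Rightarrow> nat \<Rightarrow> 'a \<Rightarrow> 'a" where
  "omega \<alpha> I j =
     (if j = 0 then id else longest_element \<alpha> (I - {j}) \<circ> longest_element \<alpha> I)"

definition highest_root :: "'a::euclidean_space set \<Rightarrow> (nat \<Rightarrow> 'a) \<Rightarrow> nat set \<Rightarrow> 'a" where
  "highest_root \<Phi> \<alpha> I = (THE \<theta>. \<theta> \<in> \<Phi> \<and> (\<forall>\<beta>\<in>\<Phi>. \<theta> - \<beta> \<in> nonneg_comb \<alpha> I))"

definition fund_alcove :: "'a::euclidean_space set \<Rightarrow> (nat \<Rightarrow> 'a) \<Rightarrow> nat set \<Rightarrow> 'a set" where
  "fund_alcove \<Phi> \<alpha> I = {x. (\<forall>i\<in>I. \<alpha> i \<bullet> x > 0) \<and> highest_root \<Phi> \<alpha> I \<bullet> x < 1}"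

definition coweight_lattice :: "'a::euclidean_space set \<Rightarrow> 'a set" where
  "coweight_lattice \<Phi> = {x. \<forall>\<beta>\<in>\<Phi>. \<beta> \<bullet> x \<in> \<int>}"

text \<open>Elements of \<open>E/L\<close> are cosets, and a linear map preserving \<open>L\<close> acts on them by taking
  images, since \<open>w ` (x + L) = w x + L\<close>.\<close>

definition coset :: "'a::euclidean_space set \<Rightarrow> 'a \<Rightarrow> 'a set" where
  "coset L x = (\<lambda>z. x + z) ` L"

text \<open>The stabiliser in the Weyl group of the image of the fundamental alcove in \<open>E/Z\<close>.\<close>

definition alcove_stabilizer ::
    "'a::euclidean_space set \<Rightarrow> (nat \<Rightarrow> 'a) \<Rightarrow> nat set \<Rightarrow> ('a \<Rightarrow> 'a) set" where
  "alcove_stabilizer \<Phi> \<alpha> I =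
     {w \<in> reflection_group \<Phi>.
        (\<lambda>t. w ` t) ` (coset (coweight_lattice \<Phi>) ` fund_alcove \<Phi> \<alpha> I) =
        coset (coweight_lattice \<Phi>) ` fund_alcove \<Phi> \<alpha> I}"

definition scaled_lattice :: "'a::euclidean_space set \<Rightarrow> int \<Rightarrow> 'a set" where
  "scaled_lattice \<Phi> q = (\<lambda>z. of_int q *\<^sub>R z) ` coweight_lattice \<Phi>"

definition M :: "'a::euclidean_space set \<Rightarrow> int \<Rightarrow> 'a set set" where
  "M \<Phi> q = {coset (scaled_lattice \<Phi> q) x | x.
      x \<in> coweight_lattice \<Phi> \<and> (\<forall>\<beta>\<in>\<Phi>. \<not> [\<beta> \<bullet> x = 0] (rmod (of_int q)))}"

definition chi :: "'a::euclidean_space set \<Rightarrow> int \<Rightarrow> ('a \<Rightarrow> 'a) \<Rightarrow> int" where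
  "chi \<Phi> q w = int (card {t \<in> M \<Phi> q. w ` t = t})"

end

theory Submission
  imports Defs "HOL-Real_Asymp.Real_Asymp"
begin

text \<open>
  Let \<open>Z\<close> be the coweight lattice, \<open>W\<close> the Weyl group and \<open>S\<close> the set of coweights in the open
  alcove dilated by \<open>q\<close>. Every class in \<open>M \<Phi> q\<close> has a representative \<open>w y\<close> with \<open>w\<close> in \<open>W\<close> and
  \<open>y\<close> in \<open>S\<close>: in the orbit of a regular coweight under \<open>W\<close> and translations by \<open>q Z\<close>, a point nearest
  to the centre of the dilated alcove lies on the right side of all its walls
  (\<open>level_representative\<close>). The representation is unique up to the elements of \<open>W\<close> that, followed by
  a translation, preserve the alcove.

  These are the identity and one involution, the flip (\<open>weyl_alcove_cases\<close>). The reason is a count of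
  fractional parts: the affine simple roots satisfy one linear relation, with marks adding up to 18, and
  an isometry compatible with the alcove turns it into a sum of eight positive heights, weighted by
  the same marks and with total 18; so every height is 1, and the isometry permutes the affine
  simple roots (\<open>isometry_permutes_affine_roots\<close>). It is then an automorphism of the extended Dynkin
  diagram, which has only two. The same lemma, applied to isometries that need not lie in \<open>W\<close>, shows
  that an isometry preserving the positive roots is the identity. This makes the longest element
  of \<open>W\<close> equal to \<open>-1\<close>, and it identifies \<open>omega \<alpha> {1..7} 7\<close> with the flip, because that
  element preserves the positive roots of the parabolic \<open>E\<^sub>6\<close>, makes all other positive roots
  negative, and so preserves the alcove after a shift by the seventh fundamental coweight.

  Hence \<open>W \<times> S \<rightarrow> M \<Phi> q\<close> is two-to-one (\<open>card_M\<close>), and a class \<open>w y\<close> is fixed by the flip iff \<open>w\<close>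
  centralizes the flip and \<open>y\<close> is fixed by its affine lift (\<open>card_fixed\<close>). In coordinates \<open>S\<close> consists of
  the positive solutions of \<open>m0 + m7 + 2 (m1 + m2 + m6) + 3 (m3 + m5) + 4 m4 = q\<close>, and the lift swaps
  \<open>m0, m7\<close> and \<open>m1, m6\<close> and \<open>m3, m5\<close>. Adding one summand at a time shows that the numbers of all
  solutions and of symmetric solutions are quasi-polynomials in \<open>q\<close> with explicit tables.

  What remains are two constants, the orders of \<open>W\<close> and of the centralizer. They are read off
  from growth: all but \<open>O(q ^ 6)\<close> of the \<open>q ^ 7\<close> classes of \<open>Z / q Z\<close> are regular, and for even \<open>q\<close>
  the regular classes fixed by the flip number \<open>q ^ 4 + O(q ^ 3)\<close> if 3 does not divide \<open>q\<close>. Comparing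
  leading coefficients gives 2903040 and 9216 (\<open>card_weyl\<close>, \<open>card_centralizer\<close>).
\<close>

section \<open>Positive solutions of a linear equation\<close>

definition positive_solutions :: "nat list \<Rightarrow> nat \<Rightarrow> nat list set" where
  "positive_solutions ns q =
     {ms. length ms = length ns \<and> (\<forall>m\<in>set ms. 1 \<le> m) \<and> sum_list (map2 (*) ns ms) = q}"

abbreviation num_solutions :: "nat list \<Rightarrow> nat \<Rightarrow> nat" where
  "num_solutions ns q \<equiv> card (positive_solutions ns q)"

lemma positive_solutions_less:
  assumes "q < n" shows "positive_solutions (n # ns) q = {}"
proof -
  have False if "ms \<in> positive_solutions (n # ns) q" for ms
  proof (cases ms)
    case Nil then show False using that by (simp add: positive_solutions_def)
  next
    case (Cons m ms')
    then have "1 \<le> m" "n * m \<le> q" using that by (auto simp: positive_solutions_def)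
    then show False using assms by (metis mult.right_neutral mult_le_mono2 not_less order_trans)
  qed
  then show ?thesis by blast
qed

text \<open>A solution whose first entry is not 1 comes from one with right-hand side smaller by \<open>n\<close>, by
  lowering that entry.\<close>

lemma positive_solutions_add:
  "positive_solutions (n # ns) (q + n) =
     (#) 1 ` positive_solutions ns q \<union>
     (\<lambda>ms. Suc (hd ms) # tl ms) ` positive_solutions (n # ns) q" (is "?L = ?A \<union> ?B")
proof
  show "?L \<subseteq> ?A \<union> ?B"
  proof
    fix ms assume ms: "ms \<in> ?L"
    then obtain m ms' where ms': "ms = m # ms'" by (cases ms) (auto simp: positive_solutions_def)
    show "ms \<in> ?A \<union> ?B"
    proof (cases "m = 1")
      case True
      then show ?thesis using ms ms' by (auto simp: positive_solutions_def)
    next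
      case False
      then obtain k where k: "m = Suc k" "1 \<le> k"
        using ms ms' by (cases m) (auto simp: positive_solutions_def)
      then have "k # ms' \<in> positive_solutions (n # ns) q"
        using ms ms' by (auto simp: positive_solutions_def)
      then have "(\<lambda>ms. Suc (hd ms) # tl ms) (k # ms') \<in> ?B" by (rule imageI)
      then show ?thesis using k ms' by simp
    qed
  qed
  show "?A \<union> ?B \<subseteq> ?L"
  proof
    fix ms assume "ms \<in> ?A \<union> ?B"
    then consider ms' where "ms = 1 # ms'" "ms' \<in> positive_solutions ns q"
      | ms' where "ms = Suc (hd ms') # tl ms'" "ms' \<in> positive_solutions (n # ns) q" by blast
    then show "ms \<in> ?L"
    proof cases
      case 1 then show ?thesis by (auto simp: positive_solutions_def)
    next
      case 2 then show ?thesis by (cases ms') (auto simp: positive_solutions_def)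
    qed
  qed
qed

lemma finite_positive_solutions:
  assumes "\<forall>n\<in>set ns. 1 \<le> n" shows "finite (positive_solutions ns q)"
  using assms
proof (induction ns arbitrary: q)
  case Nil
  have "positive_solutions [] q \<subseteq> {[]}" by (auto simp: positive_solutions_def)
  then show ?case by (rule finite_subset) simp
next
  case (Cons n ns)
  show ?case
  proof (induction q rule: less_induct)
    case (less q)
    show ?case
    proof (cases "q < n")
      case True then show ?thesis by (simp add: positive_solutions_less)
    next
      case False
      then have "q = (q - n) + n" "q - n < q" using Cons.prems by auto
      then show ?thesis
        using less[of "q - n"] Cons positive_solutions_add[of n ns "q - n"] by simp
    qed
  qed
qed

lemma num_solutions_add:
  assumes "1 \<le> n" "\<forall>n\<in>set ns. 1 \<le> n"
  shows "num_solutions (n # ns) (q + n) = num_solutions ns q + num_solutions (n # ns) q"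
proof -
  have inj: "inj_on (\<lambda>ms. Suc (hd ms) # tl ms) (positive_solutions (n # ns) q)"
  proof (rule inj_onI)
    fix x y assume "x \<in> positive_solutions (n # ns) q" "y \<in> positive_solutions (n # ns) q"
      "Suc (hd x) # tl x = Suc (hd y) # tl y"
    then show "x = y" by (cases x; cases y) (auto simp: positive_solutions_def)
  qed
  have disj: "(#) 1 ` positive_solutions ns q \<inter>
      (\<lambda>ms. Suc (hd ms) # tl ms) ` positive_solutions (n # ns) q = {}"
  proof -
    have "1 \<le> hd ms" if "ms \<in> positive_solutions (n # ns) q" for ms
      using that by (cases ms) (auto simp: positive_solutions_def)
    then show ?thesis by fastforce
  qed
  show ?thesis
    unfolding positive_solutions_add
    by (subst card_Un_disjoint)
       (use assms disj in \<open>auto simp: finite_positive_solutions card_image inj\<close>)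
qed

lemma num_solutions_zero:
  assumes "ns \<noteq> []" "\<forall>n\<in>set ns. 1 \<le> n" shows "num_solutions ns 0 = 0"
proof -
  obtain n ns' where "ns = n # ns'" using assms(1) by (cases ns) auto
  then show ?thesis using assms(2) positive_solutions_less[of 0 n ns'] by simp
qed

text \<open>\<open>T\<close> has one row of coefficients, constant term first, for each residue class modulo its length.\<close>

definition quasi_poly :: "int list list \<Rightarrow> int \<Rightarrow> int" where
  "quasi_poly T q = horner_sum id q (T ! nat (q mod int (length T)))"

text \<open>Both sides satisfy the recurrence of \<open>num_solutions_add\<close>. They also agree on \<open>{1..n}\<close>, where no
  solution exists: its first summand is at least \<open>n\<close> and the others, of which there is at least
  one, are positive.\<close>

lemma num_solutions_quasi_poly_step:
  assumes n: "1 \<le> n" and ns: "ns \<noteq> []" "\<forall>m\<in>set ns. 1 \<le> m"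
    and S: "\<And>q. 1 \<le> q \<Longrightarrow> D * int (num_solutions ns q) = quasi_poly S (int q)"
    and rec: "\<And>q. quasi_poly T (q + int n) = quasi_poly T q + e * quasi_poly S q"
    and zero: "\<forall>q\<in>set [1..<Suc n]. quasi_poly T (int q) = 0"
    and q: "1 \<le> q"
  shows "e * D * int (num_solutions (n # ns) q) = quasi_poly T (int q)"
  using q
proof (induction q rule: less_induct)
  case (less q)
  consider "q < n" | "q = n" | "n < q" by linarith
  then show ?case
  proof cases
    case 1
    then show ?thesis using zero less.prems by (auto simp: positive_solutions_less)
  next
    case 2
    then have "num_solutions (n # ns) q = 0"
      using num_solutions_add[of n ns 0] n ns positive_solutions_less[of 0 n ns]
      by (simp add: num_solutions_zero)
    then show ?thesis using zero 2 n by auto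
  next
    case 3
    define p where "p = q - n"
    have p: "q = p + n" "1 \<le> p" "p < q" using 3 n by (auto simp: p_def)
    have "e * D * int (num_solutions (n # ns) q)
        = e * (D * int (num_solutions ns p)) + e * D * int (num_solutions (n # ns) p)"
      unfolding p(1) using num_solutions_add[of n ns p] n ns by (simp add: algebra_simps)
    also have "\<dots> = e * quasi_poly S (int p) + quasi_poly T (int p)"
      using S[OF p(2)] less.IH[OF p(3,2)] by simp
    finally show ?thesis using rec[of "int p"] p(1) by simp
  qed
qed

lemma int_mod_12_cases:
  fixes q :: int
  obtains "q mod 12 = 0" | "q mod 12 = 1" | "q mod 12 = 2" | "q mod 12 = 3" | "q mod 12 = 4"
    | "q mod 12 = 5" | "q mod 12 = 6" | "q mod 12 = 7" | "q mod 12 = 8" | "q mod 12 = 9"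
    | "q mod 12 = 10" | "q mod 12 = 11"
proof -
  have "q mod 12 = 0 \<or> q mod 12 = 1 \<or> q mod 12 = 2 \<or> q mod 12 = 3 \<or> q mod 12 = 4 \<or>
      q mod 12 = 5 \<or> q mod 12 = 6 \<or> q mod 12 = 7 \<or> q mod 12 = 8 \<or> q mod 12 = 9 \<or>
      q mod 12 = 10 \<or> q mod 12 = 11"
    by presburger
  then show ?thesis by (elim disjE) (erule that)+
qed

lemma divisor_of_12_mod:
  fixes q :: int
  shows "q mod 2 = q mod 12 mod 2" "q mod 4 = q mod 12 mod 4" "q mod 6 = q mod 12 mod 6"
  by (simp_all add: mod_mod_cancel)

lemma mod_add_12: "(q + n) mod 12 = (q mod 12 + n) mod 12" for q n :: int
  by (simp add: mod_add_left_eq)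

lemma num_solutions_single:
  assumes "1 \<le> q" shows "num_solutions [1] q = 1"
proof -
  have "positive_solutions [1] q = {[q]}"
    using assms by (auto simp: positive_solutions_def length_Suc_conv)
  then have "num_solutions [1] q = card {[q]}" by (rule arg_cong)
  then show ?thesis by simp
qed

text \<open>The tables describe the number of solutions times the least common denominator, which makes
  every leading coefficient 1. The weights 1, 1, 2, 2, 2, 4, 3, 3 are the marks of the extended
  diagram, and the period becomes 12 only when the first 3 enters. The last table branches off after
  1, 1, 2, 2 and counts the solutions symmetric under the flip.\<close>

definition table_1 :: "int list list" where "table_1 = [[1]]"

lemma num_solutions_1:
  assumes "1 \<le> q" shows "1 * int (num_solutions [1] q) = quasi_poly table_1 (int q)"
  using num_solutions_single[OF assms] by (simp add: quasi_poly_def table_1_def)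

definition table_11 :: "int list list" where
  "table_11 =
     [[-1, 1]]"

lemma num_solutions_11:
  assumes "1 \<le> q" shows "1 * int (num_solutions [1, 1] q) = quasi_poly table_11 (int q)"
proof -
  have "quasi_poly table_11 (q + 1) = quasi_poly table_11 q + 1 * quasi_poly table_1 q" for q :: int
    by (rule int_mod_12_cases[of q])
       (simp_all add: quasi_poly_def table_11_def table_1_def mod_add_12[of q]
          divisor_of_12_mod[of q] divisor_of_12_mod[of "q + 1"] algebra_simps)
  then show ?thesis
    using num_solutions_quasi_poly_step[of 1 "[1]" 1 table_1 table_11 1 q]
      assms num_solutions_1
    by (simp add: quasi_poly_def table_11_def upt_rec)
qed

definition table_211 :: "int list list" where
  "table_211 =
     [[4, -4, 1],
      [3, -4, 1]]"

lemma num_solutions_211: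
  assumes "1 \<le> q" shows "4 * int (num_solutions [2, 1, 1] q) = quasi_poly table_211 (int q)"
proof -
  have "quasi_poly table_211 (q + 2) = quasi_poly table_211 q + 4 * quasi_poly table_11 q" for q :: int
    by (rule int_mod_12_cases[of q])
       (simp_all add: quasi_poly_def table_211_def table_11_def mod_add_12[of q]
          divisor_of_12_mod[of q] divisor_of_12_mod[of "q + 2"] algebra_simps)
  then show ?thesis
    using num_solutions_quasi_poly_step[of 2 "[1, 1]" 1 table_11 table_211 4 q]
      assms num_solutions_11
    by (simp add: quasi_poly_def table_211_def upt_rec)
qed

definition table_2211 :: "int list list" where
  "table_2211 =
     [[-24, 26, -9, 1],
      [-15, 23, -9, 1]]"

lemma num_solutions_2211:
  assumes "1 \<le> q" shows "24 * int (num_solutions [2, 2, 1, 1] q) = quasi_poly table_2211 (int q)"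
proof -
  have "quasi_poly table_2211 (q + 2) = quasi_poly table_2211 q + 6 * quasi_poly table_211 q" for q :: int
    by (rule int_mod_12_cases[of q])
       (simp_all add: quasi_poly_def table_2211_def table_211_def mod_add_12[of q]
          divisor_of_12_mod[of q] divisor_of_12_mod[of "q + 2"] algebra_simps)
  then show ?thesis
    using num_solutions_quasi_poly_step[of 2 "[2, 1, 1]" 4 table_211 table_2211 6 q]
      assms num_solutions_211
    by (simp add: quasi_poly_def table_2211_def upt_rec)
qed

definition table_22211 :: "int list list" where
  "table_22211 =
     [[192, -224, 92, -16, 1],
      [105, -176, 86, -16, 1]]"

lemma num_solutions_22211:
  assumes "1 \<le> q" shows "192 * int (num_solutions [2, 2, 2, 1, 1] q) = quasi_poly table_22211 (int q)"
proof -
  have "quasi_poly table_22211 (q + 2) = quasi_poly table_22211 q + 8 * quasi_poly table_2211 q" for q :: int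
    by (rule int_mod_12_cases[of q])
       (simp_all add: quasi_poly_def table_22211_def table_2211_def mod_add_12[of q]
          divisor_of_12_mod[of q] divisor_of_12_mod[of "q + 2"] algebra_simps)
  then show ?thesis
    using num_solutions_quasi_poly_step[of 2 "[2, 2, 1, 1]" 24 table_2211 table_22211 8 q]
      assms num_solutions_2211
    by (simp add: quasi_poly_def table_22211_def upt_rec)
qed

definition table_422211 :: "int list list" where
  "table_422211 =
     [[-3840, 4384, -1800, 340, -30, 1],
      [-2070, 3389, -1620, 330, -30, 1],
      [-3840, 4384, -1800, 340, -30, 1],
      [-2310, 3389, -1620, 330, -30, 1]]"

lemma num_solutions_422211:
  assumes "1 \<le> q" shows "3840 * int (num_solutions [4, 2, 2, 2, 1, 1] q) = quasi_poly table_422211 (int q)"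
proof -
  have "quasi_poly table_422211 (q + 4) = quasi_poly table_422211 q + 20 * quasi_poly table_22211 q" for q :: int
    by (rule int_mod_12_cases[of q])
       (simp_all add: quasi_poly_def table_422211_def table_22211_def mod_add_12[of q]
          divisor_of_12_mod[of q] divisor_of_12_mod[of "q + 4"] algebra_simps)
  then show ?thesis
    using num_solutions_quasi_poly_step[of 4 "[2, 2, 2, 1, 1]" 192 table_22211 table_422211 20 q]
      assms num_solutions_22211
    by (simp add: quasi_poly_def table_422211_def upt_rec)
qed

definition table_3422211 :: "int list list" where
  "table_3422211 =
     [[69120, -74880, 32544, -7020, 795, -45, 1],
      [36725, -61065, 30519, -6930, 795, -45, 1],
      [64400, -74880, 32544, -7020, 795, -45, 1],
      [41445, -61065, 30519, -6930, 795, -45, 1],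
      [66560, -74880, 32544, -7020, 795, -45, 1],
      [36725, -61065, 30519, -6930, 795, -45, 1],
      [66960, -74880, 32544, -7020, 795, -45, 1],
      [38885, -61065, 30519, -6930, 795, -45, 1],
      [66560, -74880, 32544, -7020, 795, -45, 1],
      [39285, -61065, 30519, -6930, 795, -45, 1],
      [64400, -74880, 32544, -7020, 795, -45, 1],
      [38885, -61065, 30519, -6930, 795, -45, 1]]"

lemma num_solutions_3422211:
  assumes "1 \<le> q" shows "69120 * int (num_solutions [3, 4, 2, 2, 2, 1, 1] q) = quasi_poly table_3422211 (int q)"
proof -
  have "quasi_poly table_3422211 (q + 3) = quasi_poly table_3422211 q + 18 * quasi_poly table_422211 q" for q :: int
    by (rule int_mod_12_cases[of q])
       (simp_all add: quasi_poly_def table_3422211_def table_422211_def mod_add_12[of q]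
          divisor_of_12_mod[of q] divisor_of_12_mod[of "q + 3"] algebra_simps)
  then show ?thesis
    using num_solutions_quasi_poly_step[of 3 "[4, 2, 2, 2, 1, 1]" 3840 table_422211 table_3422211 18 q]
      assms num_solutions_422211
    by (simp add: quasi_poly_def table_3422211_def upt_rec)
qed

definition table_33422211 :: "int list list" where
  "table_33422211 =
     [[-1451520, 1513728, -689472, 163884, -21735, 1617, -63, 1],
      [-765765, 1286963, -663957, 162939, -21735, 1617, -63, 1],
      [-1244880, 1495808, -689472, 163884, -21735, 1617, -63, 1],
      [-927045, 1304883, -663957, 162939, -21735, 1617, -63, 1],
      [-1290240, 1495808, -689472, 163884, -21735, 1617, -63, 1],
      [-765765, 1286963, -663957, 162939, -21735, 1617, -63, 1],
      [-1406160, 1513728, -689472, 163884, -21735, 1617, -63, 1],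
      [-765765, 1286963, -663957, 162939, -21735, 1617, -63, 1],
      [-1290240, 1495808, -689472, 163884, -21735, 1617, -63, 1],
      [-927045, 1304883, -663957, 162939, -21735, 1617, -63, 1],
      [-1244880, 1495808, -689472, 163884, -21735, 1617, -63, 1],
      [-765765, 1286963, -663957, 162939, -21735, 1617, -63, 1]]"

lemma num_solutions_33422211:
  assumes "1 \<le> q" shows "1451520 * int (num_solutions [3, 3, 4, 2, 2, 2, 1, 1] q) = quasi_poly table_33422211 (int q)"
proof -
  have "quasi_poly table_33422211 (q + 3) = quasi_poly table_33422211 q + 21 * quasi_poly table_3422211 q" for q :: int
    by (rule int_mod_12_cases[of q])
       (simp_all add: quasi_poly_def table_33422211_def table_3422211_def mod_add_12[of q]
          divisor_of_12_mod[of q] divisor_of_12_mod[of "q + 3"] algebra_simps)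
  then show ?thesis
    using num_solutions_quasi_poly_step[of 3 "[3, 4, 2, 2, 2, 1, 1]" 69120 table_3422211 table_33422211 21 q]
      assms num_solutions_3422211
    by (simp add: quasi_poly_def table_33422211_def upt_rec)
qed

definition table_32211 :: "int list list" where
  "table_32211 =
     [[288, -288, 112, -18, 1],
      [175, -270, 112, -18, 1],
      [256, -288, 112, -18, 1],
      [207, -270, 112, -18, 1],
      [256, -288, 112, -18, 1],
      [175, -270, 112, -18, 1]]"

lemma num_solutions_32211:
  assumes "1 \<le> q" shows "288 * int (num_solutions [3, 2, 2, 1, 1] q) = quasi_poly table_32211 (int q)"
proof -
  have "quasi_poly table_32211 (q + 3) = quasi_poly table_32211 q + 12 * quasi_poly table_2211 q" for q :: int
    by (rule int_mod_12_cases[of q])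
       (simp_all add: quasi_poly_def table_32211_def table_2211_def mod_add_12[of q]
          divisor_of_12_mod[of q] divisor_of_12_mod[of "q + 3"] algebra_simps)
  then show ?thesis
    using num_solutions_quasi_poly_step[of 3 "[2, 2, 1, 1]" 24 table_2211 table_32211 12 q]
      assms num_solutions_2211
    by (simp add: quasi_poly_def table_32211_def upt_rec)
qed

section \<open>The positive roots of \<open>E\<^sub>7\<close> in simple coordinates\<close>

text \<open>The 63 positive roots by increasing height, as coefficients with respect to the simple roots.\<close>

definition E7_positive :: "int list list" where
  "E7_positive =
   [[1, 0, 0, 0, 0, 0, 0], [0, 1, 0, 0, 0, 0, 0], [0, 0, 1, 0, 0, 0, 0],
    [0, 0, 0, 1, 0, 0, 0], [0, 0, 0, 0, 1, 0, 0], [0, 0, 0, 0, 0, 1, 0],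
    [0, 0, 0, 0, 0, 0, 1], [1, 0, 1, 0, 0, 0, 0], [0, 1, 0, 1, 0, 0, 0],
    [0, 0, 1, 1, 0, 0, 0], [0, 0, 0, 1, 1, 0, 0], [0, 0, 0, 0, 1, 1, 0],
    [0, 0, 0, 0, 0, 1, 1], [1, 0, 1, 1, 0, 0, 0], [0, 1, 1, 1, 0, 0, 0],
    [0, 1, 0, 1, 1, 0, 0], [0, 0, 1, 1, 1, 0, 0], [0, 0, 0, 1, 1, 1, 0],
    [0, 0, 0, 0, 1, 1, 1], [1, 1, 1, 1, 0, 0, 0], [1, 0, 1, 1, 1, 0, 0],
    [0, 1, 1, 1, 1, 0, 0], [0, 1, 0, 1, 1, 1, 0], [0, 0, 1, 1, 1, 1, 0],
    [0, 0, 0, 1, 1, 1, 1], [1, 1, 1, 1, 1, 0, 0], [1, 0, 1, 1, 1, 1, 0],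
    [0, 1, 1, 2, 1, 0, 0], [0, 1, 1, 1, 1, 1, 0], [0, 1, 0, 1, 1, 1, 1],
    [0, 0, 1, 1, 1, 1, 1], [1, 1, 1, 2, 1, 0, 0], [1, 1, 1, 1, 1, 1, 0],
    [1, 0, 1, 1, 1, 1, 1], [0, 1, 1, 2, 1, 1, 0], [0, 1, 1, 1, 1, 1, 1],
    [1, 1, 2, 2, 1, 0, 0], [1, 1, 1, 2, 1, 1, 0], [1, 1, 1, 1, 1, 1, 1],
    [0, 1, 1, 2, 2, 1, 0], [0, 1, 1, 2, 1, 1, 1], [1, 1, 2, 2, 1, 1, 0],
    [1, 1, 1, 2, 2, 1, 0], [1, 1, 1, 2, 1, 1, 1], [0, 1, 1, 2, 2, 1, 1],
    [1, 1, 2, 2, 2, 1, 0], [1, 1, 2, 2, 1, 1, 1], [1, 1, 1, 2, 2, 1, 1],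
    [0, 1, 1, 2, 2, 2, 1], [1, 1, 2, 3, 2, 1, 0], [1, 1, 2, 2, 2, 1, 1],
    [1, 1, 1, 2, 2, 2, 1], [1, 2, 2, 3, 2, 1, 0], [1, 1, 2, 3, 2, 1, 1],
    [1, 1, 2, 2, 2, 2, 1], [1, 2, 2, 3, 2, 1, 1], [1, 1, 2, 3, 2, 2, 1],
    [1, 2, 2, 3, 2, 2, 1], [1, 1, 2, 3, 3, 2, 1], [1, 2, 2, 3, 3, 2, 1],
    [1, 2, 2, 4, 3, 2, 1], [1, 2, 3, 4, 3, 2, 1], [2, 2, 3, 4, 3, 2, 1]]"

text \<open>The inner product in simple coordinates, normalized so that roots have norm 2.\<close>

definition E7_gram :: "int list \<Rightarrow> int list \<Rightarrow> int" where
  "E7_gram c d =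
     (case (c, d) of ([c1, c2, c3, c4, c5, c6, c7], [d1, d2, d3, d4, d5, d6, d7]) \<Rightarrow>
        2 * (c1*d1 + c2*d2 + c3*d3 + c4*d4 + c5*d5 + c6*d6 + c7*d7)
        - (c1*d3 + c3*d1) - (c3*d4 + c4*d3) - (c2*d4 + c4*d2) - (c4*d5 + c5*d4)
        - (c5*d6 + c6*d5) - (c6*d7 + c7*d6)
      | _ \<Rightarrow> 0)"

text \<open>Node 0 of the extended diagram is the lowest root, the negative of the highest one.\<close>

definition affine_simple :: "nat \<Rightarrow> int list" where
  "affine_simple i =
     (if i = 0 then [-2, -2, -3, -4, -3, -2, -1] else (replicate 7 0)[i - 1 := 1])"

definition refl_coeffs :: "nat \<Rightarrow> int list \<Rightarrow> int list" where
  "refl_coeffs i c = c[i - 1 := c ! (i - 1) - E7_gram c (affine_simple i)]"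

text \<open>A simple reflection permutes the positive roots other than its own simple root. A root orthogonal
  to the simple root is fixed, which spares a search in the list.\<close>

lemma refl_positive:
  "\<forall>c\<in>set E7_positive. \<forall>i\<in>set [1,2,3,4,5,6,7].
     E7_gram c (affine_simple i) = 0 \<or> c = affine_simple i \<or> refl_coeffs i c \<in> set E7_positive"
  by code_simp

text \<open>A nonnegative combination of simple roots that pairs nonpositively with all of them would have
  nonpositive norm. So some simple reflection lowers the height of a given positive root.\<close>

lemma ex_descent:
  "\<forall>c\<in>set E7_positive. \<not> (\<forall>i\<in>set [1,2,3,4,5,6,7]. E7_gram c (affine_simple i) \<le> 0)"
  by code_simp

lemma length_positive: "\<forall>c\<in>set E7_positive. length c = 7"
  by code_simp

lemma below_highest:
  "\<forall>c\<in>set E7_positive. \<forall>i\<in>set [0,1,2,3,4,5,6]. 0 \<le> c ! i \<and> c ! i \<le> - (affine_simple 0 ! i)"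
  by code_simp

lemma height_one: "\<forall>c\<in>set E7_positive. sum_list c = 1 \<longrightarrow> (\<exists>i\<in>set [1,2,3,4,5,6,7]. c = affine_simple i)"
  by code_simp

text \<open>The Coxeter number is 18: heights stop at 17, and only the highest root attains this value.\<close>

lemma height_bounds: "\<forall>c\<in>set E7_positive. 1 \<le> sum_list c \<and> sum_list c \<le> 17 \<and> (sum_list c = 17 \<longrightarrow> c = map uminus (affine_simple 0))"
  by code_simp

text \<open>The reflection of the extended diagram 0-1-3-4-5-6-7, with 2 attached to 4, in its middle.\<close>

definition affine_flip :: "nat \<Rightarrow> nat" where
  "affine_flip i = [7,6,2,5,4,3,1,0] ! i"

definition affine_neighbours :: "nat \<Rightarrow> nat list" where
  "affine_neighbours i =
     filter (\<lambda>j. E7_gram (affine_simple i) (affine_simple j) = -1) [0, 1, 2, 3, 4, 5, 6, 7]"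

text \<open>The variables trace the image of the diagram, starting at the centre 4 and running outwards along the
  three arms. Deleting the nodes already used encodes injectivity; only node 4 has three neighbours,
  so the walk can be completed in just two ways.\<close>

lemma affine_diagram_automorphisms:
  "\<forall>p4\<in>set [0,1,2,3,4,5,6,7]. \<forall>p2\<in>set (affine_neighbours p4).
   \<forall>p3\<in>set (removeAll p2 (affine_neighbours p4)).
   \<forall>p5\<in>set (removeAll p2 (removeAll p3 (affine_neighbours p4))).
   \<forall>p1\<in>set (removeAll p4 (affine_neighbours p3)).
   \<forall>p6\<in>set (removeAll p4 (affine_neighbours p5)).
   \<forall>p0\<in>set (removeAll p3 (affine_neighbours p1)).
   \<forall>p7\<in>set (removeAll p5 (affine_neighbours p6)).
     [p0,p1,p2,p3,p4,p5,p6,p7] = [0,1,2,3,4,5,6,7] \<or>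
     [p0,p1,p2,p3,p4,p5,p6,p7] = map affine_flip [0,1,2,3,4,5,6,7]"
  by code_simp

lemma sum_1_7: "(\<Sum>i\<in>{1..7::nat}. f i) = f 1 + f 2 + f 3 + f 4 + f 5 + f 6 + f 7"
  for f :: "nat \<Rightarrow> 'b::comm_monoid_add"
proof -
  have "{1..7::nat} = {1, 2, 3, 4, 5, 6, 7}" by auto
  then show ?thesis by (simp add: add.assoc)
qed

lemma in_1_7_iff: "i \<in> {1..7::nat} \<longleftrightarrow> i \<in> set [1, 2, 3, 4, 5, 6, 7]"
  by auto

lemma ball_1_7: "(\<forall>i\<in>{1..7::nat}. P i) \<longleftrightarrow> P 1 \<and> P 2 \<and> P 3 \<and> P 4 \<and> P 5 \<and> P 6 \<and> P 7"
proof -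
  have "{1..7::nat} = set [1, 2, 3, 4, 5, 6, 7]" by auto
  then show ?thesis by simp
qed

lemma length_7_cases:
  assumes "length c = 7"
  obtains c1 c2 c3 c4 c5 c6 c7 where "c = [c1, c2, c3, c4, c5, c6, c7]"
  using assms by (auto simp: length_Suc_conv eval_nat_numeral)

lemma E7_gram_sum:
  assumes "length c = 7" "length d = 7"
  shows "E7_gram c d = (\<Sum>i\<in>{1..7}. d ! (i - 1) * E7_gram c (affine_simple i))"
  using assms
  by (elim length_7_cases)
     (simp add: sum_1_7 E7_gram_def affine_simple_def numeral_eq_Suc algebra_simps)

lemma length_affine_simple [simp]: "length (affine_simple i) = 7"
  by (simp add: affine_simple_def)

lemma length_refl_coeffs [simp]: "length (refl_coeffs i c) = length c"
  by (simp add: refl_coeffs_def)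

lemma gram_refl_coeffs:
  assumes "length c = 7" "i \<in> {1..7}"
  shows "E7_gram (refl_coeffs i c) (affine_simple i) = - E7_gram c (affine_simple i)"
  using assms unfolding in_1_7_iff
  by (elim length_7_cases)
     (auto simp: refl_coeffs_def E7_gram_def affine_simple_def numeral_eq_Suc)

lemma refl_coeffs_refl_coeffs:
  assumes "length c = 7" "i \<in> {1..7}"
  shows "refl_coeffs i (refl_coeffs i c) = c"
proof -
  have "E7_gram (c[i - 1 := c ! (i - 1) - E7_gram c (affine_simple i)]) (affine_simple i) =
      - E7_gram c (affine_simple i)"
    using gram_refl_coeffs[OF assms] by (simp add: refl_coeffs_def)
  moreover have "i - 1 < length c" using assms by auto
  ultimately show ?thesis by (simp add: refl_coeffs_def)
qed

lemma sum_list_refl_coeffs: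
  assumes "length c = 7" "i \<in> {1..7}"
  shows "sum_list (refl_coeffs i c) = sum_list c - E7_gram c (affine_simple i)"
  using assms unfolding in_1_7_iff
  by (elim length_7_cases) (auto simp: refl_coeffs_def numeral_eq_Suc)

lemma affine_simple_positive: "i \<in> {1..7} \<Longrightarrow> affine_simple i \<in> set E7_positive"
proof -
  have "\<forall>i\<in>set [1,2,3,4,5,6,7]. affine_simple i \<in> set E7_positive" by code_simp
  then show "i \<in> {1..7} \<Longrightarrow> ?thesis" unfolding in_1_7_iff by blast
qed

lemma highest_positive: "map uminus (affine_simple 0) \<in> set E7_positive"
  by code_simp

section \<open>A root system of type \<open>E\<^sub>7\<close> is the explicit one\<close>

locale E7 =
  fixes \<Phi> :: "'a::euclidean_space set" and \<alpha> :: "nat \<Rightarrow> 'a"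
  assumes dim: "DIM('a) = 7" and E7: "E7_root_system \<Phi> \<alpha>"
begin

definition comb :: "int list \<Rightarrow> 'a" where
  "comb c = (\<Sum>i\<in>{1..7}. real_of_int (c ! (i - 1)) *\<^sub>R \<alpha> i)"

abbreviation weyl :: "('a \<Rightarrow> 'a) set" where
  "weyl \<equiv> reflection_group \<Phi>"

abbreviation coweights :: "'a set" where
  "coweights \<equiv> coweight_lattice \<Phi>"

abbreviation positive_roots :: "'a set" where
  "positive_roots \<equiv> comb ` set E7_positive"

lemma root_system: "root_system \<Phi>" and simple_system: "simple_system \<Phi> \<alpha> {1..7}"
  and cartan: "i \<in> {1..7} \<Longrightarrow> j \<in> {1..7} \<Longrightarrow> 2 * (\<alpha> i \<bullet> \<alpha> j) / (\<alpha> j \<bullet> \<alpha> j) = E7_cartan i j"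
  using E7 by (auto simp: E7_root_system_def)

lemma simple_root: "i \<in> {1..7} \<Longrightarrow> \<alpha> i \<in> \<Phi>"
  using simple_system by (auto simp: simple_system_def)

lemma root_nonzero: "\<beta> \<in> \<Phi> \<Longrightarrow> \<beta> \<noteq> 0"
  using root_system by (auto simp: root_system_def)

lemma reflection_root: "\<beta> \<in> \<Phi> \<Longrightarrow> \<gamma> \<in> \<Phi> \<Longrightarrow> reflection \<beta> \<gamma> \<in> \<Phi>"
  using root_system by (auto simp: root_system_def)

lemma norm_pos: "0 < \<alpha> 1 \<bullet> \<alpha> 1"
  using simple_root[of 1] root_nonzero[of "\<alpha> 1"] by simp

text \<open>The Cartan integers fix inner products up to the norms of the roots, and an edge of the simply laced
  diagram forces equal norms. As the diagram is connected, one scale remains.\<close>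

lemma simple_inner:
  assumes "i \<in> {1..7}" "j \<in> {1..7}"
  shows "\<alpha> i \<bullet> \<alpha> j = (\<alpha> 1 \<bullet> \<alpha> 1) / 2 * E7_cartan i j"
proof -
  have c: "2 * (\<alpha> i \<bullet> \<alpha> j) = E7_cartan i j * (\<alpha> j \<bullet> \<alpha> j)" if "i \<in> {1..7}" "j \<in> {1..7}" for i j
    using cartan[OF that] root_nonzero[OF simple_root[OF that(2)]] by (simp add: divide_eq_eq)
  have e: "\<alpha> i \<bullet> \<alpha> i = \<alpha> j \<bullet> \<alpha> j" if "i \<in> {1..7}" "j \<in> {1..7}" "{i, j} \<in> E7_edges" for i j
  proof -
    have "i \<noteq> j" using that(3) by (auto simp: E7_edges_def doubleton_eq_iff)
    moreover have "{j, i} \<in> E7_edges" using that(3) by (simp add: insert_commute)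
    ultimately show ?thesis
      using c[OF that(1,2)] c[OF that(2,1)] that(3)
      by (simp add: E7_cartan_def inner_commute)
  qed
  have "\<alpha> j \<bullet> \<alpha> j = \<alpha> 1 \<bullet> \<alpha> 1"
    using e[of 1 3] e[of 3 4] e[of 2 4] e[of 4 5] e[of 5 6] e[of 6 7] assms(2)
    unfolding in_1_7_iff by (auto simp: E7_edges_def)
  then show ?thesis using c[OF assms] by (simp add: field_simps)
qed

lemma comb_inner: "comb c \<bullet> x = (\<Sum>i\<in>{1..7}. real_of_int (c ! (i - 1)) * (\<alpha> i \<bullet> x))"
  by (simp add: comb_def inner_sum_left)

lemma comb_affine_simple:
  assumes "i \<in> {1..7}" shows "comb (affine_simple i) = \<alpha> i"
proof -
  have "real_of_int (affine_simple i ! (j - 1)) *\<^sub>R \<alpha> j = (if j = i then \<alpha> i else 0)"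
    if "j \<in> {1..7}" for j
    using assms that by (auto simp: affine_simple_def nth_list_update)
  then have "comb (affine_simple i) = (\<Sum>j\<in>{1..7}. if j = i then \<alpha> i else 0)"
    unfolding comb_def by (rule sum.cong[OF refl])
  then show ?thesis using assms by simp
qed

lemma comb_uminus: "length c = 7 \<Longrightarrow> comb (map uminus c) = - comb c"
  by (auto simp: comb_def sum_negf[symmetric] intro!: sum.cong)

lemma comb_inner_simple:
  assumes "length c = 7" "i \<in> {1..7}"
  shows "comb c \<bullet> \<alpha> i = (\<alpha> 1 \<bullet> \<alpha> 1) / 2 * real_of_int (E7_gram c (affine_simple i))"
proof -
  have "comb c \<bullet> \<alpha> i = (\<alpha> 1 \<bullet> \<alpha> 1) / 2 * (\<Sum>j\<in>{1..7}. real_of_int (c ! (j - 1)) * E7_cartan j i)"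
    unfolding comb_inner sum_distrib_left
    by (rule sum.cong[OF refl], subst simple_inner) (use assms(2) in auto)
  also have "(\<Sum>j\<in>{1..7}. real_of_int (c ! (j - 1)) * E7_cartan j i) = E7_gram c (affine_simple i)"
    using assms unfolding in_1_7_iff
    by (elim length_7_cases)
       (auto simp: sum_1_7 E7_cartan_def E7_edges_def doubleton_eq_iff E7_gram_def
         affine_simple_def numeral_eq_Suc)
  finally show ?thesis .
qed

lemma comb_inner_comb:
  assumes "length c = 7" "length d = 7"
  shows "comb c \<bullet> comb d = (\<alpha> 1 \<bullet> \<alpha> 1) / 2 * real_of_int (E7_gram c d)"
proof -
  have "comb c \<bullet> comb d = comb d \<bullet> comb c" by (rule inner_commute)
  also have "\<dots> = (\<alpha> 1 \<bullet> \<alpha> 1) / 2 *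
      (\<Sum>i\<in>{1..7}. real_of_int (d ! (i - 1)) * real_of_int (E7_gram c (affine_simple i)))"
    unfolding comb_inner sum_distrib_left
    by (rule sum.cong[OF refl], subst inner_commute) (simp add: comb_inner_simple assms(1))
  finally show ?thesis by (simp add: E7_gram_sum[OF assms])
qed

lemma reflection_simple_comb:
  assumes "length c = 7" "i \<in> {1..7}"
  shows "reflection (\<alpha> i) (comb c) = comb (refl_coeffs i c)"
proof -
  define g where "g = E7_gram c (affine_simple i)"
  have n: "\<alpha> i \<bullet> \<alpha> i = \<alpha> 1 \<bullet> \<alpha> 1"
    using simple_inner[OF assms(2,2)] by (simp add: E7_cartan_def)
  have "2 * (\<alpha> i \<bullet> comb c) / (\<alpha> i \<bullet> \<alpha> i) = g"
    unfolding n inner_commute[of "\<alpha> i" "comb c"] comb_inner_simple[OF assms] g_def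
    using norm_pos by simp
  then have "reflection (\<alpha> i) (comb c) = comb c - real_of_int g *\<^sub>R \<alpha> i"
    by (simp add: reflection_def)
  also have "\<dots> = (\<Sum>j\<in>{1..7}. real_of_int (c ! (j - 1)) *\<^sub>R \<alpha> j - (if j = i then real_of_int g *\<^sub>R \<alpha> i else 0))"
    using assms(2) by (simp add: sum_subtractf comb_def)
  also have "\<dots> = comb (refl_coeffs i c)"
    unfolding comb_def
    by (rule sum.cong[OF refl])
       (use assms in \<open>auto simp: refl_coeffs_def g_def nth_list_update scaleR_diff_left\<close>)
  finally show ?thesis .
qed

lemma inj_simple: "inj_on \<alpha> {1..7}" and independent_simple: "independent (\<alpha> ` {1..7})"
  using simple_system by (auto simp: simple_system_def)

lemma simple_coeffs_zero:
  assumes "(\<Sum>i\<in>{1..7}. f i *\<^sub>R \<alpha> i) = 0" "i \<in> {1..7}"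
  shows "f i = 0"
proof -
  have "(\<Sum>v\<in>\<alpha> ` {1..7}. f (the_inv_into {1..7} \<alpha> v) *\<^sub>R v) = (\<Sum>i\<in>{1..7}. f i *\<^sub>R \<alpha> i)"
    unfolding sum.reindex[OF inj_simple] o_def
    by (rule sum.cong[OF refl]) (simp only: the_inv_into_f_f[OF inj_simple])
  then have "f (the_inv_into {1..7} \<alpha> (\<alpha> i)) = 0"
    using independentD[OF independent_simple, of "\<alpha> ` {1..7}" "\<lambda>v. f (the_inv_into {1..7} \<alpha> v)" "\<alpha> i"]
      assms by simp
  then show ?thesis using the_inv_into_f_f[OF inj_simple assms(2)] by simp
qed

lemma comb_inj:
  assumes "comb c = comb d" "length c = 7" "length d = 7"
  shows "c = d"
proof (rule nth_equalityI)
  show "length c = length d" using assms by simp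
  fix k assume "k < length c"
  then have k: "Suc k \<in> {1..7}" using assms(2) by simp
  have "(\<Sum>i\<in>{1..7}. (real_of_int (c ! (i - 1)) - real_of_int (d ! (i - 1))) *\<^sub>R \<alpha> i) = 0"
    using assms(1) by (simp add: comb_def scaleR_diff_left sum_subtractf)
  from simple_coeffs_zero[OF this k] show "c ! k = d ! k" by simp
qed

lemma reflection_reflection: "b \<noteq> 0 \<Longrightarrow> reflection b (reflection b x) = x"
  by (simp add: reflection_def inner_diff_right algebra_simps)

text \<open>By induction on the height: descend by a simple reflection and reflect back.\<close>

lemma positive_root_in: "c \<in> set E7_positive \<Longrightarrow> comb c \<in> \<Phi>"
proof (induction "nat (sum_list c)" arbitrary: c rule: less_induct)
  case less
  have c: "length c = 7" using less.prems length_positive by blast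
  obtain i where i: "i \<in> {1..7}" "0 < E7_gram c (affine_simple i)"
    using ex_descent less.prems unfolding in_1_7_iff by (metis not_less)
  show ?case
  proof (cases "c = affine_simple i")
    case True then show ?thesis using i by (simp add: comb_affine_simple simple_root)
  next
    case False
    let ?d = "refl_coeffs i c"
    have d: "?d \<in> set E7_positive"
      using False i refl_positive less.prems unfolding in_1_7_iff by fastforce
    have "sum_list ?d = sum_list c - E7_gram c (affine_simple i)"
      by (rule sum_list_refl_coeffs[OF c i(1)])
    moreover have "1 \<le> sum_list ?d" using d height_bounds by blast
    ultimately have "nat (sum_list ?d) < nat (sum_list c)" using i(2) by simp
    then have "comb ?d \<in> \<Phi>" using less.hyps d by blast
    then have "reflection (\<alpha> i) (comb ?d) \<in> \<Phi>" using reflection_root simple_root i(1) by blast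
    then show ?thesis using reflection_simple_comb[of ?d i] i(1) c by (simp add: refl_coeffs_refl_coeffs)
  qed
qed

lemma nonneg_combE:
  assumes "\<beta> \<in> nonneg_comb \<alpha> {1..7}"
  obtains c where "\<beta> = comb c" "length c = 7" "\<forall>x\<in>set c. 0 \<le> x"
proof -
  obtain f :: "nat \<Rightarrow> nat" where f: "\<beta> = (\<Sum>i\<in>{1..7}. real (f i) *\<^sub>R \<alpha> i)"
    using assms by (auto simp: nonneg_comb_def)
  define c where "c = map (\<lambda>i. int (f i)) [1, 2, 3, 4, 5, 6, 7]"
  have "\<beta> = comb c" unfolding f comb_def c_def sum_1_7 by simp
  then show thesis using that[of c] by (simp add: c_def)
qed

lemma nonneg_combI:
  assumes "length c = 7" "\<forall>x\<in>set c. 0 \<le> x"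
  shows "comb c \<in> nonneg_comb \<alpha> {1..7}"
proof -
  have "comb c = (\<Sum>i\<in>{1..7}. real (nat (c ! (i - 1))) *\<^sub>R \<alpha> i)"
    unfolding comb_def by (rule sum.cong[OF refl]) (use assms in auto)
  then show ?thesis by (auto simp: nonneg_comb_def)
qed

text \<open>By induction on the height. A simple reflection that lowers the height changes a single coefficient.
  If another coefficient is nonzero, it keeps the image from being negative, so the image is listed by
  induction; otherwise the root is a multiple of a simple root.\<close>

lemma nonneg_root_positive:
  assumes "comb c \<in> \<Phi>" "length c = 7" "\<forall>x\<in>set c. 0 \<le> x"
  shows "c \<in> set E7_positive"
  using assms
proof (induction "nat (sum_list c)" arbitrary: c rule: less_induct)
  case less
  note c = less.prems(2)
  have nn: "0 \<le> c ! (i - 1)" if "i \<in> {1..7}" for i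
    using that less.prems by auto
  have "0 < comb c \<bullet> comb c" using root_nonzero[OF less.prems(1)] by simp
  then have "0 < E7_gram c c"
    using norm_pos unfolding comb_inner_comb[OF c c]
    by (metis half_gt_zero of_int_0_less_iff zero_less_mult_pos)
  then have "\<exists>i\<in>{1..7}. 0 < c ! (i - 1) * E7_gram c (affine_simple i)"
    unfolding E7_gram_sum[OF c c] by (metis (no_types, lifting) not_less sum_nonpos)
  \<comment> \<open>A simple reflection that lowers the height exists because the norm is positive.\<close>
  then obtain i where i: "i \<in> {1..7}" "0 < E7_gram c (affine_simple i)"
    using nn by (metis zero_less_mult_iff not_less)
  let ?d = "refl_coeffs i c"
  have dnth: "?d ! (j - 1) = c ! (j - 1)" if "j \<in> {1..7}" "j \<noteq> i" for j
    using that i(1) c by (auto simp: refl_coeffs_def nth_list_update)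
  show ?case
  proof (cases "\<exists>j\<in>{1..7}. j \<noteq> i \<and> c ! (j - 1) \<noteq> 0")
    case False
    then have "comb c = (\<Sum>j\<in>{1..7}. if j = i then real_of_int (c ! (i - 1)) *\<^sub>R \<alpha> i else 0)"
      unfolding comb_def by (intro sum.cong) auto
    then have *: "comb c = real_of_int (c ! (i - 1)) *\<^sub>R \<alpha> i" using i(1) by simp
    then have "real_of_int (c ! (i - 1)) = 1 \<or> real_of_int (c ! (i - 1)) = - 1"
      using root_system less.prems(1) simple_root[OF i(1)] unfolding root_system_def by metis
    then have "c ! (i - 1) = 1" using nn[OF i(1)] by linarith
    then have "comb c = comb (affine_simple i)" using * i(1) by (simp add: comb_affine_simple)
    then show ?thesis using comb_inj[of c "affine_simple i"] c affine_simple_positive[OF i(1)] by simp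
  next
    case True
    then obtain j where j: "j \<in> {1..7}" "j \<noteq> i" "0 < c ! (j - 1)"
      using nn by (metis order_le_less)
    have d\<Phi>: "comb ?d \<in> \<Phi>"
      using reflection_root[OF simple_root[OF i(1)] less.prems(1)] reflection_simple_comb[OF c i(1)]
      by simp
    have dpos: "0 < ?d ! (j - 1)" using dnth j by simp
    have "- comb ?d \<notin> nonneg_comb \<alpha> {1..7}"
    proof
      assume "- comb ?d \<in> nonneg_comb \<alpha> {1..7}"
      then obtain e where e: "- comb ?d = comb e" "length e = 7" "\<forall>x\<in>set e. 0 \<le> x"
        by (rule nonneg_combE)
      then have "e = map uminus ?d"
        using comb_inj[of e "map uminus ?d"] c by (simp add: comb_uminus)
      moreover have "0 \<le> e ! (j - 1)" using e j(1) by auto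
      ultimately show False using dpos j(1) c by auto
    qed
    then have "comb ?d \<in> nonneg_comb \<alpha> {1..7}"
      using d\<Phi> simple_system by (auto simp: simple_system_def)
    then obtain e where e: "comb ?d = comb e" "length e = 7" "\<forall>x\<in>set e. 0 \<le> x"
      by (rule nonneg_combE)
    then have dnn: "\<forall>x\<in>set ?d. 0 \<le> x" using comb_inj[of ?d e] c by simp
    have "sum_list ?d = sum_list c - E7_gram c (affine_simple i)"
      by (rule sum_list_refl_coeffs[OF c i(1)])
    moreover have "0 \<le> sum_list ?d" using dnn by (simp add: sum_list_nonneg)
    ultimately have "nat (sum_list ?d) < nat (sum_list c)" using i(2) by simp
    then have dp: "?d \<in> set E7_positive" using less.hyps[of ?d] d\<Phi> dnn c by simp
    have "?d \<noteq> affine_simple i"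
    proof
      assume "?d = affine_simple i"
      moreover have "affine_simple i ! (j - 1) = 0"
        using i(1) j(1,2) by (auto simp: affine_simple_def nth_list_update)
      ultimately show False using dpos by simp
    qed
    moreover have "E7_gram ?d (affine_simple i) \<noteq> 0" using gram_refl_coeffs[OF c i(1)] i(2) by simp
    ultimately have "refl_coeffs i ?d \<in> set E7_positive"
      using refl_positive dp i(1) unfolding in_1_7_iff by blast
    then show ?thesis using refl_coeffs_refl_coeffs[OF c i(1)] by simp
  qed
qed

lemma roots_eq: "\<Phi> = positive_roots \<union> uminus ` positive_roots"
proof
  show "\<Phi> \<subseteq> positive_roots \<union> uminus ` positive_roots"
  proof
    fix \<beta> assume b: "\<beta> \<in> \<Phi>"
    have "reflection \<beta> \<beta> = - \<beta>" using root_nonzero[OF b] by (simp add: reflection_def scaleR_2)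
    then have mb: "- \<beta> \<in> \<Phi>" using reflection_root[OF b b] by simp
    consider "\<beta> \<in> nonneg_comb \<alpha> {1..7}" | "- \<beta> \<in> nonneg_comb \<alpha> {1..7}"
      using b simple_system by (auto simp: simple_system_def)
    then show "\<beta> \<in> positive_roots \<union> uminus ` positive_roots"
    proof cases
      case 1
      then obtain c where "\<beta> = comb c" "length c = 7" "\<forall>x\<in>set c. 0 \<le> x" by (rule nonneg_combE)
      then show ?thesis using nonneg_root_positive[of c] b by blast
    next
      case 2
      then obtain c where "- \<beta> = comb c" "length c = 7" "\<forall>x\<in>set c. 0 \<le> x" by (rule nonneg_combE)
      then have "- \<beta> \<in> positive_roots" using nonneg_root_positive[of c] mb by simp
      then have "- (- \<beta>) \<in> uminus ` positive_roots" by (rule imageI)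
      then show ?thesis by simp
    qed
  qed
  have "- comb c \<in> \<Phi>" if "c \<in> set E7_positive" for c
  proof -
    have "reflection (comb c) (comb c) \<in> \<Phi>"
      using positive_root_in[OF that] reflection_root by blast
    then show ?thesis
      using root_nonzero[OF positive_root_in[OF that]] by (simp add: reflection_def scaleR_2)
  qed
  then show "positive_roots \<union> uminus ` positive_roots \<subseteq> \<Phi>" using positive_root_in by auto
qed

lemma span_simple: "span (\<alpha> ` {1..7}) = UNIV"
proof -
  have "card (\<alpha> ` {1..7}) = 7" using card_image[OF inj_simple] by simp
  then have "UNIV \<subseteq> span (\<alpha> ` {1..7})"
    using independent_simple dim by (intro card_ge_dim_independent) auto
  then show ?thesis by blast
qed

lemma coords_eqI:
  assumes "\<And>i. i \<in> {1..7} \<Longrightarrow> \<alpha> i \<bullet> x = \<alpha> i \<bullet> y" shows "x = y"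
proof -
  have "(x - y) \<bullet> z = 0" if "z \<in> span (\<alpha> ` {1..7})" for z
    using that
  proof (induction rule: span_induct_alt)
    case base then show ?case by simp
  next
    case (step c a z)
    then show ?case using assms by (auto simp: inner_add_right inner_commute[of "x - y"] inner_diff_right)
  qed
  then have "(x - y) \<bullet> (x - y) = 0" using span_simple by blast
  then show ?thesis by simp
qed

lemma linear_eqI:
  assumes "linear f" "linear g" "\<And>i. i \<in> {1..7} \<Longrightarrow> f (\<alpha> i) = g (\<alpha> i)" shows "f = g"
proof
  fix x
  have "x \<in> span (\<alpha> ` {1..7})" using span_simple by blast
  then show "f x = g x"
    by (rule linear_eq_on_span[OF assms(1,2), rotated]) (use assms(3) in blast)
qed

lemma ex_coords: "\<exists>x. \<forall>i\<in>{1..7}. \<alpha> i \<bullet> x = m i"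
proof -
  obtain g where g: "linear g" "\<forall>v\<in>\<alpha> ` {1..7}. g v = m (the_inv_into {1..7} \<alpha> v)"
    using linear_independent_extend[OF independent_simple, of "\<lambda>v. m (the_inv_into {1..7} \<alpha> v)"]
    by auto
  define x where "x = (\<Sum>b\<in>Basis. g b *\<^sub>R b)"
  have "v \<bullet> x = g v" for v
  proof -
    have "g v = g (\<Sum>b\<in>Basis. (v \<bullet> b) *\<^sub>R b)" by (simp add: euclidean_representation)
    also have "\<dots> = (\<Sum>b\<in>Basis. (v \<bullet> b) * g b)"
      using g(1) by (simp add: linear_sum linear_cmul)
    finally show ?thesis by (simp add: x_def inner_sum_right mult.commute)
  qed
  moreover have "g (\<alpha> i) = m i" if "i \<in> {1..7}" for i
    using g(2) the_inv_into_f_f[OF inj_simple that] that by auto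
  ultimately show ?thesis by (intro exI[of _ x]) simp
qed

end

section \<open>Isometries of the root system and the Weyl group\<close>

text \<open>From here on the coefficient of \<open>\<alpha> i\<close> is addressed as \<open>c ! (i - 1)\<close> for
  symbolic \<open>i\<close>, so \<open>1\<close> is kept from unfolding to a successor.\<close>

declare One_nat_def [simp del]

lemma linear_reflection: "linear (reflection a)"
  by (rule linearI) (auto simp: reflection_def inner_add_right algebra_simps add_divide_distrib)

lemma reflection_inner: "a \<noteq> 0 \<Longrightarrow> reflection a x \<bullet> reflection a y = x \<bullet> y"
  by (simp add: reflection_def inner_diff_left inner_diff_right inner_commute[of x a] field_simps)

lemma reflection_group_comp:
  assumes "v \<in> reflection_group R" "w \<in> reflection_group R" shows "v \<circ> w \<in> reflection_group R"
  using assms(1)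
proof induction
  case one then show ?case using assms(2) by simp
next
  case (mult v a) then show ?case unfolding comp_assoc by (intro reflection_group.mult)
qed

lemma reflection_in_group: "a \<in> R \<Longrightarrow> reflection a \<in> reflection_group R"
  using reflection_group.mult[OF reflection_group.one] by force

lemma reflection_group_mono: "w \<in> reflection_group R \<Longrightarrow> R \<subseteq> S \<Longrightarrow> w \<in> reflection_group S"
  by (induction rule: reflection_group.induct) (auto intro: reflection_group.intros)

text \<open>The inverse of a word in reflections is the reversed word.\<close>

lemma reflection_group_inverse:
  assumes "0 \<notin> R" "w \<in> reflection_group R"
  shows "\<exists>v\<in>reflection_group R. v \<circ> w = id \<and> w \<circ> v = id"
  using assms(2)
proof induction
  case one then show ?case using reflection_group.one by (intro bexI[of _ id]) auto
next
  case (mult w a)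
  then obtain v where v: "v \<in> reflection_group R" "v \<circ> w = id" "w \<circ> v = id" by blast
  have a: "reflection a \<circ> reflection a = id"
    using mult.hyps assms(1) by (auto simp: fun_eq_iff reflection_def inner_diff_right algebra_simps)
  have "v \<circ> reflection a \<circ> (reflection a \<circ> w) = v \<circ> (reflection a \<circ> reflection a) \<circ> w"
    "reflection a \<circ> w \<circ> (v \<circ> reflection a) = reflection a \<circ> (w \<circ> v) \<circ> reflection a"
    by (simp_all only: comp_assoc)
  then have "v \<circ> reflection a \<circ> (reflection a \<circ> w) = id"
    "reflection a \<circ> w \<circ> (v \<circ> reflection a) = id"
    unfolding a v comp_id by (simp_all only: v)
  then show ?case
    using mult.hyps reflection_group_comp[OF v(1) reflection_in_group[of a R]] by blast
qed

context E7
begin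

text \<open>This class contains the Weyl group and is closed under negation, so that it applies to the negative
  of a longest element, whose membership in the Weyl group is not known beforehand.\<close>

definition root_isometry :: "('a \<Rightarrow> 'a) \<Rightarrow> bool" where
  "root_isometry u \<longleftrightarrow> linear u \<and> (\<forall>x y. u x \<bullet> u y = x \<bullet> y) \<and> u ` \<Phi> \<subseteq> \<Phi>"

lemma root_isometryD:
  assumes "root_isometry u"
  shows "linear u" "u x \<bullet> u y = x \<bullet> y" "\<beta> \<in> \<Phi> \<Longrightarrow> u \<beta> \<in> \<Phi>"
  using assms by (auto simp: root_isometry_def)

lemma root_isometry_comp: "root_isometry u \<Longrightarrow> root_isometry v \<Longrightarrow> root_isometry (u \<circ> v)"
  unfolding root_isometry_def by (auto intro: linear_compose simp: image_subset_iff)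

lemma minus_root: "\<beta> \<in> \<Phi> \<Longrightarrow> - \<beta> \<in> \<Phi>"
  using reflection_root[of \<beta> \<beta>] root_nonzero[of \<beta>] by (simp add: reflection_def scaleR_2)

lemma root_isometry_uminus: "root_isometry u \<Longrightarrow> root_isometry (\<lambda>x. - u x)"
  by (auto simp: root_isometry_def linear_compose_neg minus_root)

lemma zero_notin_roots: "0 \<notin> \<Phi>"
  using root_nonzero by blast

lemma weyl_root_isometry: "w \<in> weyl \<Longrightarrow> root_isometry w"
proof (induction rule: reflection_group.induct)
  case one then show ?case using linear_id by (simp add: root_isometry_def id_def)
next
  case (mult w a)
  then have "root_isometry (reflection a)"
    using root_nonzero reflection_root
    by (auto simp: root_isometry_def linear_reflection reflection_inner)
  then show ?case using mult.IH root_isometry_comp by blast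
qed

lemma finite_roots: "finite \<Phi>"
  using root_system by (simp add: root_system_def)

lemma root_isometry_inj: assumes "root_isometry u" shows "inj u"
proof (rule injI)
  fix x y assume "u x = u y"
  then have "u (x - y) = 0" using root_isometryD(1)[OF assms] by (simp add: linear_diff)
  then have "(x - y) \<bullet> (x - y) = 0" using root_isometryD(2)[OF assms, of "x - y" "x - y"] by simp
  then show "x = y" by simp
qed

lemma root_isometry_bij: "root_isometry u \<Longrightarrow> bij u"
  using root_isometry_inj[of u] root_isometryD(1)[of u] linear_injective_imp_surjective[of u]
  by (simp add: bij_def)

lemma root_isometry_image: assumes "root_isometry u" shows "u ` \<Phi> = \<Phi>"
  by (rule endo_inj_surj[OF finite_roots])
     (use assms root_isometry_inj in \<open>auto simp: root_isometry_def intro: inj_on_subset\<close>)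

lemma root_isometry_inv:
  assumes "root_isometry u" shows "root_isometry (inv u)"
proof -
  note b = root_isometry_bij[OF assms]
  have f: "u (inv u x) = x" for x using b by (simp add: bij_is_surj surj_f_inv_f)
  have "linear (inv u)"
  proof (rule linearI)
    note lin = root_isometryD(1)[OF assms]
    fix x y and c :: real
    have "u (inv u (x + y)) = u (inv u x + inv u y)" unfolding linear_add[OF lin] f ..
    then show "inv u (x + y) = inv u x + inv u y" by (rule injD[OF root_isometry_inj[OF assms]])
    have "u (inv u (c *\<^sub>R x)) = u (c *\<^sub>R inv u x)" unfolding linear_cmul[OF lin] f ..
    then show "inv u (c *\<^sub>R x) = c *\<^sub>R inv u x" by (rule injD[OF root_isometry_inj[OF assms]])
  qed
  moreover have "inv u x \<bullet> inv u y = x \<bullet> y" for x y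
    using root_isometryD(2)[OF assms, of "inv u x" "inv u y"] f by simp
  moreover have "inv u ` \<Phi> \<subseteq> \<Phi>"
    using root_isometry_image[OF assms] b by (metis bij_def image_inv_f_f order_refl)
  ultimately show ?thesis by (simp add: root_isometry_def)
qed

lemma root_isometry_inv_cancel [simp]:
  assumes "root_isometry u" shows "u (inv u x) = x" "inv u (u x) = x"
  using root_isometry_bij[OF assms] by (simp_all add: bij_is_surj surj_f_inv_f bij_is_inj inv_f_f)

lemma inner_root_isometry: "root_isometry u \<Longrightarrow> \<beta> \<bullet> u x = inv u \<beta> \<bullet> x"
  by (metis root_isometryD(2) root_isometry_inv_cancel(1))

lemma weyl_inv: "w \<in> weyl \<Longrightarrow> inv w \<in> weyl"
proof -
  assume w: "w \<in> weyl"
  then obtain v where v: "v \<in> weyl" "v \<circ> w = id" "w \<circ> v = id"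
    using reflection_group_inverse[OF zero_notin_roots] by blast
  then have "inv w = v" by (simp add: inv_unique_comp)
  then show ?thesis using v by simp
qed

lemma positive_root_cases:
  assumes "\<beta> \<in> \<Phi>"
  obtains c where "c \<in> set E7_positive" "\<beta> = comb c" | c where "c \<in> set E7_positive" "\<beta> = - comb c"
  using assms roots_eq by auto

lemma length_positive_root: "c \<in> set E7_positive \<Longrightarrow> length c = 7"
  using length_positive by blast

lemma pos_coeff_nonneg: "c \<in> set E7_positive \<Longrightarrow> i \<in> {1..7} \<Longrightarrow> 0 \<le> c ! (i - 1)"
  unfolding in_1_7_iff using below_highest by (auto simp: One_nat_def)

lemma minus_positive_not_positive:
  assumes "\<beta> \<in> positive_roots" shows "- \<beta> \<notin> positive_roots"
proof
  assume "- \<beta> \<in> positive_roots"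
  then obtain d where d: "d \<in> set E7_positive" "- \<beta> = comb d" by blast
  obtain c where c: "c \<in> set E7_positive" "\<beta> = comb c" using assms by blast
  have "d = map uminus c"
    by (rule comb_inj) (use c d in \<open>simp_all add: comb_uminus length_positive_root\<close>)
  moreover have "sum_list (map uminus c) = - sum_list c" by (induction c) auto
  moreover have "1 \<le> sum_list c" "1 \<le> sum_list d" using c d height_bounds by blast+
  ultimately show False by simp
qed

lemma not_positive_iff: "\<beta> \<in> \<Phi> \<Longrightarrow> \<beta> \<notin> positive_roots \<longleftrightarrow> - \<beta> \<in> positive_roots"
  using roots_eq minus_positive_not_positive by force

section \<open>Coweights and the fundamental alcove\<close>

text \<open>Roots are integral combinations of simple roots.\<close>

lemma coweight_iff: "x \<in> coweights \<longleftrightarrow> (\<forall>i\<in>{1..7}. \<alpha> i \<bullet> x \<in> \<int>)"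
proof
  assume x: "\<forall>i\<in>{1..7}. \<alpha> i \<bullet> x \<in> \<int>"
  have *: "comb c \<bullet> x \<in> \<int>" for c
    unfolding comb_inner by (rule Ints_sum) (use x in auto)
  have "\<beta> \<bullet> x \<in> \<int>" if "\<beta> \<in> \<Phi>" for \<beta>
    using that by (rule positive_root_cases) (use * in auto)
  then show "x \<in> coweights" by (simp add: coweight_lattice_def)
qed (use simple_root in \<open>auto simp: coweight_lattice_def\<close>)

lemma coweight_root: "x \<in> coweights \<Longrightarrow> \<beta> \<in> \<Phi> \<Longrightarrow> \<beta> \<bullet> x \<in> \<int>"
  by (simp add: coweight_lattice_def)

lemma coweight_zero: "0 \<in> coweights"
  and coweight_add: "x \<in> coweights \<Longrightarrow> y \<in> coweights \<Longrightarrow> x + y \<in> coweights"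
  and coweight_diff: "x \<in> coweights \<Longrightarrow> y \<in> coweights \<Longrightarrow> x - y \<in> coweights"
  and coweight_scale: "x \<in> coweights \<Longrightarrow> of_int k *\<^sub>R x \<in> coweights"
  by (auto simp: coweight_lattice_def inner_add_right inner_diff_right)

lemma coweight_isometry:
  assumes "root_isometry u" "x \<in> coweights" shows "u x \<in> coweights"
proof -
  have "inv u \<beta> \<in> \<Phi>" if "\<beta> \<in> \<Phi>" for \<beta>
    using root_isometry_inv[OF assms(1)] that by (rule root_isometryD(3))
  then show ?thesis using assms by (auto simp: coweight_lattice_def inner_root_isometry)
qed

definition affine_root :: "nat \<Rightarrow> 'a" where
  "affine_root i = comb (affine_simple i)"

lemma affine_root_simple: "i \<in> {1..7} \<Longrightarrow> affine_root i = \<alpha> i"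
  by (simp add: affine_root_def comb_affine_simple)

lemma minus_affine_root_0: "- affine_root 0 = comb (map uminus (affine_simple 0))"
  by (simp add: affine_root_def comb_uminus)

lemma affine_root_in: assumes "i \<le> 7" shows "affine_root i \<in> \<Phi>"
proof (cases "i = 0")
  case True
  have "- affine_root 0 \<in> \<Phi>"
    unfolding minus_affine_root_0 by (rule positive_root_in[OF highest_positive])
  then show ?thesis using minus_root[of "- affine_root 0"] True by simp
next
  case False
  then have "i \<in> {1..7}" using assms by auto
  then show ?thesis by (simp add: affine_root_simple simple_root)
qed

lemma comb_map2:
  assumes "length c = 7" "length d = 7" "\<And>x y. real_of_int (f x y) = a * of_int x + b * of_int y"
  shows "comb (map2 f c d) = a *\<^sub>R comb c + b *\<^sub>R comb d"
proof -
  have "real_of_int (map2 f c d ! (i - 1)) = a * of_int (c ! (i - 1)) + b * of_int (d ! (i - 1))"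
    if "i \<in> {1..7}" for i
  proof -
    have "i - 1 < 7" using that by auto
    then show ?thesis using assms by simp
  qed
  then show ?thesis
    unfolding comb_def scaleR_sum_right sum.distrib[symmetric]
    by (intro sum.cong refl) (simp add: scaleR_add_left)
qed

lemma highest_minus_positive:
  assumes "c \<in> set E7_positive"
  obtains d where "length d = 7" "\<forall>x\<in>set d. 0 \<le> x" "- affine_root 0 - comb c = comb d"
proof
  let ?d = "map2 (\<lambda>t x. - t - x) (affine_simple 0) c"
  show l: "length ?d = 7" using assms by (simp add: length_positive_root)
  show "\<forall>x\<in>set ?d. 0 \<le> x"
  proof
    fix x assume "x \<in> set ?d"
    then obtain k where k: "k < 7" "x = ?d ! k" using l by (metis in_set_conv_nth)
    then have "k \<in> set [0,1,2,3,4,5,6]" by auto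
    then have "c ! k \<le> - (affine_simple 0 ! k)" using below_highest assms by blast
    then show "0 \<le> x" using k assms by (simp add: length_positive_root)
  qed
  show "- affine_root 0 - comb c = comb ?d"
    unfolding affine_root_def
    by (subst comb_map2[of _ _ _ "-1" "-1"]) (use assms in \<open>simp_all add: length_positive_root\<close>)
qed

text \<open>Two roots that dominate all roots dominate each other; their difference and its negative are then
  both nonnegative combinations of simple roots, so it vanishes.\<close>

lemma highest_root_eq: "highest_root \<Phi> \<alpha> {1..7} = - affine_root 0"
  unfolding highest_root_def
proof (rule the_equality)
  have above: "- affine_root 0 - \<beta> \<in> nonneg_comb \<alpha> {1..7}" if "\<beta> \<in> \<Phi>" for \<beta>
    using that
  proof (cases rule: positive_root_cases)
    case (1 c)
    then show ?thesis using highest_minus_positive[of c] nonneg_combI by metis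
  next
    case (2 c)
    let ?d = "map2 (\<lambda>t x. - t + x) (affine_simple 0) c"
    have l: "length ?d = 7" using 2 by (simp add: length_positive_root)
    have "\<forall>x\<in>set ?d. 0 \<le> x"
    proof
      fix x assume "x \<in> set ?d"
      then obtain k where k: "k < 7" "x = ?d ! k" using l by (metis in_set_conv_nth)
      then have "k \<in> set [0,1,2,3,4,5,6]" by auto
      then have "0 \<le> c ! k \<and> c ! k \<le> - (affine_simple 0 ! k)" using below_highest 2 by blast
      then show "0 \<le> x" using k 2 by (simp add: length_positive_root)
    qed
    moreover have "- affine_root 0 + comb c = comb ?d"
      unfolding affine_root_def
      by (subst comb_map2[of _ _ _ "-1" 1]) (use 2 in \<open>simp_all add: length_positive_root\<close>)
    ultimately show ?thesis using nonneg_combI[OF l] 2 by simp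
  qed
  show "- affine_root 0 \<in> \<Phi> \<and> (\<forall>\<beta>\<in>\<Phi>. - affine_root 0 - \<beta> \<in> nonneg_comb \<alpha> {1..7})"
    using above minus_root affine_root_in[of 0] by simp
  fix \<theta> assume t: "\<theta> \<in> \<Phi> \<and> (\<forall>\<beta>\<in>\<Phi>. \<theta> - \<beta> \<in> nonneg_comb \<alpha> {1..7})"
  then have "\<theta> - (- affine_root 0) \<in> nonneg_comb \<alpha> {1..7}"
    using t minus_root[OF affine_root_in[OF le0]] by blast
  then obtain c where c: "\<theta> - (- affine_root 0) = comb c" "length c = 7" "\<forall>x\<in>set c. 0 \<le> x"
    by (rule nonneg_combE)
  have "- affine_root 0 - \<theta> \<in> nonneg_comb \<alpha> {1..7}" using above t by blast
  then obtain d where d: "- affine_root 0 - \<theta> = comb d" "length d = 7" "\<forall>x\<in>set d. 0 \<le> x"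
    by (rule nonneg_combE)
  have "comb d = - comb c" unfolding d(1)[symmetric] c(1)[symmetric] by simp
  then have "d = map uminus c" using comb_inj[of d "map uminus c"] c d by (simp add: comb_uminus)
  then have "c ! k = 0" if "k < 7" for k
    using c d that by (metis length_map neg_0_le_iff_le nth_map nth_mem order_antisym)
  then have "comb c = 0" unfolding comb_def by (intro sum.neutral) auto
  then show "\<theta> = - affine_root 0" using c(1) by (simp add: add_eq_0_iff2)
qed

abbreviation alcove :: "'a set" where
  "alcove \<equiv> fund_alcove \<Phi> \<alpha> {1..7}"

lemma alcove_iff:
  "x \<in> alcove \<longleftrightarrow> (\<forall>i\<in>{1..7}. 0 < \<alpha> i \<bullet> x) \<and> - 1 < affine_root 0 \<bullet> x"
  unfolding fund_alcove_def highest_root_eq by auto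

lemma comb_nonneg_inner:
  assumes "x \<in> alcove" "length c = 7" "\<forall>t\<in>set c. 0 \<le> t"
  shows "0 \<le> comb c \<bullet> x"
  unfolding comb_inner
proof (rule sum_nonneg)
  fix i assume i: "i \<in> {1..7::nat}"
  then have "0 \<le> c ! (i - 1)" "0 < \<alpha> i \<bullet> x" using assms by (auto simp: alcove_iff)
  then show "0 \<le> real_of_int (c ! (i - 1)) * (\<alpha> i \<bullet> x)" by simp
qed

lemma positive_root_alcove:
  assumes "x \<in> alcove" "\<beta> \<in> positive_roots" shows "0 < \<beta> \<bullet> x" "\<beta> \<bullet> x < 1"
proof -
  obtain c where c: "c \<in> set E7_positive" "\<beta> = comb c" using assms(2) by blast
  have "\<not> (\<forall>i\<in>{1..7}. c ! (i - 1) = 0)"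
  proof
    assume "\<forall>i\<in>{1..7}. c ! (i - 1) = 0"
    then have "comb c = 0" unfolding comb_def by (intro sum.neutral) auto
    then show False using positive_root_in[OF c(1)] root_nonzero by blast
  qed
  then obtain i where i: "i \<in> {1..7}" "c ! (i - 1) \<noteq> 0" by blast
  have nn: "0 \<le> real_of_int (c ! (j - 1)) * (\<alpha> j \<bullet> x)" if "j \<in> {1..7}" for j
    using that assms(1) pos_coeff_nonneg[OF c(1) that]
    by (auto simp: alcove_iff intro!: mult_nonneg_nonneg order_less_imp_le[of 0 "\<alpha> j \<bullet> x"])
  have "0 < real_of_int (c ! (i - 1)) * (\<alpha> i \<bullet> x)"
    using i assms(1) pos_coeff_nonneg[OF c(1) i(1)] by (auto simp: alcove_iff intro!: mult_pos_pos)
  then show "0 < \<beta> \<bullet> x"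
    unfolding c(2) comb_inner by (intro sum_pos2[OF _ i(1)]) (use nn in auto)
  obtain d where "length d = 7" "\<forall>x\<in>set d. 0 \<le> x" "- affine_root 0 - comb c = comb d"
    using highest_minus_positive[OF c(1)] by blast
  then have "0 \<le> (- affine_root 0 - comb c) \<bullet> x" using comb_nonneg_inner[OF assms(1)] by simp
  then show "\<beta> \<bullet> x < 1" using assms(1) c(2) by (simp add: alcove_iff inner_diff_left)
qed

end

section \<open>Isometries that permute the affine simple roots\<close>

lemma affine_simple_inj:
  assumes "affine_simple i = affine_simple j" "i \<le> 7" "j \<le> 7" shows "i = j"
proof -
  have "\<forall>i\<in>set [0,1,2,3,4,5,6,7]. \<forall>j\<in>set [0,1,2,3,4,5,6,7].
      affine_simple i = affine_simple j \<longrightarrow> i = j"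
    by code_simp
  moreover have "i \<in> set [0,1,2,3,4,5,6,7]" "j \<in> set [0,1,2,3,4,5,6,7]" using assms(2,3) by auto
  ultimately show ?thesis using assms(1) by blast
qed

context E7
begin

text \<open>A root takes values in \<open>{-1<..<1}\<close> on the alcove. Adding this indicator moves them to the
  fractional part.\<close>

definition neg_indicator :: "'a \<Rightarrow> real" where
  "neg_indicator \<beta> = (if \<beta> \<in> positive_roots then 0 else 1)"

lemma root_in_unit_interval:
  assumes "\<beta> \<in> \<Phi>" "x \<in> alcove"
  shows "0 < \<beta> \<bullet> x + neg_indicator \<beta>" "\<beta> \<bullet> x + neg_indicator \<beta> < 1"
proof -
  have "- \<beta> \<in> positive_roots" if "\<beta> \<notin> positive_roots" using that assms(1) not_positive_iff by blast
  then show "0 < \<beta> \<bullet> x + neg_indicator \<beta>" "\<beta> \<bullet> x + neg_indicator \<beta> < 1"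
    using positive_root_alcove[OF assms(2), of \<beta>] positive_root_alcove[OF assms(2), of "- \<beta>"]
    by (auto simp: neg_indicator_def)
qed

text \<open>The image under \<open>u\<close> of the relation that expresses the lowest root through the simple roots; its
  coefficients are the marks of the highest root.\<close>

lemma affine_relation:
  assumes "linear u"
  shows "u (affine_root 0) \<bullet> x +
    (\<Sum>i\<in>{1..7}. - real_of_int (affine_simple 0 ! (i - 1)) * (u (\<alpha> i) \<bullet> x)) = 0"
  unfolding affine_root_def comb_def linear_sum[OF assms] linear_cmul[OF assms] inner_sum_left
  by (simp add: sum_negf)

lemma affine_marks: "(\<Sum>i\<in>{1..7}. - real_of_int (affine_simple 0 ! (i - 1)) * f i) =
    2 * f 1 + 2 * f 2 + 3 * f 3 + 4 * f 4 + 3 * f 5 + 2 * f 6 + f 7"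
  by (simp add: sum_1_7 affine_simple_def)

text \<open>The half-sum of the positive coroots, characterized by its pairing with the simple roots.
  Pairing with it gives the height of a root.\<close>

definition rho :: 'a where
  "rho = (SOME x. \<forall>i\<in>{1..7}. \<alpha> i \<bullet> x = 1)"

lemma simple_rho: "i \<in> {1..7} \<Longrightarrow> \<alpha> i \<bullet> rho = 1"
  using someI_ex[OF ex_coords[of "\<lambda>_. 1"]] unfolding rho_def by blast

lemma comb_rho: assumes "length c = 7" shows "comb c \<bullet> rho = sum_list c"
proof -
  have "comb c \<bullet> rho = (\<Sum>i\<in>{1..7}. real_of_int (c ! (i - 1)))"
    unfolding comb_inner by (rule sum.cong) (simp_all add: simple_rho)
  then show ?thesis using assms by (elim length_7_cases) (simp add: sum_1_7)
qed

text \<open>Counting heights modulo 18 as numbers between 1 and 17, the affine simple roots are exactly the roots of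
  height 1.\<close>

lemma affine_height:
  assumes "\<beta> \<in> \<Phi>"
  shows "1 \<le> \<beta> \<bullet> rho + 18 * neg_indicator \<beta>"
    and "\<beta> \<bullet> rho + 18 * neg_indicator \<beta> = 1 \<Longrightarrow> \<exists>j\<le>7. \<beta> = affine_root j"
proof -
  have "1 \<le> \<beta> \<bullet> rho + 18 * neg_indicator \<beta> \<and>
    (\<beta> \<bullet> rho + 18 * neg_indicator \<beta> = 1 \<longrightarrow> (\<exists>j\<le>7. \<beta> = affine_root j))"
    using assms
  proof (cases rule: positive_root_cases)
    case (1 c)
    have h: "\<beta> \<bullet> rho + 18 * neg_indicator \<beta> = sum_list c"
    proof -
      have "neg_indicator \<beta> = 0" using 1 by (auto simp: neg_indicator_def)
      then show ?thesis using comb_rho[OF length_positive_root[OF 1(1)]] 1(2) by simp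
    qed
    have "\<exists>j\<le>7. \<beta> = affine_root j" if one: "sum_list c = 1"
    proof -
      obtain i where i: "i \<in> set [1,2,3,4,5,6,7]" "c = affine_simple i"
        using height_one 1 one by blast
      then have "i \<le> 7" by auto
      then show ?thesis using i 1 by (auto simp: affine_root_def)
    qed
    moreover have "1 \<le> sum_list c" using height_bounds 1 by blast
    ultimately show ?thesis unfolding h by auto
  next
    case (2 c)
    have "\<beta> \<notin> positive_roots"
      unfolding 2(2) by (rule minus_positive_not_positive[OF imageI[OF 2(1)]])
    then have "neg_indicator \<beta> = 1" by (simp only: neg_indicator_def if_False)
    then have h: "\<beta> \<bullet> rho + 18 * neg_indicator \<beta> = 18 - sum_list c"
      using comb_rho[OF length_positive_root[OF 2(1)]] 2(2) by simp
    have "\<beta> = affine_root 0" if "sum_list c = 17"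
    proof -
      have "c = map uminus (affine_simple 0)" using height_bounds 2 that by blast
      then have "comb c = - affine_root 0" using minus_affine_root_0 by simp
      then show ?thesis using 2 by simp
    qed
    moreover have "sum_list c \<le> 17" using height_bounds 2 by blast
    ultimately show ?thesis unfolding h by auto
  qed
  then show "1 \<le> \<beta> \<bullet> rho + 18 * neg_indicator \<beta>"
    "\<beta> \<bullet> rho + 18 * neg_indicator \<beta> = 1 \<Longrightarrow> \<exists>j\<le>7. \<beta> = affine_root j" by blast+
qed

lemma neg_indicator_affine:
  "neg_indicator (affine_root 0) = 1" "i \<in> {1..7} \<Longrightarrow> neg_indicator (\<alpha> i) = 0"
proof -
  have "- affine_root 0 \<in> positive_roots"
    unfolding minus_affine_root_0 using highest_positive by blast
  then have "affine_root 0 \<notin> positive_roots" using minus_positive_not_positive by fastforce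
  then show "neg_indicator (affine_root 0) = 1" by (simp add: neg_indicator_def)
  show "neg_indicator (\<alpha> i) = 0" if i: "i \<in> {1..7}"
    using affine_simple_positive[OF i] comb_affine_simple[OF i] unfolding neg_indicator_def by force
qed

text \<open>The fractional parts of \<open>v \<beta>\<close> at \<open>x\<close> and of \<open>\<beta>\<close> at \<open>y\<close> agree. Summing them over the affine simple
  roots with the marks as weights gives 1, for the fractional parts at \<open>y\<close>; at \<open>x\<close> the linear parts
  cancel, so the negative roots among the images \<open>v \<beta>\<close> have total weight 1. Replacing \<open>x\<close> by \<open>rho\<close>
  and the period 1 by 18, the heights of the images have weighted sum 18. Since the marks also add up to
  18 and every height is at least 1, all heights equal 1.\<close>

lemma isometry_permutes_affine_roots:
  assumes v: "root_isometry v" and xy: "x \<in> alcove" "y \<in> alcove"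
    and cong: "\<And>\<beta>. \<beta> \<in> \<Phi> \<Longrightarrow> v \<beta> \<bullet> x - \<beta> \<bullet> y \<in> \<int>"
    and i: "i \<le> 7"
  shows "\<exists>j\<le>7. v (affine_root i) = affine_root j"
proof -
  note lin = root_isometryD(1)[OF v]
  have res: "v \<beta> \<bullet> x + neg_indicator (v \<beta>) = \<beta> \<bullet> y + neg_indicator \<beta>" if "\<beta> \<in> \<Phi>" for \<beta>
  proof -
    have "v \<beta> \<in> \<Phi>" using root_isometryD(3)[OF v that] .
    then have "\<bar>(v \<beta> \<bullet> x + neg_indicator (v \<beta>)) - (\<beta> \<bullet> y + neg_indicator \<beta>)\<bar> < 1"
      using root_in_unit_interval xy that by (smt (verit, best))
    moreover have "(v \<beta> \<bullet> x + neg_indicator (v \<beta>)) - (\<beta> \<bullet> y + neg_indicator \<beta>) \<in> \<int>"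
    proof -
      have "neg_indicator (v \<beta>) - neg_indicator \<beta> \<in> \<int>" by (auto simp: neg_indicator_def)
      from Ints_add[OF cong[OF that] this] show ?thesis by (simp add: algebra_simps)
    qed
    ultimately show ?thesis using Ints_nonzero_abs_less1 by fastforce
  qed
  have vr: "v (affine_root 0) \<in> \<Phi>" "i \<in> {1..7} \<Longrightarrow> v (\<alpha> i) \<in> \<Phi>" for i
    using root_isometryD(3)[OF v] affine_root_in[of 0] simple_root by auto
  let ?S = "\<lambda>f. f (v (affine_root 0)) + (\<Sum>i\<in>{1..7}. - real_of_int (affine_simple 0 ! (i - 1)) * f (v (\<alpha> i)))"
  \<comment> \<open>The linear parts cancel, so the total of 1 comes from the negative images.\<close>
  have "?S neg_indicator = 1"
  proof -
    have "?S (\<lambda>\<beta>. \<beta> \<bullet> x + neg_indicator \<beta>) = ?S (\<lambda>\<beta>. \<beta> \<bullet> x) + ?S neg_indicator"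
      unfolding affine_marks by (simp add: algebra_simps)
    moreover have "?S (\<lambda>\<beta>. \<beta> \<bullet> x) = 0" by (rule affine_relation[OF lin])
    moreover have "?S (\<lambda>\<beta>. \<beta> \<bullet> x + neg_indicator \<beta>) = (affine_root 0 \<bullet> y + neg_indicator (affine_root 0)) +
        (\<Sum>i\<in>{1..7}. - real_of_int (affine_simple 0 ! (i - 1)) * (\<alpha> i \<bullet> y + neg_indicator (\<alpha> i)))"
      using res[OF affine_root_in[of 0]] res[OF simple_root] by simp
    moreover have "\<dots> = 1"
      using affine_relation[OF linear_id, of y] neg_indicator_affine by simp
    ultimately show ?thesis by simp
  qed
  moreover have "?S (\<lambda>\<beta>. \<beta> \<bullet> rho + 18 * neg_indicator \<beta>) = ?S (\<lambda>\<beta>. \<beta> \<bullet> rho) + 18 * ?S neg_indicator"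
    unfolding affine_marks by (simp add: algebra_simps)
  moreover have "?S (\<lambda>\<beta>. \<beta> \<bullet> rho) = 0" by (rule affine_relation[OF lin])
  ultimately have total: "?S (\<lambda>\<beta>. \<beta> \<bullet> rho + 18 * neg_indicator \<beta>) = 18" by simp
  let ?h = "\<lambda>\<beta>. \<beta> \<bullet> rho + 18 * neg_indicator \<beta>"
  have h0: "1 \<le> ?h (v (affine_root 0))" using affine_height(1) vr(1) .
  have h: "1 \<le> ?h (v (\<alpha> i))" if "i \<in> {1..7}" for i using affine_height(1) vr(2)[OF that] .
  have "?h (v (affine_root i)) = 1"
  proof (cases "i = 0")
    case True
    then show ?thesis using total h0 h[of 1] h[of 2] h[of 3] h[of 4] h[of 5] h[of 6] h[of 7]
      unfolding affine_marks by simp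
  next
    case False
    then have "i \<in> {1..7}" using i by auto
    moreover from this have "?h (v (\<alpha> i)) = 1"
      using total h0 h[of 1] h[of 2] h[of 3] h[of 4] h[of 5] h[of 6] h[of 7]
      unfolding affine_marks in_1_7_iff by auto
    ultimately show ?thesis by (simp add: affine_root_simple)
  qed
  then show ?thesis using affine_height(2) root_isometryD(3)[OF v affine_root_in[OF i]] by blast
qed

lemma affine_root_inj: "affine_root i = affine_root j \<Longrightarrow> i \<le> 7 \<Longrightarrow> j \<le> 7 \<Longrightarrow> i = j"
  unfolding affine_root_def by (rule affine_simple_inj) (auto intro: comb_inj)

text \<open>An isometry preserves inner products, hence adjacency in the extended diagram.\<close>

lemma affine_permutation_cases:
  assumes v: "root_isometry v" and perm: "\<And>i. i \<le> 7 \<Longrightarrow> \<exists>j\<le>7. v (affine_root i) = affine_root j"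
  shows "(\<forall>i\<le>7. v (affine_root i) = affine_root i) \<or>
    (\<forall>i\<le>7. v (affine_root i) = affine_root (affine_flip i))"
proof -
  obtain p where p: "\<And>i. i \<le> 7 \<Longrightarrow> p i \<le> 7 \<and> v (affine_root i) = affine_root (p i)"
    using perm by metis
  have "E7_gram (affine_simple (p i)) (affine_simple (p j)) = E7_gram (affine_simple i) (affine_simple j)"
    if "i \<le> 7" "j \<le> 7" for i j
  proof -
    have "affine_root (p i) \<bullet> affine_root (p j) = affine_root i \<bullet> affine_root j"
      using root_isometryD(2)[OF v, of "affine_root i" "affine_root j"] p that by simp
    then show ?thesis using norm_pos by (simp add: affine_root_def comb_inner_comb)
  qed
  moreover have "p i \<in> set [0,1,2,3,4,5,6,7]" if "i \<le> 7" for i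
    using p[OF that] by auto
  ultimately have nb: "p j \<in> set (affine_neighbours (p i))"
    if "E7_gram (affine_simple i) (affine_simple j) = -1" "i \<le> 7" "j \<le> 7" for i j
    using that by (simp only: affine_neighbours_def set_filter mem_Collect_eq simp_thms)
  have neq: "p i \<noteq> p j" if "i \<noteq> j" "i \<le> 7" "j \<le> 7" for i j
  proof
    assume "p i = p j"
    then have "v (affine_root i) = v (affine_root j)" using p that by simp
    then show False using injD[OF root_isometry_inj[OF v]] affine_root_inj that by blast
  qed
  have p4: "p 4 \<in> set [0,1,2,3,4,5,6,7]" using p[of 4] by auto
  have p2: "p 2 \<in> set (affine_neighbours (p 4))"
    by (rule nb, code_simp) simp_all
  have p3: "p 3 \<in> set (removeAll (p 2) (affine_neighbours (p 4)))"
    using nb[of 4 3, OF _ _ _] neq[of 3 2] by (simp add: E7_gram_def affine_simple_def numeral_eq_Suc)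
  have p5: "p 5 \<in> set (removeAll (p 2) (removeAll (p 3) (affine_neighbours (p 4))))"
    using nb[of 4 5] neq[of 5 2] neq[of 5 3] by (simp add: E7_gram_def affine_simple_def numeral_eq_Suc)
  have p1: "p 1 \<in> set (removeAll (p 4) (affine_neighbours (p 3)))"
    using nb[of 3 1] neq[of 1 4] by (simp add: E7_gram_def affine_simple_def numeral_eq_Suc)
  have p6: "p 6 \<in> set (removeAll (p 4) (affine_neighbours (p 5)))"
    using nb[of 5 6] neq[of 6 4] by (simp add: E7_gram_def affine_simple_def numeral_eq_Suc)
  have p0: "p 0 \<in> set (removeAll (p 3) (affine_neighbours (p 1)))"
    using nb[of 1 0] neq[of 0 3] by (simp add: E7_gram_def affine_simple_def numeral_eq_Suc)
  have p7: "p 7 \<in> set (removeAll (p 5) (affine_neighbours (p 6)))"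
    using nb[of 6 7] neq[of 7 5] by (simp add: E7_gram_def affine_simple_def numeral_eq_Suc)
  have i7: "i = 0 \<or> i = 1 \<or> i = 2 \<or> i = 3 \<or> i = 4 \<or> i = 5 \<or> i = 6 \<or> i = 7" if "i \<le> 7" for i :: nat
    using that by linarith
  have "map p [0,1,2,3,4,5,6,7] = [0,1,2,3,4,5,6,7] \<or>
      map p [0,1,2,3,4,5,6,7] = map affine_flip [0,1,2,3,4,5,6,7]"
    using affine_diagram_automorphisms[THEN bspec, OF p4, THEN bspec, OF p2, THEN bspec, OF p3,
      THEN bspec, OF p5, THEN bspec, OF p1, THEN bspec, OF p6, THEN bspec, OF p0, THEN bspec, OF p7]
    by simp
  then have "(\<forall>i\<le>7. p i = i) \<or> (\<forall>i\<le>7. p i = affine_flip i)"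
    by (rule disj_forward; auto dest!: i7)
  then show ?thesis using p by auto
qed

lemma isometry_eqI:
  assumes "root_isometry u" "root_isometry v" "\<And>i. i \<in> {1..7} \<Longrightarrow> u (affine_root i) = v (affine_root i)"
  shows "u = v"
  using assms by (intro linear_eqI) (auto simp: root_isometryD affine_root_simple)

lemma root_isometry_id: "root_isometry id"
  using linear_id by (simp add: root_isometry_def)

text \<open>Such an isometry maps the alcove to itself, hence permutes the affine simple roots. The flip is ruled
  out because it makes a simple root negative.\<close>

lemma preserves_positive_imp_id:
  assumes u: "root_isometry u" and pos: "u ` positive_roots \<subseteq> positive_roots"
  shows "u = id"
proof -
  note i = root_isometry_inv[OF u]
  have im: "u ` positive_roots = positive_roots"
    by (rule endo_inj_surj) (use pos root_isometry_inj[OF u] in \<open>auto intro: inj_on_subset\<close>)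
  have ipos: "inv u \<beta> \<in> positive_roots" if "\<beta> \<in> positive_roots" for \<beta>
  proof -
    have "\<beta> \<in> u ` positive_roots" unfolding im by (rule that)
    then obtain \<gamma> where "\<beta> = u \<gamma>" "\<gamma> \<in> positive_roots" by (rule imageE)
    then show ?thesis using root_isometry_inv_cancel(2)[OF u, of \<gamma>] by (simp only:)
  qed
  have spos: "\<alpha> i \<in> positive_roots" if "i \<in> {1..7}" for i
    using neg_indicator_affine(2)[OF that] by (auto simp: neg_indicator_def split: if_splits)
  have hpos: "- affine_root 0 \<in> positive_roots"
    unfolding minus_affine_root_0 using highest_positive by blast
  have "\<exists>x. \<forall>i\<in>{1..7}. \<alpha> i \<bullet> x = 1 / 18" by (rule ex_coords)
  then obtain x where x: "\<forall>i\<in>{1..7}. \<alpha> i \<bullet> x = 1 / 18" by blast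
  have "x \<in> alcove"
    using affine_relation[OF linear_id, of x] x
    unfolding affine_marks by (auto simp: alcove_iff)
  have "u x \<in> alcove"
  proof -
    have "0 < \<alpha> i \<bullet> u x" if "i \<in> {1..7}" for i
      using positive_root_alcove(1)[OF \<open>x \<in> alcove\<close> ipos[OF spos[OF that]]]
      by (simp add: inner_root_isometry[OF u])
    moreover have "(- affine_root 0) \<bullet> u x < 1"
      using positive_root_alcove(2)[OF \<open>x \<in> alcove\<close> ipos[OF hpos]]
      unfolding inner_root_isometry[OF u] .
    ultimately show ?thesis by (auto simp: alcove_iff)
  qed
  have "\<exists>j\<le>7. inv u (affine_root i) = affine_root j" if "i \<le> 7" for i
    by (rule isometry_permutes_affine_roots[OF i \<open>x \<in> alcove\<close> \<open>u x \<in> alcove\<close> _ that])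
       (simp add: inner_root_isometry[OF u])
  from affine_permutation_cases[OF i this]
  have "\<forall>i\<le>7. inv u (affine_root i) = affine_root i"
  proof
    assume "\<forall>i\<le>7. inv u (affine_root i) = affine_root (affine_flip i)"
    then have "inv u (affine_root 7) = affine_root (affine_flip 7)" by blast
    then have "inv u (\<alpha> 7) = affine_root 0" by (simp add: affine_root_simple affine_flip_def)
    then have "affine_root 0 \<in> positive_roots" using ipos[OF spos[of 7]] by simp
    then show ?thesis using neg_indicator_affine(1) by (simp add: neg_indicator_def)
  qed
  then have "inv u = id" by (intro isometry_eqI[OF i root_isometry_id]) auto
  then have "u x = x" for x using root_isometry_inv_cancel(2)[OF u, of x] by simp
  then show ?thesis by auto
qed

end

section \<open>Inversions and longest elements\<close>

lemma word_product_Nil: "word_product \<alpha> [] = id"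
  and word_product_Cons: "word_product \<alpha> (i # is) = reflection (\<alpha> i) \<circ> word_product \<alpha> is"
  by (simp_all add: word_product_def)

lemma word_product_snoc: "word_product \<alpha> (is @ [i]) = word_product \<alpha> is \<circ> reflection (\<alpha> i)"
  by (induction "is") (simp_all add: word_product_Nil word_product_Cons comp_assoc)

lemma word_product_in_group: "set is \<subseteq> J \<Longrightarrow> word_product \<alpha> is \<in> reflection_group (\<alpha> ` J)"
  by (induction "is") (auto simp: word_product_Nil word_product_Cons intro: reflection_group.intros)

context E7
begin

lemma positive_rho: "\<beta> \<in> positive_roots \<Longrightarrow> 1 \<le> \<beta> \<bullet> rho"
  using affine_height(1)[of \<beta>] roots_eq by (auto simp: neg_indicator_def)

lemma nonpositive_rho: "\<beta> \<in> \<Phi> \<Longrightarrow> \<beta> \<notin> positive_roots \<Longrightarrow> \<beta> \<bullet> rho \<le> - 1"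
  using not_positive_iff[of \<beta>] positive_rho[of "- \<beta>"] by auto

text \<open>The positive roots supported on the simple roots with index in \<open>J\<close>.\<close>

definition parabolic_positive :: "nat set \<Rightarrow> 'a set" where
  "parabolic_positive J = comb ` {c \<in> set E7_positive. \<forall>k\<in>{1..7} - J. c ! (k - 1) = 0}"

definition inversions :: "nat set \<Rightarrow> ('a \<Rightarrow> 'a) \<Rightarrow> 'a set" where
  "inversions J w = {\<beta> \<in> parabolic_positive J. w \<beta> \<notin> positive_roots}"

lemma parabolic_subset: "parabolic_positive J \<subseteq> positive_roots"
  by (auto simp: parabolic_positive_def)

lemma positive_subset_roots: "positive_roots \<subseteq> \<Phi>"
  using roots_eq by blast

lemma finite_parabolic: "finite (parabolic_positive J)"
  by (simp add: parabolic_positive_def)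

lemma finite_inversions: "finite (inversions J w)"
  using finite_parabolic by (simp add: inversions_def)

lemma parabolic_full: "parabolic_positive {1..7} = positive_roots"
  by (auto simp: parabolic_positive_def)

lemma refl_coeffs_outside:
  assumes "length c = 7" "i \<in> {1..7}" "k \<in> {1..7}" "k \<noteq> i"
  shows "refl_coeffs i c ! (k - 1) = c ! (k - 1)"
  using assms by (auto simp: refl_coeffs_def nth_list_update)

context
  fixes J :: "nat set"
  assumes J: "J \<subseteq> {1..7}"
begin

lemma parabolic_weyl: "w \<in> reflection_group (\<alpha> ` J) \<Longrightarrow> w \<in> weyl"
  by (erule reflection_group_mono) (use J simple_root in auto)

lemma parabolic_isometry: "w \<in> reflection_group (\<alpha> ` J) \<Longrightarrow> root_isometry w"
  by (rule weyl_root_isometry[OF parabolic_weyl])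

lemma simple_reflection_isometry: "i \<in> J \<Longrightarrow> root_isometry (reflection (\<alpha> i))"
  by (rule parabolic_isometry[OF reflection_in_group]) auto

text \<open>Reflecting in \<open>\<alpha> i\<close> changes only the coefficient of \<open>\<alpha> i\<close>.\<close>

lemma parabolic_fixes_outer_coeffs:
  assumes "w \<in> reflection_group (\<alpha> ` J)" "length c = 7"
  shows "\<exists>d. length d = 7 \<and> w (comb c) = comb d \<and> (\<forall>k\<in>{1..7} - J. d ! (k - 1) = c ! (k - 1))"
  using assms(1)
proof induction
  case one then show ?case using assms(2) by auto
next
  case (mult w a)
  then obtain d where d: "length d = 7" "w (comb c) = comb d"
    "\<forall>k\<in>{1..7} - J. d ! (k - 1) = c ! (k - 1)" by blast
  obtain i where i: "i \<in> J" "a = \<alpha> i" using mult.hyps by blast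
  then have i7: "i \<in> {1..7}" using J by blast
  show ?case
  proof (intro exI conjI ballI)
    show "length (refl_coeffs i d) = 7" using d by simp
    show "(reflection a \<circ> w) (comb c) = comb (refl_coeffs i d)"
      using d i reflection_simple_comb[OF d(1) i7] by simp
    fix k assume "k \<in> {1..7} - J"
    then show "refl_coeffs i d ! (k - 1) = c ! (k - 1)"
      using refl_coeffs_outside[OF d(1) i7, of k] d i by auto
  qed
qed

lemma parabolic_image:
  assumes w: "w \<in> reflection_group (\<alpha> ` J)" and b: "\<beta> \<in> parabolic_positive J"
  shows "w \<beta> \<in> parabolic_positive J \<or> - w \<beta> \<in> parabolic_positive J"
proof -
  obtain c where c: "c \<in> set E7_positive" "\<forall>k\<in>{1..7} - J. c ! (k - 1) = 0" "\<beta> = comb c"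
    using b by (auto simp: parabolic_positive_def)
  obtain d where d: "length d = 7" "w (comb c) = comb d" "\<forall>k\<in>{1..7} - J. d ! (k - 1) = c ! (k - 1)"
    using parabolic_fixes_outer_coeffs[OF w length_positive_root[OF c(1)]] by blast
  have "w \<beta> \<in> \<Phi>"
    using root_isometryD(3)[OF parabolic_isometry[OF w]] positive_root_in[OF c(1)] c(3) by simp
  then show ?thesis
  proof (cases rule: positive_root_cases)
    case (1 e)
    then have "d = e" using comb_inj[of d e] d c(3) length_positive_root by simp
    then show ?thesis using 1 d c by (auto simp: parabolic_positive_def)
  next
    case (2 e)
    have le: "length e = 7" using 2 length_positive_root by blast
    have "d = map uminus e"
      by (rule comb_inj) (use 2 d c(3) le in \<open>simp_all add: comb_uminus\<close>)
    then have "e ! (k - 1) = 0" if "k \<in> {1..7} - J" for k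
    proof -
      have "k - 1 < 7" using that by auto
      then have "d ! (k - 1) = - (e ! (k - 1))" using \<open>d = map uminus e\<close> le by simp
      then show ?thesis using d c that by simp
    qed
    then have "comb e \<in> parabolic_positive J" using 2 by (auto simp: parabolic_positive_def)
    then show ?thesis using 2 by simp
  qed
qed

lemma simple_in_parabolic: "i \<in> J \<Longrightarrow> \<alpha> i \<in> parabolic_positive J"
proof -
  assume i: "i \<in> J"
  then have i7: "i \<in> {1..7}" using J by blast
  have "affine_simple i ! (k - 1) = 0" if "k \<in> {1..7} - J" for k
  proof -
    have "k \<noteq> i" "1 \<le> k" "1 \<le> i" "k \<le> 7" using that i i7 by auto
    then have "k - 1 \<noteq> i - 1" "k - 1 < 7" by linarith+
    then show ?thesis using i7 by (simp add: affine_simple_def)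
  qed
  then have "comb (affine_simple i) \<in> parabolic_positive J"
    using affine_simple_positive[OF i7] by (auto simp: parabolic_positive_def)
  then show ?thesis by (simp add: comb_affine_simple[OF i7])
qed

lemma simple_reflection_permutes:
  assumes i: "i \<in> J" and b: "\<beta> \<in> parabolic_positive J" "\<beta> \<noteq> \<alpha> i"
  shows "reflection (\<alpha> i) \<beta> \<in> parabolic_positive J" "reflection (\<alpha> i) \<beta> \<noteq> \<alpha> i"
proof -
  have i7: "i \<in> {1..7}" using J i by blast
  obtain c where c: "c \<in> set E7_positive" "\<forall>k\<in>{1..7} - J. c ! (k - 1) = 0" "\<beta> = comb c"
    using b by (auto simp: parabolic_positive_def)
  note lc = length_positive_root[OF c(1)]
  have "c \<noteq> affine_simple i" using b(2) c(3) comb_affine_simple[OF i7] by auto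
  then consider "E7_gram c (affine_simple i) = 0" | "refl_coeffs i c \<in> set E7_positive"
    using refl_positive c(1) i7 unfolding in_1_7_iff by blast
  then have "refl_coeffs i c \<in> set E7_positive"
  proof cases
    case 1
    then have "refl_coeffs i c = c" by (simp add: refl_coeffs_def)
    then show ?thesis using c(1) by simp
  qed
  moreover have "\<forall>k\<in>{1..7} - J. refl_coeffs i c ! (k - 1) = 0"
  proof
    fix k assume k: "k \<in> {1..7} - J"
    then have "k \<noteq> i" "k \<in> {1..7}" using i by auto
    then show "refl_coeffs i c ! (k - 1) = 0" using refl_coeffs_outside[OF lc i7] c(2) k by simp
  qed
  ultimately show "reflection (\<alpha> i) \<beta> \<in> parabolic_positive J"
    unfolding c(3) reflection_simple_comb[OF lc i7] by (auto simp: parabolic_positive_def)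
  show "reflection (\<alpha> i) \<beta> \<noteq> \<alpha> i"
  proof
    have n0: "\<alpha> i \<noteq> 0" using root_nonzero[OF simple_root[OF i7]] .
    assume "reflection (\<alpha> i) \<beta> = \<alpha> i"
    then have "\<beta> = reflection (\<alpha> i) (\<alpha> i)" using reflection_reflection[OF n0, of \<beta>] by simp
    also have "\<dots> = - \<alpha> i" using n0 by (simp add: reflection_def scaleR_2)
    finally have "- \<alpha> i \<in> positive_roots" using b parabolic_subset by blast
    moreover have "\<alpha> i \<in> positive_roots" using simple_in_parabolic[OF i] parabolic_subset by blast
    ultimately show False using minus_positive_not_positive by blast
  qed
qed

text \<open>The reflection in \<open>\<alpha> i\<close> permutes the positive roots other than \<open>\<alpha> i\<close>, so composing with it
  transports the other inversions and removes \<open>\<alpha> i\<close>.\<close>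

lemma inversions_simple_reflection:
  assumes w: "w \<in> reflection_group (\<alpha> ` J)" and i: "i \<in> J" and neg: "w (\<alpha> i) \<notin> positive_roots"
  shows "inversions J (w \<circ> reflection (\<alpha> i)) = reflection (\<alpha> i) ` (inversions J w - {\<alpha> i})"
proof -
  let ?s = "reflection (\<alpha> i)"
  have i7: "i \<in> {1..7}" using J i by blast
  have n0: "\<alpha> i \<noteq> 0" using root_nonzero[OF simple_root[OF i7]] .
  note ss = reflection_reflection[OF n0]
  have "w (?s (\<alpha> i)) = - w (\<alpha> i)"
    using n0 root_isometryD(1)[OF parabolic_isometry[OF w]]
    by (simp add: reflection_def scaleR_2 linear_neg)
  moreover have "w (\<alpha> i) \<in> \<Phi>"
    using root_isometryD(3)[OF parabolic_isometry[OF w] simple_root[OF i7]] .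
  ultimately have a: "\<alpha> i \<notin> inversions J (w \<circ> ?s)"
    using neg not_positive_iff by (simp add: inversions_def)
  show ?thesis
  proof
    show "inversions J (w \<circ> ?s) \<subseteq> ?s ` (inversions J w - {\<alpha> i})"
    proof
      fix \<beta> assume b: "\<beta> \<in> inversions J (w \<circ> ?s)"
      then have "\<beta> \<in> parabolic_positive J" "\<beta> \<noteq> \<alpha> i" using a by (auto simp: inversions_def)
      from simple_reflection_permutes[OF i this] b
      have "?s \<beta> \<in> inversions J w - {\<alpha> i}" by (simp add: inversions_def)
      then have "?s (?s \<beta>) \<in> ?s ` (inversions J w - {\<alpha> i})" by (rule imageI)
      then show "\<beta> \<in> ?s ` (inversions J w - {\<alpha> i})" by (simp only: ss)
    qed
    show "?s ` (inversions J w - {\<alpha> i}) \<subseteq> inversions J (w \<circ> ?s)"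
    proof
      fix \<gamma> assume "\<gamma> \<in> ?s ` (inversions J w - {\<alpha> i})"
      then obtain \<beta> where b: "\<beta> \<in> inversions J w" "\<beta> \<noteq> \<alpha> i" "\<gamma> = ?s \<beta>" by blast
      then show "\<gamma> \<in> inversions J (w \<circ> ?s)"
        using simple_reflection_permutes[OF i, of \<beta>] by (simp add: inversions_def ss)
    qed
  qed
qed

lemma card_inversions_descent:
  assumes w: "w \<in> reflection_group (\<alpha> ` J)" and i: "i \<in> J" and neg: "w (\<alpha> i) \<notin> positive_roots"
  shows "Suc (card (inversions J (w \<circ> reflection (\<alpha> i)))) = card (inversions J w)"
proof -
  have "\<alpha> i \<in> inversions J w" using simple_in_parabolic[OF i] neg by (simp add: inversions_def)
  then have "card (inversions J w) = Suc (card (inversions J w - {\<alpha> i}))"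
    by (rule card.remove[OF finite_inversions])
  moreover have "inj_on (reflection (\<alpha> i)) (inversions J w - {\<alpha> i})"
    by (rule inj_on_subset[OF root_isometry_inj[OF simple_reflection_isometry[OF i]]]) simp
  ultimately show ?thesis
    unfolding inversions_simple_reflection[OF assms] by (simp add: card_image)
qed

lemma reflection_comp_in: "w \<in> reflection_group (\<alpha> ` J) \<Longrightarrow> i \<in> J \<Longrightarrow>
    w \<circ> reflection (\<alpha> i) \<in> reflection_group (\<alpha> ` J)"
  by (rule reflection_group_comp[OF _ reflection_in_group]) auto

lemma comp_reflection_twice: "i \<in> J \<Longrightarrow> w \<circ> reflection (\<alpha> i) \<circ> reflection (\<alpha> i) = w"
proof -
  assume "i \<in> J"
  then have "\<alpha> i \<noteq> 0" using J root_nonzero[OF simple_root] by blast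
  then show ?thesis by (simp add: fun_eq_iff reflection_reflection)
qed

lemma card_inversions_ascent:
  assumes w: "w \<in> reflection_group (\<alpha> ` J)" and i: "i \<in> J" and pos: "w (\<alpha> i) \<in> positive_roots"
  shows "card (inversions J (w \<circ> reflection (\<alpha> i))) = Suc (card (inversions J w))"
proof -
  have i7: "i \<in> {1..7}" using J i by blast
  have n0: "\<alpha> i \<noteq> 0" using root_nonzero[OF simple_root[OF i7]] .
  have "(w \<circ> reflection (\<alpha> i)) (\<alpha> i) = - w (\<alpha> i)"
    using n0 root_isometryD(1)[OF parabolic_isometry[OF w]]
    by (simp add: reflection_def scaleR_2 linear_neg)
  then have "(w \<circ> reflection (\<alpha> i)) (\<alpha> i) \<notin> positive_roots"
    using minus_positive_not_positive[OF pos] by simp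
  from card_inversions_descent[OF reflection_comp_in[OF w i] i this]
  show ?thesis by (simp only: comp_reflection_twice[OF i])
qed

lemma image_rho:
  assumes w: "w \<in> reflection_group (\<alpha> ` J)" and c: "\<forall>k\<in>{1..7} - J. c ! (k - 1) = 0"
  shows "w (comb c) \<bullet> rho = (\<Sum>i\<in>J. real_of_int (c ! (i - 1)) * (w (\<alpha> i) \<bullet> rho))"
proof -
  note lin = root_isometryD(1)[OF parabolic_isometry[OF w]]
  have "w (comb c) \<bullet> rho = (\<Sum>i\<in>{1..7}. real_of_int (c ! (i - 1)) * (w (\<alpha> i) \<bullet> rho))"
    unfolding comb_def linear_sum[OF lin] linear_cmul[OF lin] inner_sum_left by simp
  also have "\<dots> = (\<Sum>i\<in>J. real_of_int (c ! (i - 1)) * (w (\<alpha> i) \<bullet> rho))"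
    by (rule sum.mono_neutral_right) (use J c in auto)
  finally show ?thesis .
qed

lemma image_simple_root: "w \<in> reflection_group (\<alpha> ` J) \<Longrightarrow> i \<in> J \<Longrightarrow> w (\<alpha> i) \<in> \<Phi>"
  by (rule root_isometryD(3)[OF parabolic_isometry]) (use J simple_root in auto)

text \<open>Pairing with \<open>rho\<close> tells positive from negative roots, and it is additive, so the signs of the images
  of the simple roots decide.\<close>

lemma no_inversions_if_simple:
  assumes w: "w \<in> reflection_group (\<alpha> ` J)" and pos: "\<And>i. i \<in> J \<Longrightarrow> w (\<alpha> i) \<in> positive_roots"
  shows "inversions J w = {}"
proof -
  have False if b: "\<beta> \<in> inversions J w" for \<beta>
  proof -
    obtain c where c: "c \<in> set E7_positive" "\<forall>k\<in>{1..7} - J. c ! (k - 1) = 0" "\<beta> = comb c"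
      using b by (auto simp: parabolic_positive_def inversions_def)
    have "0 \<le> w \<beta> \<bullet> rho"
      unfolding c(3) image_rho[OF w c(2)]
    proof (rule sum_nonneg)
      fix i assume i: "i \<in> J"
      then show "0 \<le> real_of_int (c ! (i - 1)) * (w (\<alpha> i) \<bullet> rho)"
        using positive_rho[OF pos[OF i]] pos_coeff_nonneg[OF c(1), of i] J by auto
    qed
    moreover have "w \<beta> \<in> \<Phi>" "w \<beta> \<notin> positive_roots"
      using b root_isometryD(3)[OF parabolic_isometry[OF w] positive_root_in[OF c(1)]] c(3)
      by (auto simp: inversions_def)
    ultimately show False using nonpositive_rho by fastforce
  qed
  then show ?thesis by blast
qed

lemma all_inversions_if_simple:
  assumes w: "w \<in> reflection_group (\<alpha> ` J)" and neg: "\<And>i. i \<in> J \<Longrightarrow> w (\<alpha> i) \<notin> positive_roots"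
  shows "inversions J w = parabolic_positive J"
proof -
  have False if b: "\<beta> \<in> parabolic_positive J" "w \<beta> \<in> positive_roots" for \<beta>
  proof -
    obtain c where c: "c \<in> set E7_positive" "\<forall>k\<in>{1..7} - J. c ! (k - 1) = 0" "\<beta> = comb c"
      using b by (auto simp: parabolic_positive_def)
    have "w \<beta> \<bullet> rho \<le> 0"
      unfolding c(3) image_rho[OF w c(2)]
    proof (rule sum_nonpos)
      fix i assume i: "i \<in> J"
      then show "real_of_int (c ! (i - 1)) * (w (\<alpha> i) \<bullet> rho) \<le> 0"
        using nonpositive_rho[OF image_simple_root[OF w i] neg[OF i]] pos_coeff_nonneg[OF c(1), of i] J
        by (auto simp: mult_le_0_iff)
    qed
    then show False using positive_rho[OF b(2)] by simp
  qed
  then show ?thesis by (auto simp: inversions_def)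
qed

text \<open>A positive root outside the parabolic subsystem has a positive coefficient outside \<open>J\<close>, which
  \<open>w\<close> preserves; so such roots stay positive in any case, and \<open>w\<close> preserves all positive roots.\<close>

lemma no_inversions_imp_id:
  assumes w: "w \<in> reflection_group (\<alpha> ` J)" and none: "inversions J w = {}"
  shows "w = id"
proof (rule preserves_positive_imp_id[OF parabolic_isometry[OF w]], rule image_subsetI)
  fix \<beta> assume "\<beta> \<in> positive_roots"
  then obtain c where c: "c \<in> set E7_positive" "\<beta> = comb c" by blast
  show "w \<beta> \<in> positive_roots"
  proof (cases "\<forall>k\<in>{1..7} - J. c ! (k - 1) = 0")
    case True
    then have "\<beta> \<in> parabolic_positive J" using c by (auto simp: parabolic_positive_def)
    then show ?thesis using none by (auto simp: inversions_def)
  next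
    case False
    then obtain k where k: "k \<in> {1..7} - J" "c ! (k - 1) \<noteq> 0" by blast
    obtain d where d: "length d = 7" "w (comb c) = comb d" "\<forall>k\<in>{1..7} - J. d ! (k - 1) = c ! (k - 1)"
      using parabolic_fixes_outer_coeffs[OF w length_positive_root[OF c(1)]] by blast
    have dk: "0 < d ! (k - 1)" using d(3) k pos_coeff_nonneg[OF c(1), of k] by auto
    have "w \<beta> \<in> \<Phi>"
      using root_isometryD(3)[OF parabolic_isometry[OF w] positive_root_in[OF c(1)]] c(2) by simp
    then show ?thesis
    proof (cases rule: positive_root_cases)
      case (1 e)
      then show ?thesis by simp
    next
      case (2 e)
      have le: "length e = 7" using 2 length_positive_root by blast
      have "d = map uminus e"
        by (rule comb_inj) (use 2 d c le in \<open>simp_all add: comb_uminus\<close>)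
      moreover have "k - 1 < 7" "0 \<le> e ! (k - 1)" using k pos_coeff_nonneg[OF 2(1), of k] by auto
      ultimately show ?thesis using dk le by simp
    qed
  qed
qed

text \<open>Greedy sorting: as long as inversions remain, some simple root is one of them and can be removed.\<close>

lemma ex_word_of_length_inversions:
  assumes "w \<in> reflection_group (\<alpha> ` J)"
  shows "\<exists>is. set is \<subseteq> J \<and> length is = card (inversions J w) \<and> w = word_product \<alpha> is"
  using assms
proof (induction "card (inversions J w)" arbitrary: w)
  case 0
  then have "w = id" using no_inversions_imp_id finite_inversions by simp
  then show ?case using 0 by (intro exI[of _ "[]"]) (simp add: word_product_Nil)
next
  case (Suc n)
  then have "inversions J w \<noteq> {}" by auto
  then obtain i where i: "i \<in> J" "w (\<alpha> i) \<notin> positive_roots"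
    using no_inversions_if_simple[OF Suc.prems] by blast
  let ?v = "w \<circ> reflection (\<alpha> i)"
  have n: "n = card (inversions J ?v)"
    using card_inversions_descent[OF Suc.prems i] Suc.hyps(2) by simp
  obtain js where "set js \<subseteq> J" "length js = n" "?v = word_product \<alpha> js"
    using Suc.hyps(1)[OF n reflection_comp_in[OF Suc.prems i(1)]] n by auto
  moreover from this have "w = word_product \<alpha> (js @ [i])"
    using comp_reflection_twice[OF i(1), of w] by (simp add: word_product_snoc)
  ultimately show ?case using i Suc.hyps(2) by (intro exI[of _ "js @ [i]"]) auto
qed

lemma inversions_le_word_length:
  "set is \<subseteq> J \<Longrightarrow> card (inversions J (word_product \<alpha> is)) \<le> length is"
proof (induction "is" rule: rev_induct)
  case Nil
  have "inversions J id = {}" using parabolic_subset by (auto simp: inversions_def)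
  then show ?case by (simp only: word_product_Nil card.empty le0)
next
  case (snoc i js)
  then have w: "word_product \<alpha> js \<in> reflection_group (\<alpha> ` J)" and i: "i \<in> J"
    by (auto intro: word_product_in_group)
  have IH: "card (inversions J (word_product \<alpha> js)) \<le> length js" using snoc by simp
  have "card (inversions J (word_product \<alpha> js \<circ> reflection (\<alpha> i))) \<le> Suc (length js)"
    using card_inversions_descent[OF w i] card_inversions_ascent[OF w i] IH by linarith
  then show ?case unfolding word_product_snoc length_append_singleton .
qed

lemma coxeter_length_eq_inversions:
  assumes "w \<in> reflection_group (\<alpha> ` J)"
  shows "coxeter_length \<alpha> J w = card (inversions J w)"
  unfolding coxeter_length_def
  by (rule Least_equality)
     (use ex_word_of_length_inversions[OF assms] inversions_le_word_length in auto)

text \<open>An element with the most inversions has no ascents.\<close>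

lemma ex_all_inversions:
  "\<exists>w\<in>reflection_group (\<alpha> ` J). inversions J w = parabolic_positive J"
proof -
  have "\<exists>w. w \<in> reflection_group (\<alpha> ` J) \<and>
      (\<forall>v. v \<in> reflection_group (\<alpha> ` J) \<longrightarrow> card (inversions J v) \<le> card (inversions J w))"
    by (rule ex_has_greatest_nat[where k = id and b = "Suc (card (parabolic_positive J))"])
       (auto simp: less_Suc_eq_le inversions_def finite_parabolic reflection_group.one
         intro!: card_mono)
  then obtain w where w: "w \<in> reflection_group (\<alpha> ` J)"
    "\<And>v. v \<in> reflection_group (\<alpha> ` J) \<Longrightarrow> card (inversions J v) \<le> card (inversions J w)"
    by blast
  have "w (\<alpha> i) \<notin> positive_roots" if "i \<in> J" for i
    using card_inversions_ascent[OF w(1) that] w(2)[OF reflection_comp_in[OF w(1) that]] by auto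
  then show ?thesis using all_inversions_if_simple[OF w(1)] w(1) by blast
qed

text \<open>If \<open>v\<close> and \<open>w\<close> both negate the parabolic positive roots, the quotient has no inversions.\<close>

lemma all_inversions_unique:
  assumes v: "v \<in> reflection_group (\<alpha> ` J)" "inversions J v = parabolic_positive J"
    and w: "w \<in> reflection_group (\<alpha> ` J)" "inversions J w = parabolic_positive J"
  shows "v = w"
proof -
  have "\<alpha> ` J \<subseteq> \<Phi>" using J simple_root by auto
  then have "0 \<notin> \<alpha> ` J" using zero_notin_roots by (rule contra_subsetD)
  then obtain u where u: "u \<in> reflection_group (\<alpha> ` J)" "u \<circ> v = id" "v \<circ> u = id"
    using reflection_group_inverse v(1) by blast
  have sw: "- w' \<beta> \<in> parabolic_positive J"
    if "w' \<in> reflection_group (\<alpha> ` J)" "inversions J w' = parabolic_positive J" "\<beta> \<in> parabolic_positive J"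
    for w' \<beta>
  proof -
    have "\<beta> \<in> inversions J w'" unfolding that(2) by (rule that(3))
    then have "w' \<beta> \<notin> parabolic_positive J"
      using parabolic_subset unfolding inversions_def by blast
    then show ?thesis using parabolic_image[OF that(1,3)] by blast
  qed
  have uw: "u \<circ> w \<in> reflection_group (\<alpha> ` J)" using reflection_group_comp u w by blast
  have "inversions J (u \<circ> w) = {}"
  proof -
    have False if b: "\<beta> \<in> inversions J (u \<circ> w)" for \<beta>
    proof -
      have "\<beta> \<in> parabolic_positive J" using b by (simp add: inversions_def)
      then have g: "- w \<beta> \<in> parabolic_positive J" using sw[OF w] by blast
      have "u (- w \<beta>) \<in> positive_roots"
      proof -
        have "\<beta> \<in> \<Phi>"
          using b parabolic_subset positive_subset_roots unfolding inversions_def by blast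
        then have "u (w \<beta>) \<in> \<Phi>" "u (w \<beta>) \<notin> positive_roots"
          using b root_isometryD(3)[OF parabolic_isometry[OF uw]] by (simp_all add: inversions_def)
        then show ?thesis
          using not_positive_iff linear_neg[OF root_isometryD(1)[OF parabolic_isometry[OF u(1)]]]
          by simp
      qed
      then have "u (- w \<beta>) \<in> parabolic_positive J"
        using parabolic_image[OF u(1) g] parabolic_subset minus_positive_not_positive by blast
      then have "- v (u (- w \<beta>)) \<in> parabolic_positive J" using sw[OF v] by blast
      moreover have "v (u (- w \<beta>)) = - w \<beta>" using u(3) by (metis comp_apply id_apply)
      ultimately have "w \<beta> \<in> positive_roots" using subsetD[OF parabolic_subset] by simp
      from minus_positive_not_positive[OF this] show False using subsetD[OF parabolic_subset g] ..
    qed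
    then show ?thesis by blast
  qed
  then have "u \<circ> w = id" using no_inversions_imp_id[OF uw] by blast
  then have "v \<circ> (u \<circ> w) = v" by simp
  then show ?thesis unfolding comp_assoc[symmetric] u(3) by simp
qed

lemma longest_element_inversions:
  "longest_element \<alpha> J \<in> reflection_group (\<alpha> ` J)"
  "inversions J (longest_element \<alpha> J) = parabolic_positive J"
proof -
  obtain w where w: "w \<in> reflection_group (\<alpha> ` J)" "inversions J w = parabolic_positive J"
    using ex_all_inversions by blast
  have sub: "inversions J v \<subseteq> parabolic_positive J" for v by (auto simp: inversions_def)
  have "longest_element \<alpha> J = w"
    unfolding longest_element_def
  proof (rule the_equality)
    show "w \<in> reflection_group (\<alpha> ` J) \<and>
        (\<forall>v\<in>reflection_group (\<alpha> ` J). coxeter_length \<alpha> J v \<le> coxeter_length \<alpha> J w)"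
      using w card_mono[OF finite_parabolic sub] by (auto simp: coxeter_length_eq_inversions)
  next
    fix v assume v: "v \<in> reflection_group (\<alpha> ` J) \<and>
        (\<forall>w\<in>reflection_group (\<alpha> ` J). coxeter_length \<alpha> J w \<le> coxeter_length \<alpha> J v)"
    then have "card (parabolic_positive J) \<le> card (inversions J v)"
      using w coxeter_length_eq_inversions by metis
    then have "inversions J v = parabolic_positive J"
      using card_seteq[OF finite_parabolic sub] by blast
    then show "v = w" using all_inversions_unique v w by blast
  qed
  then show "longest_element \<alpha> J \<in> reflection_group (\<alpha> ` J)"
    "inversions J (longest_element \<alpha> J) = parabolic_positive J" using w by simp_all
qed

end

end

section \<open>The flip and the stabilizer of the alcove\<close>

lemma affine_flip_flip: "i \<le> 7 \<Longrightarrow> affine_flip (affine_flip i) = i"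
  and affine_flip_le: "i \<le> 7 \<Longrightarrow> affine_flip i \<le> 7"
proof -
  have "\<forall>i\<in>set [0,1,2,3,4,5,6,7]. affine_flip (affine_flip i) = i \<and> affine_flip i \<le> 7" by code_simp
  moreover assume "i \<le> 7"
  then have "i \<in> set [0,1,2,3,4,5,6,7]" by auto
  ultimately show "affine_flip (affine_flip i) = i" "affine_flip i \<le> 7" by blast+
qed

lemma coset_eq_iff:
  assumes "0 \<in> L" "\<And>x y. x \<in> L \<Longrightarrow> y \<in> L \<Longrightarrow> x - y \<in> L"
  shows "coset L x = coset L y \<longleftrightarrow> x - y \<in> L"
proof
  assume "coset L x = coset L y"
  moreover have "x \<in> coset L x" using assms(1) by (force simp: coset_def)
  ultimately obtain z where "x = y + z" "z \<in> L" by (auto simp: coset_def)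
  then show "x - y \<in> L" by simp
next
  have sub: "coset L x \<subseteq> coset L y" if "x - y \<in> L" for x y
  proof
    fix t assume "t \<in> coset L x"
    then obtain z where z: "z \<in> L" "t = x + z" by (auto simp: coset_def)
    have "(x - y) - (0 - z) \<in> L" using assms that z by blast
    moreover have "t = y + ((x - y) - (0 - z))" using z by simp
    ultimately show "t \<in> coset L y" unfolding coset_def by blast
  qed
  assume xy: "x - y \<in> L"
  then have "0 - (x - y) \<in> L" using assms by blast
  then show "coset L x = coset L y" using sub[OF xy] sub[of y x] by simp
qed

lemma image_coset: "linear u \<Longrightarrow> u ` L = L \<Longrightarrow> u ` coset L x = coset L (u x)"
  by (auto simp: coset_def image_image linear_add) (metis image_iff)

context E7
begin

text \<open>The negative of the longest element preserves the positive roots.\<close>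

lemma longest_element_full: "longest_element \<alpha> {1..7} = (\<lambda>x. - x)"
proof -
  define w where "w = longest_element \<alpha> {1..7}"
  have w: "w \<in> reflection_group (\<alpha> ` {1..7})" "inversions {1..7} w = positive_roots"
    using longest_element_inversions[OF order_refl] by (simp_all only: w_def parabolic_full)
  note iso = parabolic_isometry[OF order_refl w(1)]
  have "(\<lambda>x. - w x) ` positive_roots \<subseteq> positive_roots"
  proof (rule image_subsetI)
    fix \<beta> assume b: "\<beta> \<in> positive_roots"
    then have "\<beta> \<in> inversions {1..7} w" by (simp only: w)
    then have "w \<beta> \<notin> positive_roots" unfolding inversions_def by blast
    moreover have "w \<beta> \<in> \<Phi>"
      by (rule root_isometryD(3)[OF iso]) (rule subsetD[OF positive_subset_roots b])
    ultimately show "- w \<beta> \<in> positive_roots" using not_positive_iff by blast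
  qed
  then have "(\<lambda>x. - w x) = id"
    by (rule preserves_positive_imp_id[OF root_isometry_uminus[OF iso]])
  then have "- w x = x" for x by (metis id_apply)
  then have "w x = - x" for x by (metis minus_equation_iff)
  then show ?thesis by (auto simp: w_def)
qed

text \<open>The name anticipates \<open>flip_affine\<close>: this element induces the reflection of the extended diagram.\<close>

abbreviation flip :: "'a \<Rightarrow> 'a" where
  "flip \<equiv> omega \<alpha> {1..7} 7"

lemma flip_weyl: "flip \<in> weyl"
proof -
  have "{1..7} - {7::nat} \<subseteq> {1..7}" by blast
  from parabolic_weyl[OF this longest_element_inversions(1)[OF this]]
    parabolic_weyl[OF order_refl longest_element_inversions(1)[OF order_refl]]
  show ?thesis by (simp add: omega_def reflection_group_comp)
qed

lemma flip_isometry: "root_isometry flip"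
  by (rule weyl_root_isometry[OF flip_weyl])

text \<open>Up to sign the flip is the longest element of the parabolic \<open>E\<^sub>6\<close>, which negates the positive roots of
  \<open>E\<^sub>6\<close>.\<close>

lemma flip_parabolic:
  assumes "i \<in> {1..7} - {7}" shows "inv flip (\<alpha> i) \<in> positive_roots"
proof -
  let ?J = "{1..7} - {7::nat}"
  define w where "w = longest_element \<alpha> ?J"
  have J: "?J \<subseteq> {1..7}" by blast
  have w: "w \<in> reflection_group (\<alpha> ` ?J)" "inversions ?J w = parabolic_positive ?J"
    using longest_element_inversions[OF J] by (simp_all only: w_def)
  have fw: "flip x = - w x" for x
    using linear_neg[OF root_isometryD(1)[OF parabolic_isometry[OF J w(1)]]]
    by (simp add: omega_def longest_element_full w_def)
  have "flip ` parabolic_positive ?J = parabolic_positive ?J"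
  proof (rule endo_inj_surj[OF finite_parabolic])
    show "inj_on flip (parabolic_positive ?J)"
      by (rule inj_on_subset[OF root_isometry_inj[OF flip_isometry]]) simp
    show "flip ` parabolic_positive ?J \<subseteq> parabolic_positive ?J"
    proof (rule image_subsetI)
      fix \<beta> assume b: "\<beta> \<in> parabolic_positive ?J"
      then have "\<beta> \<in> inversions ?J w" by (simp only: w)
      then have "w \<beta> \<notin> positive_roots" unfolding inversions_def by blast
      then have "w \<beta> \<notin> parabolic_positive ?J" using parabolic_subset by blast
      then show "flip \<beta> \<in> parabolic_positive ?J"
        unfolding fw using parabolic_image[OF J w(1) b] by blast
    qed
  qed
  then have "\<alpha> i \<in> flip ` parabolic_positive ?J" using simple_in_parabolic[OF J assms] by simp
  then obtain \<gamma> where "\<alpha> i = flip \<gamma>" "\<gamma> \<in> parabolic_positive ?J" by (rule imageE)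
  then show ?thesis
    using root_isometry_inv_cancel(2)[OF flip_isometry, of \<gamma>] subsetD[OF parabolic_subset] by simp
qed

text \<open>The longest element of the parabolic \<open>E\<^sub>6\<close> preserves the coefficient of \<open>\<alpha> 7\<close>, and the sign in
  front of it makes this coefficient negative.\<close>

lemma flip_outer:
  assumes "d \<in> set E7_positive" "d ! 6 = 1"
  shows "inv flip (comb d) \<in> \<Phi>" "- inv flip (comb d) \<in> positive_roots"
proof -
  let ?J = "{1..7} - {7::nat}"
  define w where "w = longest_element \<alpha> ?J"
  have J: "?J \<subseteq> {1..7}" by blast
  have w: "w \<in> reflection_group (\<alpha> ` ?J)"
    using longest_element_inversions[OF J] by (simp_all only: w_def)
  have fw: "flip x = - w x" for x
    using linear_neg[OF root_isometryD(1)[OF parabolic_isometry[OF J w(1)]]]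
    by (simp add: omega_def longest_element_full w_def)
  let ?g = "inv flip (comb d)"
  show g: "?g \<in> \<Phi>"
    by (rule root_isometryD(3)[OF root_isometry_inv[OF flip_isometry] positive_root_in[OF assms(1)]])
  then show "- inv flip (comb d) \<in> positive_roots"
  proof (cases rule: positive_root_cases)
    case (1 c)
    obtain e where e: "length e = 7" "w (comb c) = comb e" "\<forall>k\<in>{1..7} - ?J. e ! (k - 1) = c ! (k - 1)"
      using parabolic_fixes_outer_coeffs[OF J w length_positive_root[OF 1(1)]] by blast
    have "comb d = flip ?g" using root_isometry_inv_cancel(1)[OF flip_isometry] by simp
    also have "\<dots> = - comb e" unfolding fw 1(2) e(2) ..
    finally have "e = map uminus d"
      using comb_inj[of e "map uminus d"] e(1) length_positive_root[OF assms(1)] by (simp add: comb_uminus)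
    then have "e ! 6 = - 1" using assms length_positive_root[OF assms(1)] by simp
    moreover have "e ! 6 = c ! 6" using bspec[OF e(3), of 7] by simp
    moreover have "0 \<le> c ! 6" using pos_coeff_nonneg[OF 1(1), of 7] by simp
    ultimately show ?thesis by simp
  next
    case (2 c)
    then show ?thesis by simp
  qed
qed

definition coweight7 :: 'a where
  "coweight7 = (SOME x. \<forall>i\<in>{1..7}. \<alpha> i \<bullet> x = (if i = 7 then 1 else 0))"

lemma simple_coweight7: "i \<in> {1..7} \<Longrightarrow> \<alpha> i \<bullet> coweight7 = (if i = 7 then 1 else 0)"
  using someI_ex[OF ex_coords[of "\<lambda>i. if i = 7 then 1 else 0"]] unfolding coweight7_def by blast

lemma coweight7_in: "coweight7 \<in> coweights"
  by (simp add: coweight_iff simple_coweight7)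

lemma affine_root_0_inner:
  "affine_root 0 \<bullet> x = - (2 * (\<alpha> 1 \<bullet> x) + 2 * (\<alpha> 2 \<bullet> x) + 3 * (\<alpha> 3 \<bullet> x) + 4 * (\<alpha> 4 \<bullet> x) +
     3 * (\<alpha> 5 \<bullet> x) + 2 * (\<alpha> 6 \<bullet> x) + \<alpha> 7 \<bullet> x)"
  using affine_relation[OF linear_id, of x] unfolding affine_marks by simp

text \<open>On the image of the alcove under the flip, \<open>\<alpha> 7\<close> and the highest root take values between -1 and 0.
  The seventh fundamental coweight has value 1 on both and 0 on the other simple roots, so adding it
  moves these values between 0 and 1.\<close>

lemma flip_shift_alcove:
  assumes "x \<in> alcove" shows "flip x + coweight7 \<in> alcove"
proof -
  note inner = inner_root_isometry[OF flip_isometry]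
  have "0 < \<alpha> i \<bullet> (flip x + coweight7)" if i: "i \<in> {1..7}" for i
  proof (cases "i = 7")
    case False
    then have "inv flip (\<alpha> i) \<in> positive_roots" using flip_parabolic i by blast
    from positive_root_alcove(1)[OF assms this] show ?thesis
      using i False by (simp add: inner_add_right inner simple_coweight7)
  next
    case True
    have "affine_simple 7 ! 6 = 1" by code_simp
    then have "- inv flip (comb (affine_simple 7)) \<in> positive_roots"
      using flip_outer(2) affine_simple_positive[of 7] by simp
    from positive_root_alcove(2)[OF assms this] show ?thesis
      using True by (simp add: inner_add_right inner simple_coweight7 comb_affine_simple)
  qed
  moreover have "- 1 < affine_root 0 \<bullet> (flip x + coweight7)"
  proof -
    have "map uminus (affine_simple 0) ! 6 = 1" by code_simp
    then have "- inv flip (- affine_root 0) \<in> positive_roots"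
      unfolding minus_affine_root_0 using flip_outer(2) highest_positive by blast
    then have "inv flip (affine_root 0) \<in> positive_roots"
      using linear_neg[OF root_isometryD(1)[OF root_isometry_inv[OF flip_isometry]]] by simp
    from positive_root_alcove(1)[OF assms this] have "0 < affine_root 0 \<bullet> flip x"
      by (simp add: inner)
    moreover have "affine_root 0 \<bullet> coweight7 = - 1"
      unfolding affine_root_0_inner by (simp add: simple_coweight7)
    ultimately show ?thesis by (simp add: inner_add_right)
  qed
  ultimately show ?thesis by (simp add: alcove_iff)
qed

lemma rho_alcove: "(1 / 18) *\<^sub>R rho \<in> alcove"
  unfolding alcove_iff affine_root_0_inner by (auto simp: simple_rho)

text \<open>By \<open>flip_shift_alcove\<close> the flip permutes the affine simple roots. It is not the identity, since it
  makes a simple root negative.\<close>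

lemma flip_affine:
  assumes "i \<le> 7" shows "flip (affine_root i) = affine_root (affine_flip i)"
proof -
  note inv = root_isometry_inv[OF flip_isometry]
  have "\<exists>j\<le>7. inv flip (affine_root i) = affine_root j" if "i \<le> 7" for i
    by (rule isometry_permutes_affine_roots[OF inv rho_alcove flip_shift_alcove[OF rho_alcove] _ that])
       (simp add: inner_add_right inner_root_isometry[OF flip_isometry] coweight_root[OF coweight7_in])
  from affine_permutation_cases[OF inv this]
  have *: "\<forall>i\<le>7. inv flip (affine_root i) = affine_root (affine_flip i)"
  proof
    assume "\<forall>i\<le>7. inv flip (affine_root i) = affine_root i"
    then have "inv flip (comb (affine_simple 7)) = comb (affine_simple 7)"
      unfolding affine_root_def by blast
    moreover have "affine_simple 7 ! 6 = 1" by code_simp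
    ultimately have "- comb (affine_simple 7) \<in> positive_roots"
      using flip_outer(2)[of "affine_simple 7"] affine_simple_positive[of 7] by simp
    moreover have "comb (affine_simple 7) \<in> positive_roots"
      by (rule imageI[OF affine_simple_positive]) simp
    ultimately show ?thesis using minus_positive_not_positive by blast
  qed
  have "inv flip (affine_root (affine_flip i)) = affine_root i"
    using * affine_flip_flip affine_flip_le assms by simp
  then show ?thesis using root_isometry_inv_cancel(1)[OF flip_isometry] by metis
qed

lemma flip_flip: "flip \<circ> flip = id"
  by (rule isometry_eqI[OF root_isometry_comp[OF flip_isometry flip_isometry] root_isometry_id])
     (simp add: flip_affine affine_flip_flip affine_flip_le)

lemma inv_flip: "inv flip = flip"
  by (rule inv_unique_comp[OF flip_flip flip_flip])

lemma flip_neq_id: "flip \<noteq> id"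
proof
  assume "flip = id"
  then have "affine_root 0 = affine_root (affine_flip 0)" using flip_affine[of 0] by simp
  then show False using affine_root_inj[of 0 "affine_flip 0"] affine_flip_le[of 0]
    by (simp add: affine_flip_def)
qed

text \<open>The inverse of \<open>w\<close> satisfies the hypotheses of \<open>isometry_permutes_affine_roots\<close>.\<close>

lemma weyl_alcove_cases:
  assumes w: "w \<in> weyl" and x: "x \<in> alcove" and y: "y \<in> alcove"
    and cong: "w x - y \<in> coweights"
  shows "w = id \<or> w = flip"
proof -
  note iso = weyl_root_isometry[OF w]
  note inv = root_isometry_inv[OF iso]
  have "\<exists>j\<le>7. inv w (affine_root i) = affine_root j" if "i \<le> 7" for i
    by (rule isometry_permutes_affine_roots[OF inv x y _ that])
       (use coweight_root[OF cong] in \<open>simp add: inner_diff_right inner_root_isometry[OF iso]\<close>)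
  then have "(\<forall>i\<le>7. inv w (affine_root i) = affine_root i) \<or>
      (\<forall>i\<le>7. inv w (affine_root i) = affine_root (affine_flip i))"
    by (rule affine_permutation_cases[OF inv])
  then have "inv w = id \<or> inv w = flip"
  proof (elim disjE)
    assume "\<forall>i\<le>7. inv w (affine_root i) = affine_root i"
    then have "inv w = id" by (intro isometry_eqI[OF inv root_isometry_id]) auto
    then show ?thesis ..
  next
    assume "\<forall>i\<le>7. inv w (affine_root i) = affine_root (affine_flip i)"
    then have "inv w = flip"
      by (intro isometry_eqI[OF inv flip_isometry]) (auto simp: flip_affine)
    then show ?thesis ..
  qed
  moreover have "w = inv (inv w)" using inv_inv_eq[OF root_isometry_bij[OF iso]] by simp
  ultimately show ?thesis using inv_flip by auto
qed

lemma isometry_image_coweight: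
  assumes "root_isometry u" shows "u ` coweights = coweights"
proof
  show "u ` coweights \<subseteq> coweights" using coweight_isometry[OF assms] by blast
  show "coweights \<subseteq> u ` coweights"
  proof
    fix x assume "x \<in> coweights"
    then have "inv u x \<in> coweights" by (rule coweight_isometry[OF root_isometry_inv[OF assms]])
    then have "u (inv u x) \<in> u ` coweights" by (rule imageI)
    then show "x \<in> u ` coweights" using root_isometry_inv_cancel(1)[OF assms] by simp
  qed
qed

text \<open>A single point of the alcove already decides: its image has to agree with an alcove point modulo
  coweights.\<close>

lemma alcove_stabilizer_eq: "alcove_stabilizer \<Phi> \<alpha> {1..7} = {id, flip}"
proof
  let ?Z = "coweights"
  note ceq = coset_eq_iff[OF coweight_zero coweight_diff]
  show "alcove_stabilizer \<Phi> \<alpha> {1..7} \<subseteq> {id, flip}"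
  proof
    fix w assume "w \<in> alcove_stabilizer \<Phi> \<alpha> {1..7}"
    then have w: "w \<in> weyl"
      and st: "(\<lambda>t. w ` t) ` (coset ?Z ` alcove) = coset ?Z ` alcove"
      by (auto simp: alcove_stabilizer_def)
    note iso = weyl_root_isometry[OF w]
    let ?x = "(1 / 18) *\<^sub>R rho"
    have "w ` coset ?Z ?x \<in> (\<lambda>t. w ` t) ` (coset ?Z ` alcove)" using rho_alcove by blast
    then obtain y where y: "y \<in> alcove" "w ` coset ?Z ?x = coset ?Z y" unfolding st by blast
    then have "coset ?Z (w ?x) = coset ?Z y"
      using image_coset[OF root_isometryD(1)[OF iso] isometry_image_coweight[OF iso]] by simp
    then have "w ?x - y \<in> ?Z" using ceq by blast
    from weyl_alcove_cases[OF w rho_alcove y(1) this] show "w \<in> {id, flip}" by blast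
  qed
  have flip_in: "flip ` t \<in> coset ?Z ` alcove" if t: "t \<in> coset ?Z ` alcove" for t
  proof -
    obtain x where x: "x \<in> alcove" "t = coset ?Z x" using t by blast
    have "flip ` t = coset ?Z (flip x)"
      unfolding x(2)
      by (rule image_coset[OF root_isometryD(1)[OF flip_isometry] isometry_image_coweight[OF flip_isometry]])
    also have "\<dots> = coset ?Z (flip x + coweight7)"
      using ceq coweight_diff[OF coweight_zero coweight7_in] by simp
    finally show ?thesis using flip_shift_alcove[OF x(1)] by blast
  qed
  have "flip ` (flip ` t) = t" for t
    unfolding image_comp flip_flip by simp
  then have "coset ?Z ` alcove \<subseteq> (\<lambda>t. flip ` t) ` (coset ?Z ` alcove)"
    using flip_in by (metis imageI subsetI)
  then have "(\<lambda>t. flip ` t) ` (coset ?Z ` alcove) = coset ?Z ` alcove"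
    using flip_in by blast
  then have "flip \<in> alcove_stabilizer \<Phi> \<alpha> {1..7}"
    using flip_weyl by (simp add: alcove_stabilizer_def)
  moreover have "id \<in> alcove_stabilizer \<Phi> \<alpha> {1..7}"
    using reflection_group.one by (simp add: alcove_stabilizer_def)
  ultimately show "{id, flip} \<subseteq> alcove_stabilizer \<Phi> \<alpha> {1..7}" by blast
qed

end

section \<open>Alcove points as representatives modulo the lattice\<close>

lemma card_eq_twice_card_image:
  assumes "finite A" and fib: "\<And>a. a \<in> A \<Longrightarrow> {b \<in> A. f b = f a} = {a, g a} \<and> g a \<noteq> a"
  shows "card A = 2 * card (f ` A)"
proof -
  have "card A = (\<Sum>t\<in>f ` A. card {b \<in> A. f b = t})"
    using sum.group[OF assms(1) finite_imageI[OF assms(1)] order_refl,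
        where g = f and h = "\<lambda>_. 1::nat"] by simp
  also have "\<dots> = (\<Sum>t\<in>f ` A. 2)"
  proof (rule sum.cong[OF refl])
    fix t assume "t \<in> f ` A"
    then obtain a where "a \<in> A" "t = f a" by blast
    then show "card {b \<in> A. f b = t} = 2" using fib[of a] by (auto simp: card_insert_if)
  qed
  finally show ?thesis by simp
qed

text \<open>The vector subtracted from \<open>y\<close> makes this the reflection in the affine hyperplane where \<open>a\<close> has the
  value \<open>k\<close>. It decreases the distance to \<open>p\<close> exactly if \<open>y\<close> and \<open>p\<close> lie strictly on opposite sides.\<close>

lemma reflected_distance:
  fixes a y p :: "'a::real_inner"
  assumes "a \<noteq> 0"
  shows "(norm (y - (2 * (a \<bullet> y - k) / (a \<bullet> a)) *\<^sub>R a - p))\<^sup>2 =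
    (norm (y - p))\<^sup>2 + 4 * (a \<bullet> y - k) * (a \<bullet> p - k) / (a \<bullet> a)"
proof -
  define t where "t = 2 * (a \<bullet> y - k) / (a \<bullet> a)"
  have ta: "t * (a \<bullet> a) = 2 * (a \<bullet> y - k)" using assms by (simp add: t_def)
  have "(norm (y - t *\<^sub>R a - p))\<^sup>2 = (norm (y - p))\<^sup>2 - 2 * t * (a \<bullet> y - a \<bullet> p) + t * (t * (a \<bullet> a))"
    by (simp add: power2_norm_eq_inner inner_diff_left inner_diff_right inner_commute algebra_simps)
  also have "\<dots> = (norm (y - p))\<^sup>2 + 2 * t * (a \<bullet> p - k)"
    unfolding ta by (simp add: algebra_simps)
  finally show ?thesis by (simp add: t_def mult.assoc)
qed

context E7
begin

text \<open>A linear map is determined by the images of the simple roots, which are roots.\<close>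

lemma finite_weyl: "finite (weyl)"
proof (rule inj_on_finite)
  let ?f = "\<lambda>w. restrict (\<lambda>i. w (\<alpha> i)) {1..7}"
  show "inj_on ?f (weyl)"
  proof (rule inj_onI)
    fix v w assume vw: "v \<in> weyl" "w \<in> weyl" "?f v = ?f w"
    show "v = w"
    proof (rule linear_eqI)
      show "v (\<alpha> i) = w (\<alpha> i)" if "i \<in> {1..7}" for i
        using fun_cong[OF vw(3), of i] that by simp
    qed (use vw root_isometryD(1)[OF weyl_root_isometry] in auto)
  qed
  show "?f ` weyl \<subseteq> PiE {1..7} (\<lambda>_. \<Phi>)"
    using root_isometryD(3)[OF weyl_root_isometry] simple_root by auto
  show "finite (PiE {1..7::nat} (\<lambda>_. \<Phi>))" by (intro finite_PiE finite_roots) auto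
qed

lemma finite_coweights_near: "finite {y \<in> coweights. norm (y - p) \<le> r}"
proof (rule inj_on_finite)
  let ?f = "\<lambda>y. restrict (\<lambda>i. \<alpha> i \<bullet> y) {1..7}"
  define B where "B = (\<lambda>i. norm (\<alpha> i) * (norm p + r))"
  show "inj_on ?f {y \<in> coweights. norm (y - p) \<le> r}"
  proof (rule inj_onI)
    fix x y assume eq: "?f x = ?f y"
    have "\<alpha> i \<bullet> x = \<alpha> i \<bullet> y" if "i \<in> {1..7}" for i
      using fun_cong[OF eq, of i] that by simp
    then show "x = y" by (rule coords_eqI)
  qed
  show "?f ` {y \<in> coweights. norm (y - p) \<le> r} \<subseteq>
      PiE {1..7} (\<lambda>i. {t \<in> \<int>. - B i \<le> t \<and> t \<le> B i})"
  proof (rule image_subsetI, rule restrict_PiE_iff[THEN iffD2], rule ballI)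
    fix y i assume y: "y \<in> {y \<in> coweights. norm (y - p) \<le> r}" and i: "i \<in> {1..7::nat}"
    have "norm y \<le> norm p + r" using y norm_triangle_sub[of y p] by simp
    then have "\<bar>\<alpha> i \<bullet> y\<bar> \<le> B i"
      unfolding B_def using Cauchy_Schwarz_ineq2[of "\<alpha> i" y]
      by (meson mult_left_mono norm_ge_zero order_trans)
    then show "\<alpha> i \<bullet> y \<in> {t \<in> \<int>. - B i \<le> t \<and> t \<le> B i}"
      using y i by (auto simp: coweight_iff)
  qed
  show "finite (PiE {1..7} (\<lambda>i. {t \<in> \<int>. - B i \<le> t \<and> t \<le> B i}))"
    by (intro finite_PiE) (auto intro: finite_int_segment)
qed

context
  fixes q :: int
  assumes q: "0 < q"
begin

abbreviation lattice :: "'a set" where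
  "lattice \<equiv> scaled_lattice \<Phi> q"

text \<open>The congruence condition of \<open>M\<close> in divided form.\<close>

definition regular :: "'a \<Rightarrow> bool" where
  "regular x \<longleftrightarrow> (\<forall>\<beta>\<in>\<Phi>. \<beta> \<bullet> x / q \<notin> \<int>)"

text \<open>The coweights in the alcove dilated by \<open>q\<close>.\<close>

definition level :: "'a set" where
  "level = {y \<in> coweights. (1 / real_of_int q) *\<^sub>R y \<in> alcove}"

lemma rcong_zero_iff: "[b = 0] (rmod (of_int q)) \<longleftrightarrow> b / q \<in> \<int>"
proof
  assume "[b = 0] (rmod (of_int q))"
  then obtain n where "0 = b + of_int n * real_of_int q" by (auto simp: rcong_altdef)
  then have "b = of_int (- n) * real_of_int q" by simp
  then have "b / q = of_int (- n)" using q by (simp add: field_simps)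
  then show "b / q \<in> \<int>" by (metis Ints_of_int)
next
  assume "b / q \<in> \<int>"
  then obtain n where "b / q = of_int n" by (rule Ints_cases)
  then have "0 = b + of_int (- n) * real_of_int q" using q by (simp add: field_simps)
  then show "[b = 0] (rmod (of_int q))" unfolding rcong_altdef by blast
qed

lemma M_eq: "M \<Phi> q = coset lattice ` {x \<in> coweights. regular x}"
  by (auto simp: M_def regular_def rcong_zero_iff)

lemma lattice_iff: "x \<in> lattice \<longleftrightarrow> (1 / real_of_int q) *\<^sub>R x \<in> coweights"
proof
  assume "(1 / real_of_int q) *\<^sub>R x \<in> coweights"
  then have "real_of_int q *\<^sub>R (1 / real_of_int q) *\<^sub>R x \<in> lattice"
    unfolding scaled_lattice_def by blast
  then show "x \<in> lattice" using q by simp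
qed (use q in \<open>auto simp: scaled_lattice_def\<close>)

lemma lattice_zero: "0 \<in> lattice"
  and lattice_diff: "x \<in> lattice \<Longrightarrow> y \<in> lattice \<Longrightarrow> x - y \<in> lattice"
  using coweight_zero coweight_diff by (auto simp: lattice_iff scaleR_diff_right)

lemma lattice_isometry:
  assumes "root_isometry u" shows "x \<in> lattice \<Longrightarrow> u x \<in> lattice"
  using coweight_isometry[OF assms, of "(1 / real_of_int q) *\<^sub>R x"]
    linear_cmul[OF root_isometryD(1)[OF assms]] by (simp add: lattice_iff)

lemma lattice_coset_eq_iff: "coset lattice x = coset lattice y \<longleftrightarrow> x - y \<in> lattice"
  by (rule coset_eq_iff[OF lattice_zero lattice_diff])

lemma isometry_image_lattice:
  assumes "root_isometry u" shows "u ` lattice = lattice"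
proof
  show "u ` lattice \<subseteq> lattice" using lattice_isometry[OF assms] by blast
  show "lattice \<subseteq> u ` lattice"
  proof
    fix x assume "x \<in> lattice"
    then have "inv u x \<in> lattice" by (rule lattice_isometry[OF root_isometry_inv[OF assms]])
    then have "u (inv u x) \<in> u ` lattice" by (rule imageI)
    then show "x \<in> u ` lattice" using root_isometry_inv_cancel(1)[OF assms] by simp
  qed
qed

lemma image_lattice_coset: "root_isometry u \<Longrightarrow> u ` coset lattice x = coset lattice (u x)"
  by (rule image_coset[OF root_isometryD(1) isometry_image_lattice])

lemma regular_isometry:
  assumes "root_isometry u" "regular x" shows "regular (u x)"
  unfolding regular_def
proof
  fix \<beta> assume "\<beta> \<in> \<Phi>"
  then have "inv u \<beta> \<in> \<Phi>" by (rule root_isometryD(3)[OF root_isometry_inv[OF assms(1)]])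
  then show "\<beta> \<bullet> u x / q \<notin> \<int>"
    using assms(2) unfolding inner_root_isometry[OF assms(1)] regular_def by blast
qed

lemma regular_cong:
  assumes "regular x" "y - x \<in> lattice" shows "regular y"
  unfolding regular_def
proof
  fix \<beta> assume b: "\<beta> \<in> \<Phi>"
  then have "\<beta> \<bullet> ((1 / real_of_int q) *\<^sub>R (y - x)) \<in> \<int>"
    using assms(2) coweight_root by (simp only: lattice_iff)
  then have d: "\<beta> \<bullet> y / q - \<beta> \<bullet> x / q \<in> \<int>"
    by (simp add: inner_diff_right diff_divide_distrib)
  show "\<beta> \<bullet> y / q \<notin> \<int>"
  proof
    assume "\<beta> \<bullet> y / q \<in> \<int>"
    from Ints_diff[OF this d] have "\<beta> \<bullet> x / q \<in> \<int>" by simp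
    then show False using assms(1) b by (simp add: regular_def)
  qed
qed

lemma level_regular: assumes "y \<in> level" shows "regular y"
  unfolding regular_def
proof
  fix \<beta> assume b: "\<beta> \<in> \<Phi>"
  let ?t = "\<beta> \<bullet> y / q + neg_indicator \<beta>"
  have "0 < ?t" "?t < 1"
    using root_in_unit_interval[OF b, of "(1 / real_of_int q) *\<^sub>R y"] assms by (auto simp: level_def)
  moreover have "?t \<in> \<int>" if "\<beta> \<bullet> y / q \<in> \<int>"
    using Ints_add[OF that, of "neg_indicator \<beta>"] by (auto simp: neg_indicator_def)
  ultimately show "\<beta> \<bullet> y / q \<notin> \<int>" using Ints_nonzero_abs_less1[of ?t] by auto
qed

lemma coroot_coweight:
  assumes "\<beta> \<in> \<Phi>" shows "(2 / (\<beta> \<bullet> \<beta>)) *\<^sub>R \<beta> \<in> coweights"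
proof -
  have "2 * (\<beta> \<bullet> \<gamma>) / (\<beta> \<bullet> \<beta>) \<in> \<int>" if "\<gamma> \<in> \<Phi>" for \<gamma>
    using root_system assms that by (auto simp: root_system_def)
  then show ?thesis by (auto simp: coweight_lattice_def inner_commute)
qed

text \<open>The orbit of \<open>x\<close> under the Weyl group and translations by the scaled lattice is discrete, so it has a
  point nearest to the centre \<open>p\<close> of the dilated alcove. By \<open>reflected_distance\<close> no wall of this
  alcove separates that point from \<open>p\<close>, and by regularity the point lies on no wall.\<close>

lemma level_representative:
  assumes x: "x \<in> coweights" "regular x"
  shows "\<exists>w\<in>weyl. \<exists>y\<in>level. w y - x \<in> lattice"
proof -
  \<comment> \<open>The only coweight in the alcove dilated by 18 is \<open>rho\<close>; scaled to level \<open>q\<close> it is interior to the dilated alcove.\<close>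
  define p where "p = (real_of_int q / 18) *\<^sub>R rho"
  define Orb where "Orb = {y. \<exists>w\<in>weyl. w x - y \<in> lattice}"
  have lat_sub: "z \<in> coweights" if "z \<in> lattice" for z
    using coweight_scale[of "(1 / real_of_int q) *\<^sub>R z" q] that q by (simp add: lattice_iff)
  have orb_Z: "y \<in> coweights" if yO: "y \<in> Orb" for y
  proof -
    obtain w where w: "w \<in> weyl" "w x - y \<in> lattice" using yO Orb_def by blast
    have "w x \<in> coweights"
      by (rule coweight_isometry[OF weyl_root_isometry[OF w(1)] x(1)])
    from coweight_diff[OF this lat_sub[OF w(2)]] show ?thesis by simp
  qed
  have "x \<in> Orb"
    unfolding Orb_def using reflection_group.one lattice_zero by (auto intro!: bexI[of _ id])
  define F where "F = {y \<in> Orb. norm (y - p) \<le> norm (x - p)}"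
  have "F \<subseteq> {y \<in> coweights. norm (y - p) \<le> norm (x - p)}"
    using orb_Z by (auto simp: F_def)
  then have "finite F" using finite_coweights_near by (rule finite_subset)
  have "x \<in> F" using \<open>x \<in> Orb\<close> by (simp add: F_def)
  define y where "y = arg_min_on (\<lambda>z. norm (z - p)) F"
  have yF: "y \<in> F" "\<And>z. z \<in> F \<Longrightarrow> norm (y - p) \<le> norm (z - p)"
    unfolding y_def using \<open>finite F\<close> \<open>x \<in> F\<close>
    by (auto intro!: arg_min_if_finite(1) arg_min_least)
  then have y: "y \<in> Orb" and ymin: "\<And>z. z \<in> Orb \<Longrightarrow> norm (y - p) \<le> norm (z - p)"
    unfolding F_def by (auto, fastforce)
  obtain w where w: "w \<in> weyl" "w x - y \<in> lattice" using y Orb_def by blast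
  have yreg: "regular y"
  proof (rule regular_cong)
    show "regular (w x)" by (rule regular_isometry[OF weyl_root_isometry[OF w(1)] x(2)])
    show "y - w x \<in> lattice" using lattice_diff[OF lattice_zero w(2)] by simp
  qed
  have refl_orb: "y - (2 * (\<beta> \<bullet> y - of_int (n * q)) / (\<beta> \<bullet> \<beta>)) *\<^sub>R \<beta> \<in> Orb"
    if b: "\<beta> \<in> \<Phi>" for \<beta> n
  proof -
    let ?s = "reflection \<beta>"
    have s: "?s \<in> weyl" by (rule reflection_in_group[OF b])
    have "?s (w x - y) \<in> lattice" by (rule lattice_isometry[OF weyl_root_isometry[OF s] w(2)])
    then have 1: "?s (w x) - ?s y \<in> lattice"
      by (simp only: linear_diff[OF linear_reflection])
    have "real_of_int (n * q) *\<^sub>R ((2 / (\<beta> \<bullet> \<beta>)) *\<^sub>R \<beta>) \<in> lattice"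
      using coweight_scale[OF coroot_coweight[OF b], of n] q by (simp add: lattice_iff)
    from lattice_diff[OF 1 this] have "?s (w x) -
        (y - (2 * (\<beta> \<bullet> y - of_int (n * q)) / (\<beta> \<bullet> \<beta>)) *\<^sub>R \<beta>) \<in> lattice"
      by (simp add: reflection_def algebra_simps diff_divide_distrib)
    then show ?thesis
      unfolding Orb_def using reflection_group_comp[OF s w(1)] by (auto intro!: bexI[of _ "?s \<circ> w"])
  qed
  \<comment> \<open>By minimality \<open>y\<close> and \<open>p\<close> are on the same side of each affine root hyperplane.\<close>
  have side: "0 \<le> (\<beta> \<bullet> y - of_int (n * q)) * (\<beta> \<bullet> p - of_int (n * q))" if b: "\<beta> \<in> \<Phi>" for \<beta> n
  proof -
    have b0: "\<beta> \<noteq> 0" using root_nonzero[OF b] .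
    have "(norm (y - p))\<^sup>2 \<le> (norm (y - (2 * (\<beta> \<bullet> y - of_int (n * q)) / (\<beta> \<bullet> \<beta>)) *\<^sub>R \<beta> - p))\<^sup>2"
      by (rule power_mono[OF ymin[OF refl_orb[OF b]]]) simp
    then have "0 \<le> 4 * (\<beta> \<bullet> y - of_int (n * q)) * (\<beta> \<bullet> p - of_int (n * q)) / (\<beta> \<bullet> \<beta>)"
      unfolding reflected_distance[OF b0] by simp
    then have "0 \<le> 4 / (\<beta> \<bullet> \<beta>) * ((\<beta> \<bullet> y - of_int (n * q)) * (\<beta> \<bullet> p - of_int (n * q)))"
      by (simp only: times_divide_eq_left mult.assoc)
    moreover have "0 < 4 / (\<beta> \<bullet> \<beta>)" using b0 by simp
    ultimately show ?thesis by (simp only: zero_le_mult_iff) linarith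
  qed
  have "y \<in> level"
  proof -
    have "0 < \<alpha> i \<bullet> y" if i: "i \<in> {1..7}" for i
    proof -
      have "0 \<le> (\<alpha> i \<bullet> y) * (q / 18)"
        using side[OF simple_root[OF i], of 0] simple_rho[OF i] by (simp add: p_def)
      then have "0 \<le> \<alpha> i \<bullet> y" using q by (simp add: zero_le_mult_iff)
      moreover have "\<alpha> i \<bullet> y \<noteq> 0"
        using yreg simple_root[OF i] by (auto simp: regular_def)
      ultimately show ?thesis by simp
    qed
    moreover have "- q < affine_root 0 \<bullet> y"
    proof -
      have r: "affine_root 0 \<in> \<Phi>" by (rule affine_root_in) simp
      have "affine_root 0 \<bullet> rho = - 17"
        unfolding affine_root_0_inner by (simp add: simple_rho)
      then have E: "affine_root 0 \<bullet> p - of_int (- 1 * q) = q / 18" by (simp add: p_def)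
      have "0 \<le> (affine_root 0 \<bullet> y - of_int (- 1 * q)) * (q / 18)"
        using side[OF r, of "- 1"] unfolding E .
      then have "0 \<le> affine_root 0 \<bullet> y + q" using q by (simp add: zero_le_mult_iff)
      moreover have "affine_root 0 \<bullet> y \<noteq> - q"
      proof
        assume "affine_root 0 \<bullet> y = - q"
        then have "affine_root 0 \<bullet> y / q = of_int (- 1)" using q by simp
        then show False using yreg r by (metis Ints_of_int regular_def)
      qed
      ultimately show ?thesis by simp
    qed
    ultimately show ?thesis
      using q orb_Z[OF y] by (auto simp: level_def alcove_iff field_simps)
  qed
  moreover have "inv w y - x \<in> lattice"
  proof -
    note iso = weyl_root_isometry[OF w(1)]
    have "inv w (w x - y) \<in> lattice"
      by (rule lattice_isometry[OF root_isometry_inv[OF iso] w(2)])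
    then have "x - inv w y \<in> lattice"
      using linear_diff[OF root_isometryD(1)[OF root_isometry_inv[OF iso]]]
        root_isometry_inv_cancel(2)[OF iso] by simp
    from lattice_diff[OF lattice_zero this] show ?thesis by simp
  qed
  ultimately show ?thesis using weyl_inv[OF w(1)] by blast
qed

lemma level_cong_eq:
  assumes "x \<in> level" "y \<in> level" "x - y \<in> lattice" shows "x = y"
proof (rule coords_eqI)
  fix i assume i: "i \<in> {1..7::nat}"
  let ?x = "(1 / real_of_int q) *\<^sub>R x" and ?y = "(1 / real_of_int q) *\<^sub>R y"
  have "\<bar>\<alpha> i \<bullet> ?x - \<alpha> i \<bullet> ?y\<bar> < 1"
    using root_in_unit_interval[OF simple_root[OF i], of ?x]
      root_in_unit_interval[OF simple_root[OF i], of ?y] assms(1,2) neg_indicator_affine(2)[OF i]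
    by (auto simp: level_def)
  moreover have "\<alpha> i \<bullet> ?x - \<alpha> i \<bullet> ?y \<in> \<int>"
    using assms(3) coweight_root[OF _ simple_root[OF i]]
    unfolding lattice_iff inner_diff_right[symmetric] scaleR_diff_right by blast
  ultimately have "\<alpha> i \<bullet> ?x - \<alpha> i \<bullet> ?y = 0" using Ints_nonzero_abs_less1 by blast
  then show "\<alpha> i \<bullet> x = \<alpha> i \<bullet> y" using q by simp
qed

text \<open>The affine lift of the flip that preserves the dilated alcove.\<close>

definition level_flip :: "'a \<Rightarrow> 'a" where
  "level_flip y = flip y + real_of_int q *\<^sub>R coweight7"

lemma level_flip_cong: "flip y - level_flip y \<in> lattice"
  using coweight_diff[OF coweight_zero coweight7_in] q by (simp add: level_flip_def lattice_iff)

lemma level_flip_in: assumes "y \<in> level" shows "level_flip y \<in> level"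
proof -
  have "flip ((1 / real_of_int q) *\<^sub>R y) + coweight7 \<in> alcove"
    using assms flip_shift_alcove by (simp add: level_def)
  moreover have "flip ((1 / real_of_int q) *\<^sub>R y) + coweight7 = (1 / real_of_int q) *\<^sub>R level_flip y"
    using q linear_cmul[OF root_isometryD(1)[OF flip_isometry]]
    by (simp add: level_flip_def scaleR_add_right)
  moreover have "level_flip y \<in> coweights"
    unfolding level_flip_def
    using assms coweight_isometry[OF flip_isometry] coweight_scale[OF coweight7_in] coweight_add
    by (simp add: level_def)
  ultimately show ?thesis by (simp add: level_def)
qed

lemma weyl_level_cases:
  assumes "w \<in> weyl" "x \<in> level" "y \<in> level" "w x - y \<in> lattice"
  shows "w = id \<and> y = x \<or> w = flip \<and> y = level_flip x"
proof -
  have "w ((1 / real_of_int q) *\<^sub>R x) - (1 / real_of_int q) *\<^sub>R y \<in> coweights"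
    using assms(4) linear_cmul[OF root_isometryD(1)[OF weyl_root_isometry[OF assms(1)]]]
    by (simp add: lattice_iff scaleR_diff_right)
  moreover have "(1 / real_of_int q) *\<^sub>R x \<in> alcove" "(1 / real_of_int q) *\<^sub>R y \<in> alcove"
    using assms(2,3) by (simp_all add: level_def)
  ultimately have "w = id \<or> w = flip" using weyl_alcove_cases[OF assms(1)] by blast
  then show ?thesis
  proof
    assume "w = id"
    then show ?thesis using level_cong_eq[OF assms(2,3)] assms(4) by simp
  next
    assume w: "w = flip"
    then have "level_flip x - y \<in> lattice"
      using lattice_diff[OF assms(4) level_flip_cong[of x]] by simp
    then show ?thesis using w level_cong_eq[OF level_flip_in[OF assms(2)] assms(3)] by simp
  qed
qed

abbreviation chart :: "('a \<Rightarrow> 'a) \<times> 'a \<Rightarrow> 'a set" where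
  "chart \<equiv> \<lambda>(w, y). coset lattice (w y)"

text \<open>Two pairs with the same class differ by a Weyl group element that maps one alcove point to the
  other modulo the lattice; by \<open>weyl_level_cases\<close> it is the identity or the flip.\<close>

lemma chart_eq_iff:
  assumes "v \<in> weyl" "x \<in> level" "w \<in> weyl" "y \<in> level"
  shows "chart (v, x) = chart (w, y) \<longleftrightarrow> (v, x) \<in> {(w, y), (w \<circ> flip, level_flip y)}"
proof -
  note iv = weyl_root_isometry[OF assms(1)] and iw = weyl_root_isometry[OF assms(3)]
  have "chart (v, x) = chart (w, y) \<longleftrightarrow> w y - v x \<in> lattice"
    using lattice_coset_eq_iff[of "w y" "v x"] by auto
  also have "\<dots> \<longleftrightarrow> (inv v \<circ> w) y - x \<in> lattice"
  proof
    assume "w y - v x \<in> lattice"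
    then have "inv v (w y - v x) \<in> lattice" by (rule lattice_isometry[OF root_isometry_inv[OF iv]])
    then show "(inv v \<circ> w) y - x \<in> lattice"
      by (simp add: linear_diff[OF root_isometryD(1)[OF root_isometry_inv[OF iv]]]
          root_isometry_inv_cancel(2)[OF iv])
  next
    assume "(inv v \<circ> w) y - x \<in> lattice"
    then have "v ((inv v \<circ> w) y - x) \<in> lattice" by (rule lattice_isometry[OF iv])
    then show "w y - v x \<in> lattice"
      by (simp add: linear_diff[OF root_isometryD(1)[OF iv]] root_isometry_inv_cancel(1)[OF iv])
  qed
  also have "\<dots> \<longleftrightarrow> inv v \<circ> w = id \<and> x = y \<or> inv v \<circ> w = flip \<and> x = level_flip y"
  proof
    assume "(inv v \<circ> w) y - x \<in> lattice"
    then show "inv v \<circ> w = id \<and> x = y \<or> inv v \<circ> w = flip \<and> x = level_flip y"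
      by (rule weyl_level_cases[OF reflection_group_comp[OF weyl_inv[OF assms(1)] assms(3)] assms(4,2)])
  next
    assume "inv v \<circ> w = id \<and> x = y \<or> inv v \<circ> w = flip \<and> x = level_flip y"
    then show "(inv v \<circ> w) y - x \<in> lattice"
    proof
      assume h: "inv v \<circ> w = id \<and> x = y"
      then show ?thesis using lattice_zero by (simp only: conjunct1[OF h] conjunct2[OF h] id_apply diff_self)
    next
      assume h: "inv v \<circ> w = flip \<and> x = level_flip y"
      then show ?thesis using level_flip_cong by (simp only: conjunct1[OF h] conjunct2[OF h])
    qed
  qed
  also have "\<dots> \<longleftrightarrow> v = w \<and> x = y \<or> v = w \<circ> flip \<and> x = level_flip y"
  proof -
    have vv: "v \<circ> inv v = id" "inv v \<circ> v = id"
      using root_isometry_inv_cancel[OF iv] by (auto simp: fun_eq_iff)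
    have *: "inv v \<circ> w = u \<longleftrightarrow> w = v \<circ> u" for u
    proof
      assume "inv v \<circ> w = u"
      then have "v \<circ> u = (v \<circ> inv v) \<circ> w" by (simp only: comp_assoc)
      then show "w = v \<circ> u" unfolding vv by simp
    next
      assume "w = v \<circ> u"
      then have "inv v \<circ> w = (inv v \<circ> v) \<circ> u" by (simp only: comp_assoc)
      then show "inv v \<circ> w = u" unfolding vv by simp
    qed
    have "w = v \<circ> flip \<longleftrightarrow> v = w \<circ> flip"
    proof
      assume "w = v \<circ> flip"
      then have "w \<circ> flip = v \<circ> (flip \<circ> flip)" by (simp only: comp_assoc)
      then show "v = w \<circ> flip" unfolding flip_flip by simp
    next
      assume "v = w \<circ> flip"
      then have "v \<circ> flip = w \<circ> (flip \<circ> flip)" by (simp only: comp_assoc)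
      then show "w = v \<circ> flip" unfolding flip_flip by simp
    qed
    then show ?thesis unfolding * by auto
  qed
  finally show ?thesis by auto
qed

lemma M_eq_chart: "M \<Phi> q = chart ` (weyl \<times> level)"
proof
  show "chart ` (weyl \<times> level) \<subseteq> M \<Phi> q"
  proof (rule image_subsetI)
    fix t assume "t \<in> weyl \<times> level"
    then obtain w y where t: "t = (w, y)" "w \<in> weyl" "y \<in> level" by blast
    then have "w y \<in> coweights" "regular (w y)"
      using coweight_isometry[OF weyl_root_isometry] regular_isometry[OF weyl_root_isometry]
        level_regular by (auto simp: level_def)
    then show "chart t \<in> M \<Phi> q" unfolding M_eq t by auto
  qed
  show "M \<Phi> q \<subseteq> chart ` (weyl \<times> level)"
  proof
    fix t assume "t \<in> M \<Phi> q"
    then obtain x where x: "x \<in> coweights" "regular x" "t = coset lattice x"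
      unfolding M_eq by blast
    then obtain w y where "w \<in> weyl" "y \<in> level" "w y - x \<in> lattice"
      using level_representative by blast
    then have "t = chart (w, y)" "(w, y) \<in> weyl \<times> level"
      using x(3) lattice_coset_eq_iff[of "w y" x] by auto
    then show "t \<in> chart ` (weyl \<times> level)" by (rule image_eqI)
  qed
qed

lemma level_iff:
  "y \<in> level \<longleftrightarrow> y \<in> coweights \<and> (\<forall>i\<in>{1..7}. 0 < \<alpha> i \<bullet> y) \<and> - q < affine_root 0 \<bullet> y"
  using q by (auto simp: level_def alcove_iff field_simps)

lemma coweight_floor:
  assumes "y \<in> coweights" "i \<in> {1..7}" shows "real_of_int \<lfloor>\<alpha> i \<bullet> y\<rfloor> = \<alpha> i \<bullet> y"
  using assms coweight_iff by (metis floor_of_int Ints_cases)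

definition point :: "(nat \<Rightarrow> int) \<Rightarrow> 'a" where
  "point m = (SOME x. \<forall>i\<in>{1..7}. \<alpha> i \<bullet> x = real_of_int (m i))"

lemma point_coord: "i \<in> {1..7} \<Longrightarrow> \<alpha> i \<bullet> point m = real_of_int (m i)"
  using someI_ex[OF ex_coords[of "\<lambda>i. real_of_int (m i)"]] unfolding point_def by blast

lemma point_coweight: "point m \<in> coweights"
  by (simp add: coweight_iff point_coord)

lemma coweight_point:
  assumes "y \<in> coweights" shows "y = point (\<lambda>i. \<lfloor>\<alpha> i \<bullet> y\<rfloor>)"
  by (rule coords_eqI) (simp add: point_coord coweight_floor[OF assms])

lemma point_level_iff:
  "point m \<in> level \<longleftrightarrow> (\<forall>i\<in>{1..7}. 0 < m i) \<and>
     2 * m 1 + 2 * m 2 + 3 * m 3 + 4 * m 4 + 3 * m 5 + 2 * m 6 + m 7 < q"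
proof -
  have "affine_root 0 \<bullet> point m =
      - real_of_int (2 * m 1 + 2 * m 2 + 3 * m 3 + 4 * m 4 + 3 * m 5 + 2 * m 6 + m 7)"
    unfolding affine_root_0_inner by (simp add: point_coord)
  then show ?thesis
    unfolding level_iff by (simp add: point_coweight point_coord del: of_int_add of_int_mult)
qed

lemma point_eq_iff: "point m = point m' \<longleftrightarrow> (\<forall>i\<in>{1..7}. m i = m' i)"
proof
  assume "point m = point m'"
  then have "real_of_int (m i) = real_of_int (m' i)" if "i \<in> {1..7}" for i
    using point_coord[OF that, of m] point_coord[OF that, of m'] by simp
  then show "\<forall>i\<in>{1..7}. m i = m' i" by simp
qed (auto intro!: coords_eqI simp: point_coord)

definition solution_point :: "nat list \<Rightarrow> 'a" where
  "solution_point ms =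
     point (\<lambda>i. int ([ms ! 3, ms ! 4, ms ! 0, ms ! 2, ms ! 1, ms ! 5, ms ! 6] ! (i - 1)))"

text \<open>The entries of a solution are the values of the affine simple roots on the point, where node 0
  takes the value \<open>q\<close> minus that of the highest root.\<close>

lemma level_bij:
  "bij_betw solution_point (positive_solutions [3, 3, 4, 2, 2, 2, 1, 1] (nat q)) level"
  unfolding bij_betw_def
proof
  let ?P = "positive_solutions [3, 3, 4, 2, 2, 2, 1, 1] (nat q)"
  have P: "ms \<in> ?P \<longleftrightarrow> (\<exists>m1 m2 m3 m4 m5 m6 m7 m0. ms = [m3, m5, m4, m1, m2, m6, m7, m0] \<and>
      1 \<le> m0 \<and> 1 \<le> m1 \<and> 1 \<le> m2 \<and> 1 \<le> m3 \<and> 1 \<le> m4 \<and> 1 \<le> m5 \<and> 1 \<le> m6 \<and> 1 \<le> m7 \<and>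
      3 * m3 + 3 * m5 + 4 * m4 + 2 * m1 + 2 * m2 + 2 * m6 + m7 + m0 = nat q)" for ms
    by (auto simp: positive_solutions_def length_Suc_conv)
  show "inj_on solution_point ?P"
  proof (rule inj_onI)
    fix ms ms' assume "ms \<in> ?P" "ms' \<in> ?P" "solution_point ms = solution_point ms'"
    then show "ms = ms'"
      unfolding P solution_point_def point_eq_iff ball_1_7 by (auto simp: numeral_eq_Suc One_nat_def)
  qed
  show "solution_point ` ?P = level"
  proof
    show "solution_point ` ?P \<subseteq> level"
    proof (rule image_subsetI)
      fix ms assume "ms \<in> ?P"
      then obtain m1 m2 m3 m4 m5 m6 m7 m0 where ms: "ms = [m3, m5, m4, m1, m2, m6, m7, m0]"
        "1 \<le> m0" "1 \<le> m1" "1 \<le> m2" "1 \<le> m3" "1 \<le> m4" "1 \<le> m5" "1 \<le> m6" "1 \<le> m7"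
        "3 * m3 + 3 * m5 + 4 * m4 + 2 * m1 + 2 * m2 + 2 * m6 + m7 + m0 = nat q"
        unfolding P by blast
      then have "3 * int m3 + 3 * int m5 + 4 * int m4 + 2 * int m1 + 2 * int m2 + 2 * int m6 +
          int m7 + int m0 = q" using q by linarith
      then show "solution_point ms \<in> level"
        unfolding solution_point_def point_level_iff ball_1_7 using ms by simp
    qed
    show "level \<subseteq> solution_point ` ?P"
    proof
      fix y assume y: "y \<in> level"
      define m where "m = (\<lambda>i. \<lfloor>\<alpha> i \<bullet> y\<rfloor>)"
      have ym: "y = point m" unfolding m_def using y by (intro coweight_point) (simp add: level_def)
      define n where "n = q - (2 * m 1 + 2 * m 2 + 3 * m 3 + 4 * m 4 + 3 * m 5 + 2 * m 6 + m 7)"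
      have pos: "0 < m 1" "0 < m 2" "0 < m 3" "0 < m 4" "0 < m 5" "0 < m 6" "0 < m 7" "0 < n"
        using y unfolding ym point_level_iff ball_1_7 n_def by auto
      let ?ms = "map nat [m 3, m 5, m 4, m 1, m 2, m 6, m 7, n]"
      have "?ms \<in> ?P"
        unfolding P
      proof (intro exI conjI)
        show "?ms = [nat (m 3), nat (m 5), nat (m 4), nat (m 1), nat (m 2), nat (m 6), nat (m 7), nat n]"
          by simp
        have "int (3 * nat (m 3) + 3 * nat (m 5) + 4 * nat (m 4) + 2 * nat (m 1) + 2 * nat (m 2) +
            2 * nat (m 6) + nat (m 7) + nat n) = int (nat q)"
          using pos q by (simp add: n_def)
        then show "3 * nat (m 3) + 3 * nat (m 5) + 4 * nat (m 4) + 2 * nat (m 1) + 2 * nat (m 2) +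
            2 * nat (m 6) + nat (m 7) + nat n = nat q"
          by (simp only: of_nat_eq_iff)
      qed (use pos in simp_all)
      moreover have "solution_point ?ms = y"
        unfolding ym solution_point_def point_eq_iff ball_1_7 using pos by simp
      ultimately show "y \<in> solution_point ` ?P" by blast
    qed
  qed
qed

lemma finite_level: "finite level"
  using bij_betw_finite[OF level_bij] finite_positive_solutions[of "[3, 3, 4, 2, 2, 2, 1, 1]"] by simp

lemma card_level: "card level = num_solutions [3, 3, 4, 2, 2, 2, 1, 1] (nat q)"
  using bij_betw_same_card[OF level_bij] by simp

lemma chart_fibre:
  assumes "a \<in> weyl \<times> level"
  shows "{b \<in> weyl \<times> level. chart b = chart a} =
      {a, (fst a \<circ> flip, level_flip (snd a))} \<and> (fst a \<circ> flip, level_flip (snd a)) \<noteq> a"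
proof -
  obtain w y where a: "a = (w, y)" "w \<in> weyl" "y \<in> level" using assms by blast
  have "w \<circ> flip \<noteq> w"
  proof
    assume "w \<circ> flip = w"
    then have "w (flip x) = w x" for x by (metis comp_apply)
    then have "flip x = x" for x using injD[OF root_isometry_inj[OF weyl_root_isometry[OF a(2)]]] by blast
    then show False using flip_neq_id by auto
  qed
  moreover have "b \<in> weyl \<times> level \<and> chart b = chart a \<longleftrightarrow>
      b \<in> {(w, y), (w \<circ> flip, level_flip y)}" for b
  proof (cases b)
    case (Pair v x)
    have "(w \<circ> flip, level_flip y) \<in> weyl \<times> level"
      using reflection_group_comp[OF a(2) flip_weyl] level_flip_in[OF a(3)] by blast
    then have "b \<in> {(w, y), (w \<circ> flip, level_flip y)} \<Longrightarrow> v \<in> weyl \<and> x \<in> level"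
      using a unfolding Pair by auto
    then show ?thesis
      unfolding Pair a(1) using chart_eq_iff[OF _ _ a(2,3), of v x] by blast
  qed
  ultimately show ?thesis unfolding a(1) by auto
qed

text \<open>The fibres of the chart are the orbits of a fixed-point-free involution.\<close>

lemma card_M: "card (weyl) * card level = 2 * card (M \<Phi> q)"
  using card_eq_twice_card_image[of "weyl \<times> level" chart, OF _ chart_fibre]
  by (simp add: M_eq_chart finite_weyl finite_level card_cartesian_product)

definition centralizer :: "('a \<Rightarrow> 'a) set" where
  "centralizer = {w \<in> weyl. flip \<circ> w = w \<circ> flip}"

text \<open>Fixing the class says that \<open>(flip \<circ> w, y)\<close> and \<open>(w, y)\<close> have the same class. The first components
  differ, so the two pairs are exchanged by the involution in \<open>chart_eq_iff\<close>.\<close>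

lemma chart_fixed_iff:
  assumes "w \<in> weyl" "y \<in> level"
  shows "flip ` chart (w, y) = chart (w, y) \<longleftrightarrow> w \<in> centralizer \<and> level_flip y = y"
proof -
  have "flip ` chart (w, y) = chart (flip \<circ> w, y)"
    using image_lattice_coset[OF flip_isometry] by simp
  then have "flip ` chart (w, y) = chart (w, y) \<longleftrightarrow>
      (flip \<circ> w, y) \<in> {(w, y), (w \<circ> flip, level_flip y)}"
    using chart_eq_iff[OF reflection_group_comp[OF flip_weyl assms(1)] assms(2,1,2)] by simp
  moreover have "flip \<circ> w \<noteq> w"
  proof
    assume "flip \<circ> w = w"
    then have "flip (w x) = w x" for x by (metis comp_apply)
    then have "flip x = x" for x
      using root_isometry_inv_cancel(1)[OF weyl_root_isometry[OF assms(1)], of x] by metis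
    then show False using flip_neq_id by auto
  qed
  ultimately show ?thesis using assms(1) by (auto simp: centralizer_def)
qed

text \<open>The chart remains two-to-one on the preimage of the fixed classes.\<close>

lemma card_fixed:
  "card centralizer * card {y \<in> level. level_flip y = y} =
     2 * card {t \<in> M \<Phi> q. flip ` t = t}"
proof -
  let ?A = "centralizer \<times> {y \<in> level. level_flip y = y}"
  have sub: "centralizer \<subseteq> weyl" by (auto simp: centralizer_def)
  have A: "?A = {a \<in> weyl \<times> level. flip ` chart a = chart a}"
  proof (rule set_eqI)
    fix a :: "('a \<Rightarrow> 'a) \<times> 'a"
    obtain w y where a: "a = (w, y)" by (rule prod.exhaust)
    show "a \<in> ?A \<longleftrightarrow> a \<in> {a \<in> weyl \<times> level. flip ` chart a = chart a}"
      unfolding a mem_Collect_eq mem_Times_iff fst_conv snd_conv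
      using chart_fixed_iff[of w y] sub by blast
  qed
  have "finite ?A"
    using finite_subset[OF sub finite_weyl] finite_level by simp
  moreover have "{b \<in> ?A. chart b = chart a} = {a, (fst a \<circ> flip, level_flip (snd a))} \<and>
      (fst a \<circ> flip, level_flip (snd a)) \<noteq> a" if "a \<in> ?A" for a
  proof -
    have a: "a \<in> weyl \<times> level" "flip ` chart a = chart a" using that A by auto
    then have "{b \<in> ?A. chart b = chart a} = {b \<in> weyl \<times> level. chart b = chart a}"
      unfolding A by auto
    then show ?thesis using chart_fibre[OF a(1)] by simp
  qed
  ultimately have "card ?A = 2 * card (chart ` ?A)" by (rule card_eq_twice_card_image)
  moreover have "chart ` ?A = {t \<in> M \<Phi> q. flip ` t = t}"
    unfolding A M_eq_chart by blast
  ultimately show ?thesis by (simp only: card_cartesian_product)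
qed

lemma simple_flip: "i \<in> {1..7} \<Longrightarrow> \<alpha> i \<bullet> flip x = affine_root (affine_flip i) \<bullet> x"
  using flip_affine[of i] by (simp add: inner_root_isometry[OF flip_isometry] inv_flip affine_root_simple)

text \<open>The lift permutes the values of the affine simple roots, so a fixed point has equal values at
  the nodes 1, 6 and 3, 5 and 0, 7.\<close>

lemma point_flip_fixed_iff:
  "level_flip (point m) = point m \<longleftrightarrow> m 1 = m 6 \<and> m 3 = m 5 \<and>
     q = 2 * m 1 + 2 * m 2 + 3 * m 3 + 4 * m 4 + 3 * m 5 + 2 * m 6 + 2 * m 7"
proof -
  have c: "\<alpha> i \<bullet> level_flip (point m) =
      affine_root (affine_flip i) \<bullet> point m + (if i = 7 then q else 0)" if "i \<in> {1..7}" for i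
    using that by (simp add: level_flip_def inner_add_right simple_flip simple_coweight7)
  have "level_flip (point m) = point m \<longleftrightarrow>
      (\<forall>i\<in>{1..7}. \<alpha> i \<bullet> level_flip (point m) = \<alpha> i \<bullet> point m)"
    using coords_eqI by auto
  also have "\<dots> \<longleftrightarrow> (\<forall>i\<in>{1..7}. affine_root (affine_flip i) \<bullet> point m + (if i = 7 then q else 0) = m i)"
    using c point_coord by simp
  also have "\<dots> \<longleftrightarrow> m 1 = m 6 \<and> m 3 = m 5 \<and>
      real_of_int q = real_of_int (2 * m 1 + 2 * m 2 + 3 * m 3 + 4 * m 4 + 3 * m 5 + 2 * m 6 + 2 * m 7)"
    unfolding ball_1_7
    by (auto simp: affine_flip_def affine_root_simple affine_root_0_inner point_coord)
  finally show ?thesis by (simp only: of_int_eq_iff)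
qed

text \<open>The marks 1, 2, 3 of the swapped nodes count twice and those of the fixed nodes 2 and 4 are even,
  so the level of a fixed point is even.\<close>

lemma no_flip_fixed_level:
  assumes "odd q" shows "{y \<in> level. level_flip y = y} = {}"
proof -
  have False if "y \<in> level" "level_flip y = y" for y
  proof -
    define m where "m = (\<lambda>i. \<lfloor>\<alpha> i \<bullet> y\<rfloor>)"
    have "y = point m" unfolding m_def using that by (intro coweight_point) (simp add: level_def)
    then have "q = 2 * (2 * m 1 + m 2 + 3 * m 3 + 2 * m 4 + m 7)"
      using that(2) unfolding point_flip_fixed_iff[of m, folded \<open>y = point m\<close>] by simp
    then show False using assms by simp
  qed
  then show ?thesis by blast
qed

definition fixed_solution_point :: "nat list \<Rightarrow> 'a" where
  "fixed_solution_point ms =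
     point (\<lambda>i. int ([ms ! 1, ms ! 3, ms ! 0, ms ! 2, ms ! 0, ms ! 1, ms ! 4] ! (i - 1)))"

text \<open>Identifying swapped nodes halves the equation of \<open>level_bij\<close>.\<close>

lemma fixed_level_bij:
  assumes h: "q = 2 * h"
  shows "bij_betw fixed_solution_point (positive_solutions [3, 2, 2, 1, 1] (nat h))
    {y \<in> level. level_flip y = y}"
  unfolding bij_betw_def
proof
  let ?P = "positive_solutions [3, 2, 2, 1, 1] (nat h)"
  have P: "ms \<in> ?P \<longleftrightarrow> (\<exists>m1 m2 m3 m4 m7. ms = [m3, m1, m4, m2, m7] \<and>
      1 \<le> m1 \<and> 1 \<le> m2 \<and> 1 \<le> m3 \<and> 1 \<le> m4 \<and> 1 \<le> m7 \<and>
      3 * m3 + 2 * m1 + 2 * m4 + m2 + m7 = nat h)" for ms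
    by (auto simp: positive_solutions_def length_Suc_conv)
  show "inj_on fixed_solution_point ?P"
  proof (rule inj_onI)
    fix ms ms' assume "ms \<in> ?P" "ms' \<in> ?P" "fixed_solution_point ms = fixed_solution_point ms'"
    then show "ms = ms'"
      unfolding P fixed_solution_point_def point_eq_iff ball_1_7
      by (auto simp: numeral_eq_Suc One_nat_def)
  qed
  show "fixed_solution_point ` ?P = {y \<in> level. level_flip y = y}"
  proof
    show "fixed_solution_point ` ?P \<subseteq> {y \<in> level. level_flip y = y}"
    proof (rule image_subsetI)
      fix ms assume "ms \<in> ?P"
      then obtain m1 m2 m3 m4 m7 where ms: "ms = [m3, m1, m4, m2, m7]"
        "1 \<le> m1" "1 \<le> m2" "1 \<le> m3" "1 \<le> m4" "1 \<le> m7"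
        "3 * m3 + 2 * m1 + 2 * m4 + m2 + m7 = nat h"
        unfolding P by blast
      then have "3 * int m3 + 2 * int m1 + 2 * int m4 + int m2 + int m7 = h" using q h by linarith
      then show "fixed_solution_point ms \<in> {y \<in> level. level_flip y = y}"
        unfolding fixed_solution_point_def mem_Collect_eq point_level_iff point_flip_fixed_iff ball_1_7
        using ms h by simp
    qed
    show "{y \<in> level. level_flip y = y} \<subseteq> fixed_solution_point ` ?P"
    proof
      fix y assume y: "y \<in> {y \<in> level. level_flip y = y}"
      define m where "m = (\<lambda>i. \<lfloor>\<alpha> i \<bullet> y\<rfloor>)"
      have ym: "y = point m" unfolding m_def using y by (intro coweight_point) (simp add: level_def)
      have pos: "0 < m 1" "0 < m 2" "0 < m 3" "0 < m 4" "0 < m 7"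
        and eq: "m 6 = m 1" "m 5 = m 3" "h = 2 * m 1 + m 2 + 3 * m 3 + 2 * m 4 + m 7"
        using y h unfolding ym mem_Collect_eq point_level_iff point_flip_fixed_iff ball_1_7 by auto
      let ?ms = "map nat [m 3, m 1, m 4, m 2, m 7]"
      have "?ms \<in> ?P"
        unfolding P
      proof (intro exI conjI)
        show "?ms = [nat (m 3), nat (m 1), nat (m 4), nat (m 2), nat (m 7)]" by simp
        have "int (3 * nat (m 3) + 2 * nat (m 1) + 2 * nat (m 4) + nat (m 2) + nat (m 7)) = int (nat h)"
          using pos by (simp add: eq(3))
        then show "3 * nat (m 3) + 2 * nat (m 1) + 2 * nat (m 4) + nat (m 2) + nat (m 7) = nat h"
          by (simp only: of_nat_eq_iff)
      qed (use pos in simp_all)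
      moreover have "fixed_solution_point ?ms = y"
        unfolding ym fixed_solution_point_def point_eq_iff ball_1_7 using pos eq(1,2) by simp
      ultimately show "y \<in> fixed_solution_point ` ?P" by blast
    qed
  qed
qed

end
end

section \<open>Regular and flip-fixed classes in coordinates\<close>

text \<open>The entries other than \<open>m j\<close> determine \<open>m j\<close> modulo \<open>q\<close>.\<close>

lemma card_linear_congruence_le:
  fixes c :: "'i \<Rightarrow> int"
  assumes "finite I" "j \<in> I" "coprime q (c j)" "0 < q"
  shows "card {m \<in> PiE I (\<lambda>_. {0..<q}). q dvd b + (\<Sum>i\<in>I. c i * m i)} \<le> nat q ^ (card I - 1)"
proof -
  let ?A = "{m \<in> PiE I (\<lambda>_. {0..<q}). q dvd b + (\<Sum>i\<in>I. c i * m i)}"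
  let ?B = "PiE (I - {j}) (\<lambda>_. {0..<q})"
  have "card ?A \<le> card ?B"
  proof (rule card_inj_on_le[where f = "\<lambda>m. restrict m (I - {j})"])
    show "inj_on (\<lambda>m. restrict m (I - {j})) ?A"
    proof (rule inj_onI)
      fix m m' assume m: "m \<in> ?A" and m': "m' \<in> ?A"
        and eq: "restrict m (I - {j}) = restrict m' (I - {j})"
      have e: "m i = m' i" if "i \<in> I - {j}" for i using fun_cong[OF eq, of i] that by simp
      have "q dvd (b + (\<Sum>i\<in>I. c i * m i)) - (b + (\<Sum>i\<in>I. c i * m' i))"
        using m m' by (intro dvd_diff) auto
      also have "(b + (\<Sum>i\<in>I. c i * m i)) - (b + (\<Sum>i\<in>I. c i * m' i)) = (\<Sum>i\<in>I. c i * (m i - m' i))"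
        by (simp add: right_diff_distrib sum_subtractf)
      also have "\<dots> = c j * (m j - m' j) + (\<Sum>i\<in>I - {j}. c i * (m i - m' i))"
        by (rule sum.remove) fact+
      also have "(\<Sum>i\<in>I - {j}. c i * (m i - m' i)) = 0" using e by (intro sum.neutral) simp
      finally have "q dvd c j * (m j - m' j)" by simp
      then have "q dvd m j - m' j" by (simp add: coprime_dvd_mult_right_iff[OF assms(3)])
      then have "m j mod q = m' j mod q" by (simp add: mod_eq_dvd_iff)
      moreover have "m j \<in> {0..<q}" "m' j \<in> {0..<q}" using m m' assms(2) by auto
      ultimately have "m j = m' j" by simp
      then have "m i = m' i" if "i \<in> I" for i using e that by (cases "i = j") auto
      then show "m = m'" using m m' by (auto intro!: PiE_ext[of m I _ m'])
    qed
    show "(\<lambda>m. restrict m (I - {j})) ` ?A \<subseteq> ?B"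
      unfolding image_subset_iff restrict_PiE_iff by blast
    show "finite ?B" using assms(1) by (intro finite_PiE) auto
  qed
  also have "card ?B = nat q ^ (card I - 1)"
    using assms by (simp add: card_PiE)
  finally show ?thesis .
qed

lemma card_avoiding_ge:
  assumes "finite R" "finite K" "\<And>k. k \<in> K \<Longrightarrow> card {m \<in> R. P k m} \<le> B"
  shows "card R \<le> card {m \<in> R. \<forall>k\<in>K. \<not> P k m} + card K * B"
proof -
  have "card R \<le> card ({m \<in> R. \<forall>k\<in>K. \<not> P k m} \<union> (\<Union>k\<in>K. {m \<in> R. P k m}))"
    using assms(1,2) by (intro card_mono) auto
  then have "card R \<le> card {m \<in> R. \<forall>k\<in>K. \<not> P k m} + card (\<Union>k\<in>K. {m \<in> R. P k m})"
    using card_Un_le order_trans by blast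
  moreover have "card (\<Union>k\<in>K. {m \<in> R. P k m}) \<le> (\<Sum>k\<in>K. card {m \<in> R. P k m})"
    by (rule card_UN_le[OF assms(2)])
  moreover have "(\<Sum>k\<in>K. card {m \<in> R. P k m}) \<le> card K * B"
    using sum_bounded_above[of K "\<lambda>k. card {m \<in> R. P k m}" B] assms(3) by simp
  ultimately show ?thesis by linarith
qed

lemma card_E7_positive_le: "card (set E7_positive) \<le> 63"
proof -
  have "length E7_positive = 63" by code_simp
  then show ?thesis using card_length[of E7_positive] by simp
qed

lemma of_int_divide_Ints_iff:
  assumes "0 < q" shows "real_of_int n / real_of_int q \<in> \<int> \<longleftrightarrow> q dvd n"
proof
  assume "real_of_int n / real_of_int q \<in> \<int>"
  then obtain k where "real_of_int n / real_of_int q = of_int k" by (rule Ints_cases)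
  then have "real_of_int n = of_int (k * q)" using assms by (simp add: field_simps)
  then have "n = k * q" by (simp only: of_int_eq_iff)
  then show "q dvd n" by simp
qed (use assms in auto)

text \<open>Every root has a coefficient \<open>\<plusminus>1\<close>.\<close>

lemma unit_coeff: "\<forall>c\<in>set E7_positive. \<not> (\<forall>i\<in>set [1,2,3,4,5,6,7]. \<bar>c ! (i - 1)\<bar> \<noteq> 1)"
  by code_simp

text \<open>On flip-fixed classes a root becomes a linear form in four coordinates, see \<open>half_extension_sum\<close>; \<open>r\<close>
  lists its coefficients. It is constant or has a coefficient \<open>\<plusminus>1\<close> or \<open>\<plusminus>3\<close>. The coefficient 3 is needed for
  the single root \<open>[1, 2, 2, 3, 2, 1, 0]\<close> and makes multiples of 3 exceptional.\<close>

lemma restricted_unit_coeff: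
  "\<forall>c\<in>set E7_positive.
     let r = [c ! 0 + c ! 5 - 2 * c ! 6, c ! 1 - c ! 6, c ! 2 + c ! 4 - 3 * c ! 6, c ! 3 - 2 * c ! 6]
     in r = [0, 0, 0, 0] \<and> c ! 6 = 1 \<or>
       \<not> (\<forall>i\<in>set [1,2,3,4]. \<bar>r ! (i - 1)\<bar> \<noteq> 1 \<and> \<bar>r ! (i - 1)\<bar> \<noteq> 3)"
  by code_simp

lemma coprime_1_or_3:
  fixes a q :: int
  assumes "\<bar>a\<bar> = 1 \<or> \<bar>a\<bar> = 3" "\<not> 3 dvd q" shows "coprime q a"
proof -
  have "coprime 3 q" using assms(2) by (intro prime_imp_coprime) simp_all
  then have "coprime q 3" by (simp only: coprime_commute)
  moreover have "a = 1 \<or> a = - 1 \<or> a = 3 \<or> a = - 3" using assms(1) by linarith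
  ultimately show ?thesis by auto
qed

lemma sum_1_4: "(\<Sum>i\<in>{1..4::nat}. f i) = f 1 + f 2 + f 3 + f 4" for f :: "nat \<Rightarrow> 'b::comm_monoid_add"
proof -
  have "{1..4::nat} = {1, 2, 3, 4}" by auto
  then show ?thesis by (simp add: add.assoc)
qed

context E7
begin

context
  fixes q :: int
  assumes q: "0 < q"
begin

definition admissible :: "(nat \<Rightarrow> int) \<Rightarrow> bool" where
  "admissible m \<longleftrightarrow> (\<forall>c\<in>set E7_positive. \<not> q dvd (\<Sum>i\<in>{1..7}. c ! (i - 1) * m i))"

lemma comb_point: "comb c \<bullet> point m = real_of_int (\<Sum>i\<in>{1..7}. c ! (i - 1) * m i)"
  unfolding comb_inner of_int_sum by (rule sum.cong) (simp_all add: point_coord[OF q])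

lemma point_regular_iff: "regular q (point m) \<longleftrightarrow> admissible m"
proof -
  have "regular q (point m) \<longleftrightarrow> (\<forall>c\<in>set E7_positive. comb c \<bullet> point m / q \<notin> \<int>)"
  proof
    assume "\<forall>c\<in>set E7_positive. comb c \<bullet> point m / q \<notin> \<int>"
    then show "regular q (point m)"
      unfolding regular_def[OF q]
      by (auto elim!: positive_root_cases)
  qed (use positive_root_in in \<open>auto simp: regular_def[OF q]\<close>)
  then show ?thesis
    unfolding admissible_def comb_point of_int_divide_Ints_iff[OF q] .
qed

lemma point_cong_iff:
  "coset (scaled_lattice \<Phi> q) (point m) = coset (scaled_lattice \<Phi> q) (point m') \<longleftrightarrow>
     (\<forall>i\<in>{1..7}. q dvd m i - m' i)"
proof -
  have c: "\<alpha> i \<bullet> ((1 / real_of_int q) *\<^sub>R (point m - point m')) = real_of_int (m i - m' i) / q"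
    if "i \<in> {1..7}" for i
    using that by (simp add: inner_diff_right point_coord[OF q])
  show ?thesis
    unfolding lattice_coset_eq_iff[OF q] lattice_iff[OF q] coweight_iff
    by (rule ball_cong[OF refl]) (simp only: c of_int_divide_Ints_iff[OF q])
qed

abbreviation point_class :: "(nat \<Rightarrow> int) \<Rightarrow> 'a set" where
  "point_class m \<equiv> coset (scaled_lattice \<Phi> q) (point m)"

lemma admissible_cong:
  assumes "admissible m" "\<forall>i\<in>{1..7}. q dvd m i - m' i" shows "admissible m'"
proof -
  have "point_class m' = point_class m" using assms(2) point_cong_iff by metis
  then have "point m' - point m \<in> scaled_lattice \<Phi> q" by (simp only: lattice_coset_eq_iff[OF q])
  then show ?thesis using regular_cong[OF q] assms(1) point_regular_iff by blast
qed

lemma eq_if_dvd_diff: "a \<in> {0..<q} \<Longrightarrow> b \<in> {0..<q} \<Longrightarrow> q dvd a - b \<Longrightarrow> a = b"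
  by (metis atLeastLessThan_iff mod_eq_dvd_iff mod_pos_pos_trivial)

text \<open>Residues of the values of the simple roots are coordinates on \<open>Z / q Z\<close>.\<close>

lemma M_bij: "bij_betw point_class {m \<in> PiE {1..7} (\<lambda>_. {0..<q}). admissible m} (M \<Phi> q)"
  unfolding bij_betw_def
proof
  let ?R = "{m \<in> PiE {1..7} (\<lambda>_. {0..<q}). admissible m}"
  show "inj_on point_class ?R"
  proof (rule inj_onI)
    fix m m' assume m: "m \<in> ?R" "m' \<in> ?R" "point_class m = point_class m'"
    have "m i = m' i" if "i \<in> {1..7}" for i
    proof (rule eq_if_dvd_diff)
      show "m i \<in> {0..<q}" "m' i \<in> {0..<q}" using m that by auto
      show "q dvd m i - m' i" using m(3) that unfolding point_cong_iff by blast
    qed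
    then show "m = m'" using m by (auto intro!: PiE_ext[of m "{1..7}" _ m'])
  qed
  show "point_class ` ?R = M \<Phi> q"
  proof
    show "point_class ` ?R \<subseteq> M \<Phi> q"
      unfolding M_eq[OF q] using point_coweight[OF q] point_regular_iff by blast
    show "M \<Phi> q \<subseteq> point_class ` ?R"
    proof
      fix t assume "t \<in> M \<Phi> q"
      then obtain x where x: "x \<in> coweights" "regular q x" "t = coset (scaled_lattice \<Phi> q) x"
        unfolding M_eq[OF q] by blast
      define m where "m = (\<lambda>i. \<lfloor>\<alpha> i \<bullet> x\<rfloor>)"
      have xm: "x = point m" unfolding m_def by (rule coweight_point[OF q x(1)])
      let ?m = "restrict (\<lambda>i. m i mod q) {1..7}"
      have d: "\<forall>i\<in>{1..7}. q dvd m i - ?m i" by simp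
      have "admissible ?m" using admissible_cong[OF _ d] x(2) unfolding xm point_regular_iff .
      then have "?m \<in> ?R" using q by auto
      moreover have "t = point_class ?m" unfolding x(3) xm point_cong_iff using d .
      ultimately show "t \<in> point_class ` ?R" by blast
    qed
  qed
qed

lemma M_card_bounds:
  "real_of_int q ^ 7 - 63 * real_of_int q ^ 6 \<le> card (M \<Phi> q)" "card (M \<Phi> q) \<le> real_of_int q ^ 7"
proof -
  let ?R = "PiE {1..7::nat} (\<lambda>_. {0..<q})"
  let ?P = "\<lambda>c m. q dvd (\<Sum>i\<in>{1..7}. c ! (i - 1) * m i)"
  have fin: "finite ?R" by (intro finite_PiE) auto
  have cR: "card ?R = nat q ^ 7" by (simp add: card_PiE)
  have cM: "card (M \<Phi> q) = card {m \<in> ?R. \<forall>c\<in>set E7_positive. \<not> ?P c m}"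
    using bij_betw_same_card[OF M_bij] by (simp add: admissible_def)
  have nq: "real (nat q) = real_of_int q" using q by simp
  have "card (M \<Phi> q) \<le> nat q ^ 7"
    unfolding cM cR[symmetric] by (rule card_mono[OF fin]) blast
  then have "real (card (M \<Phi> q)) \<le> real (nat q ^ 7)" by (rule of_nat_mono)
  then show "card (M \<Phi> q) \<le> real_of_int q ^ 7" by (simp only: of_nat_power nq)
  have "card ?R \<le> card {m \<in> ?R. \<forall>c\<in>set E7_positive. \<not> ?P c m} + card (set E7_positive) * nat q ^ 6"
  proof (rule card_avoiding_ge[OF fin])
    fix c assume "c \<in> set E7_positive"
    then obtain j where j: "j \<in> {1..7}" "\<bar>c ! (j - 1)\<bar> = 1"
      using unit_coeff unfolding in_1_7_iff by blast
    show "card {m \<in> ?R. ?P c m} \<le> nat q ^ 6"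
      using card_linear_congruence_le[of "{1..7}" j q "\<lambda>i. c ! (i - 1)" 0] j q
        coprime_abs_right_iff[of q "c ! (j - 1)"] by simp
  qed simp
  also have "\<dots> \<le> card (M \<Phi> q) + 63 * nat q ^ 6"
    unfolding cM using card_E7_positive_le by simp
  finally have "real (nat q ^ 7) \<le> real (card (M \<Phi> q) + 63 * nat q ^ 6)"
    unfolding cR by (rule of_nat_mono)
  then show "real_of_int q ^ 7 - 63 * real_of_int q ^ 6 \<le> card (M \<Phi> q)"
    by (simp add: nq)
qed

text \<open>The values of \<open>\<alpha> i\<close> on the point and on its image under the flip agree modulo \<open>q\<close>.\<close>

lemma flip_fixed_class_iff:
  "flip ` point_class m = point_class m \<longleftrightarrow> q dvd m 6 - m 1 \<and> q dvd m 5 - m 3 \<and>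
     q dvd 2 * (m 1 + m 2 + m 6 + m 7) + 3 * (m 3 + m 5) + 4 * m 4"
proof -
  let ?t = "2 * (m 1 + m 2 + m 6 + m 7) + 3 * (m 3 + m 5) + 4 * m 4"
  define d where "d i = [m 6 - m 1, 0, m 5 - m 3, 0, m 3 - m 5, m 1 - m 6, - ?t] ! (i - 1)" for i
  have "flip ` point_class m = point_class m \<longleftrightarrow> flip (point m) - point m \<in> scaled_lattice \<Phi> q"
    unfolding image_lattice_coset[OF q flip_isometry] lattice_coset_eq_iff[OF q] ..
  also have "\<dots> \<longleftrightarrow> (\<forall>i\<in>{1..7}. (\<alpha> i \<bullet> flip (point m) - \<alpha> i \<bullet> point m) / q \<in> \<int>)"
    unfolding lattice_iff[OF q] coweight_iff by (simp add: inner_diff_right)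
  also have "\<dots> \<longleftrightarrow> (\<forall>i\<in>{1..7}. q dvd d i)"
  proof -
    have "\<forall>i\<in>{1..7}. \<alpha> i \<bullet> flip (point m) - \<alpha> i \<bullet> point m = real_of_int (d i)"
      unfolding ball_1_7
      by (simp add: simple_flip[OF q] affine_flip_def affine_root_simple affine_root_0_inner point_coord[OF q] d_def)
    then show ?thesis using of_int_divide_Ints_iff[OF q] by simp
  qed
  also have "\<dots> \<longleftrightarrow> q dvd m 6 - m 1 \<and> q dvd m 5 - m 3 \<and> q dvd ?t"
    unfolding ball_1_7
    using dvd_diff_commute[of q "m 3" "m 5"] dvd_diff_commute[of q "m 1" "m 6"]
    by (auto simp: d_def simp del: minus_add_distrib)
  finally show ?thesis .
qed

context
  fixes h :: int
  assumes h: "q = 2 * h"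
begin

text \<open>The coordinates of a regular flip-fixed class in terms of the first four; why the last one is
  determined is explained at \<open>fixed_bij\<close>.\<close>

definition half_extension :: "(nat \<Rightarrow> int) \<Rightarrow> nat \<Rightarrow> int" where
  "half_extension m i =
     [m 1, m 2, m 3, m 4, m 3, m 1, h - (2 * m 1 + m 2 + 3 * m 3 + 2 * m 4)] ! (i - 1)"

lemma half_extension_sum:
  "(\<Sum>i\<in>{1..7}. c ! (i - 1) * half_extension m i) = c ! 6 * h +
     (\<Sum>i\<in>{1..4}. [c ! 0 + c ! 5 - 2 * c ! 6, c ! 1 - c ! 6, c ! 2 + c ! 4 - 3 * c ! 6,
        c ! 3 - 2 * c ! 6] ! (i - 1) * m i)"
  unfolding sum_1_7 sum_1_4 by (simp add: half_extension_def algebra_simps One_nat_def)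

lemma half_extension_flip: "flip ` point_class (half_extension m) = point_class (half_extension m)"
  unfolding flip_fixed_class_iff using h by (simp add: half_extension_def algebra_simps)

text \<open>On a fixed class the coordinates 1, 6 and 3, 5 agree, and twice the sum
  \<open>2 m1 + m2 + 3 m3 + 2 m4 + m7\<close> vanishes modulo \<open>q = 2 h\<close>. So this sum is 0 or \<open>h\<close> modulo \<open>q\<close>. It is
  the value of a root, which excludes 0 on a regular class and leaves \<open>h\<close>.\<close>

lemma fixed_bij:
  "bij_betw (\<lambda>m. point_class (half_extension m))
     {m \<in> PiE {1..4} (\<lambda>_. {0..<q}). admissible (half_extension m)} {t \<in> M \<Phi> q. flip ` t = t}"
  unfolding bij_betw_def
proof
  let ?R = "{m \<in> PiE {1..4} (\<lambda>_. {0..<q}). admissible (half_extension m)}"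
  let ?f = "\<lambda>m. point_class (half_extension m)"
  have cong: "?f m = ?f m' \<Longrightarrow> \<forall>i\<in>{1..4}. q dvd m i - m' i" for m m'
  proof -
    assume "?f m = ?f m'"
    then have *: "\<forall>i\<in>{1..7}. q dvd half_extension m i - half_extension m' i"
      by (simp only: point_cong_iff)
    have "{1..4::nat} = {1, 2, 3, 4}" by auto
    then show ?thesis using * unfolding ball_1_7 by (simp add: half_extension_def)
  qed
  show "inj_on ?f ?R"
  proof (rule inj_onI)
    fix m m' assume m: "m \<in> ?R" "m' \<in> ?R" "?f m = ?f m'"
    have "m i = m' i" if "i \<in> {1..4}" for i
    proof (rule eq_if_dvd_diff)
      show "m i \<in> {0..<q}" "m' i \<in> {0..<q}" using m that by auto
      show "q dvd m i - m' i" using cong[OF m(3)] that by blast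
    qed
    then show "m = m'" using m by (auto intro!: PiE_ext[of m "{1..4}" _ m'])
  qed
  show "?f ` ?R = {t \<in> M \<Phi> q. flip ` t = t}"
  proof
    show "?f ` ?R \<subseteq> {t \<in> M \<Phi> q. flip ` t = t}"
    proof (rule image_subsetI)
      fix m assume "m \<in> ?R"
      then have "half_extension m \<in> {m. admissible m}" by simp
      then have "?f m \<in> M \<Phi> q"
        unfolding M_eq[OF q] using point_coweight[OF q] point_regular_iff by blast
      then show "?f m \<in> {t \<in> M \<Phi> q. flip ` t = t}" using half_extension_flip by blast
    qed
    show "{t \<in> M \<Phi> q. flip ` t = t} \<subseteq> ?f ` ?R"
    proof
      fix t assume t: "t \<in> {t \<in> M \<Phi> q. flip ` t = t}"
      then obtain m where m: "m \<in> PiE {1..7} (\<lambda>_. {0..<q})" "admissible m" "t = point_class m"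
        using M_bij unfolding bij_betw_def by blast
      have "flip ` point_class m = point_class m" using t m(3) by simp
      then have d: "q dvd m 6 - m 1" "q dvd m 5 - m 3"
        and d7: "q dvd 2 * (m 1 + m 2 + m 6 + m 7) + 3 * (m 3 + m 5) + 4 * m 4"
        unfolding flip_fixed_class_iff by blast+
      have "m i \<in> {0..<q}" if "i \<in> {1..7}" for i using m(1) that by blast
      then have e: "m 6 = m 1" "m 5 = m 3"
        using eq_if_dvd_diff[OF _ _ d(1)] eq_if_dvd_diff[OF _ _ d(2)] by simp_all
      let ?s = "2 * m 1 + m 2 + 3 * m 3 + 2 * m 4 + m 7"
      have "2 * h dvd 2 * ?s" using d7 unfolding e h by (simp add: algebra_simps)
      then have "h dvd ?s" by (simp only: dvd_mult_cancel_left) simp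
      then obtain k where k: "?s = h * k" by (rule dvdE)
      have "[1, 1, 2, 2, 1, 1, 1] \<in> set E7_positive" by code_simp
      \<comment> \<open>With \<open>m 6 = m 1\<close> and \<open>m 5 = m 3\<close> this root takes the value \<open>h * k\<close> on the point.\<close>
      then have "\<not> q dvd (\<Sum>i\<in>{1..7}. [1, 1, 2, 2, 1, 1, 1] ! (i - 1) * m i)"
        using m(2) unfolding admissible_def by blast
      then have "\<not> 2 * h dvd h * k"
        unfolding sum_1_7 k[symmetric] h by (simp add: e algebra_simps)
      then have "odd k" by (auto simp: mult.commute)
      then obtain l where "k = 2 * l + 1" by (rule oddE)
      then have d': "q dvd m 7 - (h - (2 * m 1 + m 2 + 3 * m 3 + 2 * m 4))"
        using k unfolding h by (intro dvdI[of _ _ l]) (simp add: algebra_simps)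
      let ?m = "restrict m {1..4}"
      have D: "\<forall>i\<in>{1..7}. q dvd m i - half_extension ?m i"
        unfolding ball_1_7 using d' by (simp add: half_extension_def e)
      have "?m \<in> ?R"
        using admissible_cong[OF m(2) D] m(1) by auto
      moreover have "t = ?f ?m" unfolding m(3) point_cong_iff using D .
      ultimately show "t \<in> ?f ` ?R" by blast
    qed
  qed
qed

text \<open>A root whose restricted form is constant has the value \<open>h\<close>, which is not divisible by \<open>2 h\<close>. Each of
  the others excludes at most \<open>q ^ 3\<close> points.\<close>

lemma fixed_card_bounds:
  "\<not> 3 dvd q \<Longrightarrow> real_of_int q ^ 4 - 63 * real_of_int q ^ 3 \<le> card {t \<in> M \<Phi> q. flip ` t = t}"
  "card {t \<in> M \<Phi> q. flip ` t = t} \<le> real_of_int q ^ 4"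
proof -
  let ?R = "PiE {1..4::nat} (\<lambda>_. {0..<q})" and ?F = "{t \<in> M \<Phi> q. flip ` t = t}"
  let ?P = "\<lambda>c m. q dvd (\<Sum>i\<in>{1..7}. c ! (i - 1) * half_extension m i)"
  have fin: "finite ?R" by (intro finite_PiE) auto
  have cR: "card ?R = nat q ^ 4" by (simp add: card_PiE)
  have cF: "card ?F = card {m \<in> ?R. \<forall>c\<in>set E7_positive. \<not> ?P c m}"
    using bij_betw_same_card[OF fixed_bij] by (simp add: admissible_def)
  have nq: "real (nat q) = real_of_int q" using q by simp
  have "card ?F \<le> nat q ^ 4"
    unfolding cF cR[symmetric] by (rule card_mono[OF fin]) blast
  then have "real (card ?F) \<le> real (nat q ^ 4)" by (rule of_nat_mono)
  then show "card ?F \<le> real_of_int q ^ 4" by (simp only: of_nat_power nq)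
  assume q3: "\<not> 3 dvd q"
  have "card ?R \<le> card {m \<in> ?R. \<forall>c\<in>set E7_positive. \<not> ?P c m} + card (set E7_positive) * nat q ^ 3"
  proof (rule card_avoiding_ge[OF fin])
    fix c assume "c \<in> set E7_positive"
    define r where "r = [c ! 0 + c ! 5 - 2 * c ! 6, c ! 1 - c ! 6, c ! 2 + c ! 4 - 3 * c ! 6,
        c ! 3 - 2 * c ! 6]"
    have P: "?P c m \<longleftrightarrow> q dvd c ! 6 * h + (\<Sum>i\<in>{1..4}. r ! (i - 1) * m i)" for m
      unfolding half_extension_sum r_def ..
    have "r = [0, 0, 0, 0] \<and> c ! 6 = 1 \<or>
        \<not> (\<forall>i\<in>set [1,2,3,4]. \<bar>r ! (i - 1)\<bar> \<noteq> 1 \<and> \<bar>r ! (i - 1)\<bar> \<noteq> 3)"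
      using bspec[OF restricted_unit_coeff \<open>c \<in> set E7_positive\<close>] unfolding Let_def r_def .
    then show "card {m \<in> ?R. ?P c m} \<le> nat q ^ 3"
    proof
      assume "r = [0, 0, 0, 0] \<and> c ! 6 = 1"
      then have "\<not> ?P c m" for m
        unfolding P sum_1_4 using q h by (auto dest!: zdvd_imp_le)
      then show ?thesis by simp
    next
      assume "\<not> (\<forall>i\<in>set [1,2,3,4]. \<bar>r ! (i - 1)\<bar> \<noteq> 1 \<and> \<bar>r ! (i - 1)\<bar> \<noteq> 3)"
      then obtain j where "j \<in> set [1, 2, 3, 4]" "\<bar>r ! (j - 1)\<bar> = 1 \<or> \<bar>r ! (j - 1)\<bar> = 3" by blast
      then have "j \<in> {1..4}" "coprime q (r ! (j - 1))" using coprime_1_or_3 q3 by auto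
      then show ?thesis
        unfolding P
        using card_linear_congruence_le[of "{1..4}" j q "\<lambda>i. r ! (i - 1)" "c ! 6 * h"] q by simp
    qed
  qed simp
  also have "\<dots> \<le> card ?F + 63 * nat q ^ 3"
    unfolding cF using card_E7_positive_le by simp
  finally have "real (nat q ^ 4) \<le> real (card ?F + 63 * nat q ^ 3)"
    unfolding cR by (rule of_nat_mono)
  then show "real_of_int q ^ 4 - 63 * real_of_int q ^ 3 \<le> card ?F"
    by (simp add: nq)
qed

end
end
end

section \<open>Group orders from asymptotics, and the characters\<close>

lemma gcd_12_mod: "gcd 12 q = gcd 12 (q mod 12)" for q :: int
  by (metis gcd.commute gcd_mod_left zero_neq_numeral)

lemma gcd_12_values:
  "gcd 12 (0::int) = 12" "gcd 12 (1::int) = 1" "gcd 12 (2::int) = 2" "gcd 12 (3::int) = 3"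
  "gcd 12 (4::int) = 4" "gcd 12 (5::int) = 1" "gcd 12 (6::int) = 6" "gcd 12 (7::int) = 1"
  "gcd 12 (8::int) = 4" "gcd 12 (9::int) = 3" "gcd 12 (10::int) = 2" "gcd 12 (11::int) = 1"
  by code_simp+

text \<open>Rows of the table with the same \<open>gcd\<close> coincide.\<close>

lemma quasi_poly_33422211:
  fixes q :: int
  shows "gcd 12 q = 1 \<Longrightarrow> quasi_poly table_33422211 q =
      (q-1)*(q-5)*(q-7)*(q-9)*(q-11)*(q-13)*(q-17)"
    and "gcd 12 q = 2 \<Longrightarrow> quasi_poly table_33422211 q =
      (q-2)*(q-10)*(q-13)*(q-14)*(q^3 - 24*q^2 + 155*q - 342)"
    and "gcd 12 q = 3 \<Longrightarrow> quasi_poly table_33422211 q =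
      (q-3)*(q-9)*(q-15)*(q^4 - 36*q^3 + 438*q^2 - 2052*q + 2289)"
    and "gcd 12 q = 4 \<Longrightarrow> quasi_poly table_33422211 q =
      (q-4)*(q-5)*(q-8)*(q-16)*(q^3 - 30*q^2 + 263*q - 504)"
    and "gcd 12 q = 6 \<Longrightarrow> quasi_poly table_33422211 q =
      (q-6)*(q^6 - 57*q^5 + 1275*q^4 - 14085*q^3 + 79374*q^2 - 213228*q + 234360)"
    and "gcd 12 q = 12 \<Longrightarrow> quasi_poly table_33422211 q =
      (q-12)*(q^6 - 51*q^5 + 1005*q^4 - 9675*q^3 + 47784*q^2 - 116064*q + 120960)"
proof -
  have row: "quasi_poly table_33422211 q = horner_sum id q c"
    if "gcd 12 q = g" "(g, c) \<in> set
      [(1, [-765765, 1286963, -663957, 162939, -21735, 1617, -63, 1]),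
       (2, [-1244880, 1495808, -689472, 163884, -21735, 1617, -63, 1]),
       (3, [-927045, 1304883, -663957, 162939, -21735, 1617, -63, 1]),
       (4, [-1290240, 1495808, -689472, 163884, -21735, 1617, -63, 1]),
       (6, [-1406160, 1513728, -689472, 163884, -21735, 1617, -63, 1]),
       (12, [-1451520, 1513728, -689472, 163884, -21735, 1617, -63, 1])]" for g c
    using that unfolding gcd_12_mod[of q]
    by (rule_tac int_mod_12_cases[of q])
       (auto simp add: gcd_12_values quasi_poly_def table_33422211_def)
  show "quasi_poly table_33422211 q = (q-1)*(q-5)*(q-7)*(q-9)*(q-11)*(q-13)*(q-17)" if g: "gcd 12 q = 1"
    by (subst row[OF g], simp, unfold horner_sum_simps id_apply, algebra)
  show "quasi_poly table_33422211 q = (q-2)*(q-10)*(q-13)*(q-14)*(q^3 - 24*q^2 + 155*q - 342)" if g: "gcd 12 q = 2"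
    by (subst row[OF g], simp, unfold horner_sum_simps id_apply, algebra)
  show "quasi_poly table_33422211 q = (q-3)*(q-9)*(q-15)*(q^4 - 36*q^3 + 438*q^2 - 2052*q + 2289)" if g: "gcd 12 q = 3"
    by (subst row[OF g], simp, unfold horner_sum_simps id_apply, algebra)
  show "quasi_poly table_33422211 q = (q-4)*(q-5)*(q-8)*(q-16)*(q^3 - 30*q^2 + 263*q - 504)" if g: "gcd 12 q = 4"
    by (subst row[OF g], simp, unfold horner_sum_simps id_apply, algebra)
  show "quasi_poly table_33422211 q = (q-6)*(q^6 - 57*q^5 + 1275*q^4 - 14085*q^3 + 79374*q^2 - 213228*q + 234360)" if g: "gcd 12 q = 6"
    by (subst row[OF g], simp, unfold horner_sum_simps id_apply, algebra)
  show "quasi_poly table_33422211 q = (q-12)*(q^6 - 51*q^5 + 1005*q^4 - 9675*q^3 + 47784*q^2 - 116064*q + 120960)" if g: "gcd 12 q = 12"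
    by (subst row[OF g], simp, unfold horner_sum_simps id_apply, algebra)
qed

lemma double_mod_12: "(2 * h) mod 12 = (2 * (h mod 12)) mod 12" for h :: int
  by (simp add: mod_mult_right_eq)

lemma quasi_poly_32211:
  fixes q h :: int
  assumes "q = 2 * h"
  shows "gcd 12 q = 2 \<Longrightarrow> 16 * quasi_poly table_32211 h = (q-2)*(q-10)^2*(q-14)"
    and "gcd 12 q = 4 \<Longrightarrow> 16 * quasi_poly table_32211 h = (q-4)*(q-8)^2*(q-16)"
    and "gcd 12 q = 6 \<Longrightarrow> 16 * quasi_poly table_32211 h = (q-6)*(q^3 - 30*q^2 + 268*q - 552)"
    and "gcd 12 q = 12 \<Longrightarrow> 16 * quasi_poly table_32211 h = (q-12)*(q^3 - 24*q^2 + 160*q - 384)"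
proof -
  have row: "quasi_poly table_32211 h = horner_sum id h c"
    if "gcd 12 q = g" "(g, c) \<in> set
      [(2, [175, -270, 112, -18, 1]),
       (4, [256, -288, 112, -18, 1]),
       (6, [207, -270, 112, -18, 1]),
       (12, [288, -288, 112, -18, 1])]" for g c
    using that unfolding assms gcd_12_mod[of "2 * h"]
    by (rule_tac int_mod_12_cases[of h])
       (auto simp add: double_mod_12 gcd_12_values quasi_poly_def table_32211_def divisor_of_12_mod[of h])
  show "16 * quasi_poly table_32211 h = (q-2)*(q-10)^2*(q-14)" if g: "gcd 12 q = 2"
    unfolding assms by (subst row[OF g], simp, unfold horner_sum_simps id_apply, algebra)
  show "16 * quasi_poly table_32211 h = (q-4)*(q-8)^2*(q-16)" if g: "gcd 12 q = 4"
    unfolding assms by (subst row[OF g], simp, unfold horner_sum_simps id_apply, algebra)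
  show "16 * quasi_poly table_32211 h = (q-6)*(q^3 - 30*q^2 + 268*q - 552)" if g: "gcd 12 q = 6"
    unfolding assms by (subst row[OF g], simp, unfold horner_sum_simps id_apply, algebra)
  show "16 * quasi_poly table_32211 h = (q-12)*(q^3 - 24*q^2 + 160*q - 384)" if g: "gcd 12 q = 12"
    unfolding assms by (subst row[OF g], simp, unfold horner_sum_simps id_apply, algebra)
qed

context E7
begin

text \<open>Both sides of \<open>card_M\<close> are compared along a sequence on which the number of solutions is a polynomial.\<close>

lemma card_weyl: "card (weyl) = 2903040"
proof -
  define K where "K = real (card (weyl))"
  define P where "P = (\<lambda>x::real. (x-2)*(x-10)*(x-13)*(x-14)*(x^3 - 24*x^2 + 155*x - 342))"
  define x where "x = (\<lambda>k. 12 * real k + 2)"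
  define m where "m = (\<lambda>k. real (card (M \<Phi> (12 * int k + 2))))"
  have eq: "K * P (x k) = 2903040 * m k" for k
  proof -
    let ?q = "12 * int k + 2" and ?n = "num_solutions [3, 3, 4, 2, 2, 2, 1, 1] (12 * k + 2)"
    have q: "0 < ?q" by simp
    have nq: "nat ?q = 12 * k + 2" by simp
    have g: "gcd 12 ?q = 2"
      unfolding gcd_12_mod[of ?q] by (simp add: gcd_12_values)
    have "card (weyl) * ?n = 2 * card (M \<Phi> ?q)"
      using card_M[OF q] unfolding card_level[OF q] nq .
    then have n: "K * real ?n = 2 * m k"
      unfolding K_def m_def of_nat_mult[symmetric] by simp
    have iq: "int (12 * k + 2) = ?q" by simp
    have "1451520 * int ?n = quasi_poly table_33422211 ?q"
      unfolding iq[symmetric] by (rule num_solutions_33422211) simp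
    then have "real_of_int (1451520 * int ?n) =
        real_of_int ((?q-2)*(?q-10)*(?q-13)*(?q-14)*(?q^3 - 24*?q^2 + 155*?q - 342))"
      unfolding quasi_poly_33422211(2)[OF g] by (rule arg_cong)
    then have "P (x k) = 1451520 * real ?n" by (simp add: P_def x_def)
    then have "K * P (x k) = 1451520 * (K * real ?n)" by simp
    then show ?thesis unfolding n by simp
  qed
  have lim1: "(\<lambda>k. K * (P (x k) / x k ^ 7)) \<longlonglongrightarrow> K * 1"
    unfolding P_def x_def by (intro tendsto_mult tendsto_const) real_asymp
  have "(\<lambda>k. m k / x k ^ 7) \<longlonglongrightarrow> 1"
  proof (rule tendsto_sandwich)
    have b: "x k ^ 7 - 63 * x k ^ 6 \<le> m k" "m k \<le> x k ^ 7" for k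
      using M_card_bounds[of "12 * int k + 2"] by (simp_all add: m_def x_def)
    have p: "0 < x k" for k by (simp add: x_def)
    show "\<forall>\<^sub>F k in sequentially. (x k ^ 7 - 63 * x k ^ 6) / x k ^ 7 \<le> m k / x k ^ 7"
      using b(1) p by (intro always_eventually allI divide_right_mono) (simp_all add: less_imp_le)
    have "m k / x k ^ 7 \<le> 1" for k
      using b(2)[of k] zero_less_power[OF p[of k], of 7] by (simp only: divide_le_eq_1_pos)
    then show "\<forall>\<^sub>F k in sequentially. m k / x k ^ 7 \<le> 1" by simp
    show "(\<lambda>k. (x k ^ 7 - 63 * x k ^ 6) / x k ^ 7) \<longlonglongrightarrow> 1" unfolding x_def by real_asymp
  qed simp
  then have lim2: "(\<lambda>k. 2903040 * (m k / x k ^ 7)) \<longlonglongrightarrow> 2903040 * 1"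
    by (intro tendsto_mult tendsto_const)
  have "(\<lambda>k. K * (P (x k) / x k ^ 7)) = (\<lambda>k. 2903040 * (m k / x k ^ 7))"
    using eq by (intro ext) simp
  then have "K * 1 = 2903040 * 1" using LIMSEQ_unique[OF lim1] lim2 by (simp only:)
  then show ?thesis by (simp add: K_def)
qed

text \<open>As for \<open>card_weyl\<close>; the values \<open>12 k + 2\<close> are even and not divisible by 3, as the lower bound in
  \<open>fixed_card_bounds\<close> requires.\<close>

lemma card_centralizer: "card centralizer = 9216"
proof -
  define K where "K = real (card centralizer)"
  define P where "P = (\<lambda>x::real. (x-2)*(x-10)^2*(x-14))"
  define x where "x = (\<lambda>k. 12 * real k + 2)"
  define m where "m = (\<lambda>k. real (card {t \<in> M \<Phi> (12 * int k + 2). flip ` t = t}))"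
  have eq: "K * P (x k) = 9216 * m k" for k
  proof -
    let ?q = "12 * int k + 2" and ?h = "6 * int k + 1"
      and ?n = "num_solutions [3, 2, 2, 1, 1] (6 * k + 1)"
    have q: "0 < ?q" and h: "?q = 2 * ?h" by simp_all
    have nh: "nat ?h = 6 * k + 1" by simp
    have g: "gcd 12 ?q = 2"
      unfolding gcd_12_mod[of ?q] by (simp add: gcd_12_values)
    have "card centralizer * ?n = 2 * card {t \<in> M \<Phi> ?q. flip ` t = t}"
      using card_fixed[OF q] bij_betw_same_card[OF fixed_level_bij[OF q h]] unfolding nh by simp
    then have n: "K * real ?n = 2 * m k"
      unfolding K_def m_def of_nat_mult[symmetric] by simp
    have ih: "int (6 * k + 1) = ?h" by simp
    have "288 * int ?n = quasi_poly table_32211 ?h"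
      unfolding ih[symmetric] by (rule num_solutions_32211) simp
    then have "16 * (288 * int ?n) = (?q-2)*(?q-10)^2*(?q-14)"
      using quasi_poly_32211(1)[OF h g] by simp
    then have "real_of_int (16 * (288 * int ?n)) = real_of_int ((?q-2)*(?q-10)^2*(?q-14))"
      by (rule arg_cong)
    then have "P (x k) = 4608 * real ?n" by (simp add: P_def x_def)
    then have "K * P (x k) = 4608 * (K * real ?n)" by simp
    then show ?thesis unfolding n by simp
  qed
  have lim1: "(\<lambda>k. K * (P (x k) / x k ^ 4)) \<longlonglongrightarrow> K * 1"
    unfolding P_def x_def by (intro tendsto_mult tendsto_const) real_asymp
  have "(\<lambda>k. m k / x k ^ 4) \<longlonglongrightarrow> 1"
  proof (rule tendsto_sandwich)
    have b: "x k ^ 4 - 63 * x k ^ 3 \<le> m k" "m k \<le> x k ^ 4" for k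
    proof -
      have n3: "\<not> 3 dvd 12 * int k + 2" by presburger
      have xi: "real_of_int (12 * int k + 2) = x k" by (simp add: x_def)
      have q: "0 < 12 * int k + 2" and h: "12 * int k + 2 = 2 * (6 * int k + 1)" by simp_all
      show "x k ^ 4 - 63 * x k ^ 3 \<le> m k" "m k \<le> x k ^ 4"
        using fixed_card_bounds[OF q h] n3 unfolding xi m_def by blast+
    qed
    have p: "0 < x k" for k by (simp add: x_def)
    show "\<forall>\<^sub>F k in sequentially. (x k ^ 4 - 63 * x k ^ 3) / x k ^ 4 \<le> m k / x k ^ 4"
      using b(1) p by (intro always_eventually allI divide_right_mono) (simp_all add: less_imp_le)
    have "m k / x k ^ 4 \<le> 1" for k
      using b(2)[of k] zero_less_power[OF p[of k], of 4] by (simp only: divide_le_eq_1_pos)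
    then show "\<forall>\<^sub>F k in sequentially. m k / x k ^ 4 \<le> 1" by simp
    show "(\<lambda>k. (x k ^ 4 - 63 * x k ^ 3) / x k ^ 4) \<longlonglongrightarrow> 1" unfolding x_def by real_asymp
  qed simp
  then have lim2: "(\<lambda>k. 9216 * (m k / x k ^ 4)) \<longlonglongrightarrow> 9216 * 1"
    by (intro tendsto_mult tendsto_const)
  have "(\<lambda>k. K * (P (x k) / x k ^ 4)) = (\<lambda>k. 9216 * (m k / x k ^ 4))"
    using eq by (intro ext) simp
  then have "K * 1 = 9216 * 1" using LIMSEQ_unique[OF lim1] lim2 by (simp only:)
  then show ?thesis by (simp add: K_def)
qed

lemma chi_id_quasi_poly:
  assumes q: "0 < q" shows "chi \<Phi> q id = quasi_poly table_33422211 q"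
proof -
  have "card (M \<Phi> q) = 1451520 * num_solutions [3, 3, 4, 2, 2, 2, 1, 1] (nat q)"
    using card_M[OF q] unfolding card_level[OF q] card_weyl by simp
  then show ?thesis
    using num_solutions_33422211[of "nat q"] q by (simp add: chi_def)
qed

lemmas chi_id = chi_id_quasi_poly[THEN trans, OF _ quasi_poly_33422211(1)]
  chi_id_quasi_poly[THEN trans, OF _ quasi_poly_33422211(2)]
  chi_id_quasi_poly[THEN trans, OF _ quasi_poly_33422211(3)]
  chi_id_quasi_poly[THEN trans, OF _ quasi_poly_33422211(4)]
  chi_id_quasi_poly[THEN trans, OF _ quasi_poly_33422211(5)]
  chi_id_quasi_poly[THEN trans, OF _ quasi_poly_33422211(6)]

lemma chi_flip_odd:
  assumes "0 < q" "gcd 12 q \<in> {1, 3}" shows "chi \<Phi> q flip = 0"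
proof -
  have "gcd 12 q = 1 \<or> gcd 12 q = 3" using assms(2) by blast
  then have "odd (gcd 12 q)" by (rule disjE) (simp_all only: odd_one odd_numeral not_False_eq_True)
  then have "odd q" by simp
  then show ?thesis
    using card_fixed[OF assms(1)] unfolding no_flip_fixed_level[OF assms(1) \<open>odd q\<close>] chi_def by simp
qed

lemma chi_flip_quasi_poly:
  assumes q: "0 < q" and h: "q = 2 * h" shows "chi \<Phi> q flip = 16 * quasi_poly table_32211 h"
proof -
  have "card {t \<in> M \<Phi> q. flip ` t = t} = 4608 * num_solutions [3, 2, 2, 1, 1] (nat h)"
    using card_fixed[OF q] bij_betw_same_card[OF fixed_level_bij[OF q h]]
    unfolding card_centralizer by simp
  moreover have "288 * int (num_solutions [3, 2, 2, 1, 1] (nat h)) = quasi_poly table_32211 h"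
    using num_solutions_32211[of "nat h"] q h by simp
  ultimately show ?thesis by (simp add: chi_def)
qed

lemma chi_flip_even:
  assumes "0 < q"
  shows "gcd 12 q = 2 \<Longrightarrow> chi \<Phi> q flip = (q-2)*(q-10)^2*(q-14)"
    and "gcd 12 q = 4 \<Longrightarrow> chi \<Phi> q flip = (q-4)*(q-8)^2*(q-16)"
    and "gcd 12 q = 6 \<Longrightarrow> chi \<Phi> q flip = (q-6)*(q^3 - 30*q^2 + 268*q - 552)"
    and "gcd 12 q = 12 \<Longrightarrow> chi \<Phi> q flip = (q-12)*(q^3 - 24*q^2 + 160*q - 384)"
proof -
  have half: "q = 2 * (q div 2)" if "even (gcd 12 q)"
    using that by simp
  note e = chi_flip_quasi_poly[OF assms half]
  show "gcd 12 q = 2 \<Longrightarrow> chi \<Phi> q flip = (q-2)*(q-10)^2*(q-14)"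
    using quasi_poly_32211(1)[OF half] e by (simp only: even_numeral)
  show "gcd 12 q = 4 \<Longrightarrow> chi \<Phi> q flip = (q-4)*(q-8)^2*(q-16)"
    using quasi_poly_32211(2)[OF half] e by (simp only: even_numeral)
  show "gcd 12 q = 6 \<Longrightarrow> chi \<Phi> q flip = (q-6)*(q^3 - 30*q^2 + 268*q - 552)"
    using quasi_poly_32211(3)[OF half] e by (simp only: even_numeral)
  show "gcd 12 q = 12 \<Longrightarrow> chi \<Phi> q flip = (q-12)*(q^3 - 24*q^2 + 160*q - 384)"
    using quasi_poly_32211(4)[OF half] e by (simp only: even_numeral)
qed

end

theorem theorem5p9:
  fixes \<Phi> :: "'a::euclidean_space set" and \<alpha> :: "nat \<Rightarrow> 'a"
  assumes "DIM('a) = 7" and "E7_root_system \<Phi> \<alpha>"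
  shows "alcove_stabilizer \<Phi> \<alpha> {1..7} = {id, omega \<alpha> {1..7} 7} \<and>
    (\<forall>\<omega> \<in> alcove_stabilizer \<Phi> \<alpha> {1..7}. \<forall>q::int. q > 0 \<longrightarrow>
      (\<omega> = id \<and> gcd 12 q = 1 \<longrightarrow>
         chi \<Phi> q \<omega> = (q-1)*(q-5)*(q-7)*(q-9)*(q-11)*(q-13)*(q-17)) \<and>
      (\<omega> = id \<and> gcd 12 q = 2 \<longrightarrow>
         chi \<Phi> q \<omega> = (q-2)*(q-10)*(q-13)*(q-14)*(q^3 - 24*q^2 + 155*q - 342)) \<and>
      (\<omega> = id \<and> gcd 12 q = 3 \<longrightarrow>
         chi \<Phi> q \<omega> = (q-3)*(q-9)*(q-15)*(q^4 - 36*q^3 + 438*q^2 - 2052*q + 2289)) \<and>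
      (\<omega> = id \<and> gcd 12 q = 4 \<longrightarrow>
         chi \<Phi> q \<omega> = (q-4)*(q-5)*(q-8)*(q-16)*(q^3 - 30*q^2 + 263*q - 504)) \<and>
      (\<omega> = id \<and> gcd 12 q = 6 \<longrightarrow>
         chi \<Phi> q \<omega> =
           (q-6)*(q^6 - 57*q^5 + 1275*q^4 - 14085*q^3 + 79374*q^2 - 213228*q + 234360)) \<and>
      (\<omega> = id \<and> gcd 12 q = 12 \<longrightarrow>
         chi \<Phi> q \<omega> =
           (q-12)*(q^6 - 51*q^5 + 1005*q^4 - 9675*q^3 + 47784*q^2 - 116064*q + 120960)) \<and>
      (\<omega> = omega \<alpha> {1..7} 7 \<and> gcd 12 q \<in> {1, 3} \<longrightarrow>
         chi \<Phi> q \<omega> = 0) \<and>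
      (\<omega> = omega \<alpha> {1..7} 7 \<and> gcd 12 q = 2 \<longrightarrow>
         chi \<Phi> q \<omega> = (q-2)*(q-10)^2*(q-14)) \<and>
      (\<omega> = omega \<alpha> {1..7} 7 \<and> gcd 12 q = 4 \<longrightarrow>
         chi \<Phi> q \<omega> = (q-4)*(q-8)^2*(q-16)) \<and>
      (\<omega> = omega \<alpha> {1..7} 7 \<and> gcd 12 q = 6 \<longrightarrow>
         chi \<Phi> q \<omega> = (q-6)*(q^3 - 30*q^2 + 268*q - 552)) \<and>
      (\<omega> = omega \<alpha> {1..7} 7 \<and> gcd 12 q = 12 \<longrightarrow>
         chi \<Phi> q \<omega> = (q-12)*(q^3 - 24*q^2 + 160*q - 384)))"
proof -
  interpret E7 \<Phi> \<alpha> using assms by unfold_locales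
  show ?thesis
    by (intro conjI ballI allI impI alcove_stabilizer_eq; elim conjE; hypsubst;
        (rule chi_id chi_flip_even chi_flip_odd; assumption))
qed

end
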